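(* There are an absolute constant $C$ and an algorithm in real arithmetic which, for all $n,d\ge 1$ and every orthogonal matrix representation $\rho:S_n\to \mathrm{O}(d)$, given as input the matrices $\rho(\tau_1),\ldots,\rho(\tau_{n-1})\in \mathrm{O}(d)$, computes, using at most $C n^2 d^3$ operations, the non-zero multiplicities $a_1,\ldots,a_r$ of the irreducible representations occurring in $\rho$; that is, it outputs the list of pairs $(\lambda^1,a_1),\ldots,(\lambda^r,a_r)$, where $\lambda^1,\ldots,\lambda^r$ are the distinct partitions of $n$ whose associated irreducible representation $\rho_{\lambda^k}$ occurs in $\rho$, and $a_k\geq 1$ is the number of times that $\rho_{\lambda^k}$ occurs.
   Context: $S_n$ is the symmetric group and $\tau_\ell=(\ell\ \ell+1)$, $\ell=1,\ldots,n-1$, are the simple transpositions. $\mathrm{O}(d)$ is the group of real orthogonal $d\times d$ matrices. An orthogonal matrix representation is a group homomorphism $\rho:S_n\to \mathrm{O}(d)$, acting on $\mathbb{R}^d$. The irreducible representations $\rho_\lambda$ of $S_n$ are indexed up to isomorphism in the usual way by the partitions $\lambda$ of $n$ (with the convention that the partition $(n)$ corresponds to the trivial representation). The decomposition of $\rho$ is $\mathbb{R}^d\cong V_1^{\oplus a_1}\oplus\cdots\oplus V_r^{\oplus a_r}$, where $V_1,\ldots,V_r$ are pairwise non-isomorphic irreducible representations, $V_k$ corresponding to $\lambda^k$. Operations are exact real-number operations (arithmetic operations, square roots, comparisons), each of unit cost. *)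

theory Defs
  imports
    Complex_Main
    "HOL-Library.Function_Algebras"
    "HOL-Algebra.Sym_Groups"
    "Jordan_Normal_Form.VS_Connect"
begin

section \<open>A machine model for exact real arithmetic\<close>

text \<open>
  A uniform real random access machine, presented as a small imperative language. The memory
  consists of arrays of reals and arrays of natural numbers (both named by strings and
  indexed by natural numbers; a scalar is entry 0 of its array), plus a write-only output tape of
  natural numbers. Natural numbers serve as addresses, as loop counters and as output. A program
  contains no real constants, and a real number influences the natural numbers and
  the control flow only through a comparison. In particular there is no rounding.

  Everything is charged: every node of every expression (constants, memory accesses, arithmetic
  operations, square roots, comparisons, Boolean connectives, and also the index computations), and
  every executed command. So the running time is an upper bound for the number of operations on reals.

  Division and square root are the total functions of the library. A program can test
  for zero or for a negative argument in constantly many steps, so this gives no additional power.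
\<close>

datatype iexp =
    IConst nat
  | IGet string iexp
  | IAdd iexp iexp
  | ISub iexp iexp
  | IMul iexp iexp

datatype rexp =
    RNat iexp
  | RGet string iexp
  | RAdd rexp rexp
  | RSub rexp rexp
  | RMul rexp rexp
  | RDiv rexp rexp
  | RSqrt rexp

datatype bexp =
    ILess iexp iexp
  | IEq iexp iexp
  | RLess rexp rexp
  | REq rexp rexp
  | BNot bexp
  | BAnd bexp bexp
  | BOr bexp bexp

datatype com =
    Skip
  | IAssign string iexp iexp
  | RAssign string iexp rexp
  | Emit iexp
  | Seq com com
  | If bexp com com
  | While bexp com

record state =
  ints :: "string \<Rightarrow> nat \<Rightarrow> nat"
  reals :: "string \<Rightarrow> nat \<Rightarrow> real"
  outp :: "nat list"

primrec ival :: "iexp \<Rightarrow> state \<Rightarrow> nat" where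
  "ival (IConst k) s = k"
| "ival (IGet x e) s = ints s x (ival e s)"
| "ival (IAdd e f) s = ival e s + ival f s"
| "ival (ISub e f) s = ival e s - ival f s"
| "ival (IMul e f) s = ival e s * ival f s"

primrec rval :: "rexp \<Rightarrow> state \<Rightarrow> real" where
  "rval (RNat e) s = real (ival e s)"
| "rval (RGet x e) s = reals s x (ival e s)"
| "rval (RAdd e f) s = rval e s + rval f s"
| "rval (RSub e f) s = rval e s - rval f s"
| "rval (RMul e f) s = rval e s * rval f s"
| "rval (RDiv e f) s = rval e s / rval f s"
| "rval (RSqrt e) s = sqrt (rval e s)"

primrec bval :: "bexp \<Rightarrow> state \<Rightarrow> bool" where
  "bval (ILess e f) s \<longleftrightarrow> ival e s < ival f s"
| "bval (IEq e f) s \<longleftrightarrow> ival e s = ival f s"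
| "bval (RLess e f) s \<longleftrightarrow> rval e s < rval f s"
| "bval (REq e f) s \<longleftrightarrow> rval e s = rval f s"
| "bval (BNot b) s \<longleftrightarrow> \<not> bval b s"
| "bval (BAnd b c) s \<longleftrightarrow> bval b s \<and> bval c s"
| "bval (BOr b c) s \<longleftrightarrow> bval b s \<or> bval c s"

primrec icost :: "iexp \<Rightarrow> nat" where
  "icost (IConst k) = 1"
| "icost (IGet x e) = 1 + icost e"
| "icost (IAdd e f) = 1 + icost e + icost f"
| "icost (ISub e f) = 1 + icost e + icost f"
| "icost (IMul e f) = 1 + icost e + icost f"

primrec rcost :: "rexp \<Rightarrow> nat" where
  "rcost (RNat e) = 1 + icost e"
| "rcost (RGet x e) = 1 + icost e"
| "rcost (RAdd e f) = 1 + rcost e + rcost f"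
| "rcost (RSub e f) = 1 + rcost e + rcost f"
| "rcost (RMul e f) = 1 + rcost e + rcost f"
| "rcost (RDiv e f) = 1 + rcost e + rcost f"
| "rcost (RSqrt e) = 1 + rcost e"

primrec bcost :: "bexp \<Rightarrow> nat" where
  "bcost (ILess e f) = 1 + icost e + icost f"
| "bcost (IEq e f) = 1 + icost e + icost f"
| "bcost (RLess e f) = 1 + rcost e + rcost f"
| "bcost (REq e f) = 1 + rcost e + rcost f"
| "bcost (BNot b) = 1 + bcost b"
| "bcost (BAnd b c) = 1 + bcost b + bcost c"
| "bcost (BOr b c) = 1 + bcost b + bcost c"

definition set_int :: "string \<Rightarrow> nat \<Rightarrow> nat \<Rightarrow> state \<Rightarrow> state" where
  "set_int x i v s = s\<lparr>ints := (ints s)(x := (ints s x)(i := v))\<rparr>"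

definition set_real :: "string \<Rightarrow> nat \<Rightarrow> real \<Rightarrow> state \<Rightarrow> state" where
  "set_real x i v s = s\<lparr>reals := (reals s)(x := (reals s x)(i := v))\<rparr>"

text \<open>\<open>exec c s t s'\<close>: started in \<open>s\<close>, the program \<open>c\<close> terminates in \<open>s'\<close> after \<open>t\<close> operations.\<close>

inductive exec :: "com \<Rightarrow> state \<Rightarrow> nat \<Rightarrow> state \<Rightarrow> bool" where
  Skip: "exec Skip s 1 s"
| IAssign: "exec (IAssign x e f) s (1 + icost e + icost f) (set_int x (ival e s) (ival f s) s)"
| RAssign: "exec (RAssign x e f) s (1 + icost e + rcost f) (set_real x (ival e s) (rval f s) s)"
| Emit: "exec (Emit e) s (1 + icost e) (s\<lparr>outp := outp s @ [ival e s]\<rparr>)"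
| Seq: "exec c1 s t1 s1 \<Longrightarrow> exec c2 s1 t2 s2 \<Longrightarrow> exec (Seq c1 c2) s (1 + t1 + t2) s2"
| IfTrue: "bval b s \<Longrightarrow> exec c1 s t s' \<Longrightarrow> exec (If b c1 c2) s (1 + bcost b + t) s'"
| IfFalse: "\<not> bval b s \<Longrightarrow> exec c2 s t s' \<Longrightarrow> exec (If b c1 c2) s (1 + bcost b + t) s'"
| WhileFalse: "\<not> bval b s \<Longrightarrow> exec (While b c) s (1 + bcost b) s"
| WhileTrue: "bval b s \<Longrightarrow> exec c s t1 s1 \<Longrightarrow> exec (While b c) s1 t2 s2 \<Longrightarrow>
    exec (While b c) s (1 + bcost b + t1 + t2) s2"

lemma exec_deterministic:
  assumes "exec c s t s'" and "exec c s u s''"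
  shows "u = t \<and> s'' = s'"
  using assms
proof (induction arbitrary: u s'' rule: exec.induct)
  case (Seq c1 s t1 s1 c2 t2 s2)
  from Seq.prems show ?case by cases (use Seq.IH in blast)
next
  case (IfTrue b s c1 t s' c2)
  from IfTrue.prems show ?case by cases (use IfTrue in blast)+
next
  case (IfFalse b s c2 t s' c1)
  from IfFalse.prems show ?case by cases (use IfFalse in blast)+
next
  case (WhileFalse b s c)
  from WhileFalse.prems show ?case by cases (use WhileFalse in simp_all)
next
  case (WhileTrue b s c t1 s1 t2 s2)
  from WhileTrue.prems show ?case by cases (use WhileTrue in blast)+
qed (erule exec.cases; simp)+

text \<open>
  The input consists of \<open>n\<close>, \<open>d\<close> and the \<open>d \<times> d\<close> matrices \<open>M 1, \<dots>, M (n - 1)\<close>, stored one after the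
  other, each in row-major order. All other memory is initially zero.
\<close>

definition init_state :: "nat \<Rightarrow> nat \<Rightarrow> (nat \<Rightarrow> real mat) \<Rightarrow> state" where
  "init_state n d M = \<lparr>
     ints = (\<lambda>x k. if x = ''n'' \<and> k = 0 then n else if x = ''d'' \<and> k = 0 then d else 0),
     reals = (\<lambda>x k. if x = ''M'' \<and> k < (n - 1) * d * d
       then M (k div (d * d) + 1) $$ ((k mod (d * d)) div d, k mod d) else 0),
     outp = []\<rparr>"

text \<open>
  On the output tape each pair of a list of naturals and a number is written as the length of the
  list, followed by its entries, followed by the number. This encoding is injective.
\<close>

definition encode :: "(nat list \<times> nat) list \<Rightarrow> nat list" where
  "encode ps = concat (map (\<lambda>(la, a). length la # la @ [a]) ps)"


section \<open>Irreducible representations of the symmetric group\<close>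

definition partitions :: "nat \<Rightarrow> nat list set" where
  "partitions n = {la. sorted_wrt (\<ge>) la \<and> (\<forall>k\<in>set la. 0 < k) \<and> sum_list la = n}"

definition cells :: "nat list \<Rightarrow> (nat \<times> nat) set" where
  "cells la = {(i, j). i < length la \<and> j < la ! i}"

text \<open>
  A tableau is given by the map sending each entry in \<open>{1..n}\<close> to its cell (row, column). Hence the tableau
  \<open>g T\<close>, in which every entry \<open>x\<close> of \<open>T\<close> is replaced by \<open>g x\<close>, is \<open>T \<circ> inv g\<close>. A tabloid (row
  equivalence class of tableaux) is the map sending each entry to its row.
\<close>

definition tableaux :: "nat \<Rightarrow> nat list \<Rightarrow> (nat \<Rightarrow> nat \<times> nat) set" where
  "tableaux n la = {T. bij_betw T {1..n} (cells la)}"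

definition tabloid :: "nat \<Rightarrow> (nat \<Rightarrow> nat \<times> nat) \<Rightarrow> (nat \<Rightarrow> nat)" where
  "tabloid n T = (\<lambda>x\<in>{1..n}. fst (T x))"

definition column_stabilizer :: "nat \<Rightarrow> (nat \<Rightarrow> nat \<times> nat) \<Rightarrow> (nat \<Rightarrow> nat) set" where
  "column_stabilizer n T = {q. q permutes {1..n} \<and> (\<forall>x\<in>{1..n}. snd (T (q x)) = snd (T x))}"

text \<open>Formal linear combinations of tabloids are real functions on tabloids.\<close>

definition polytabloid :: "nat \<Rightarrow> (nat \<Rightarrow> nat \<times> nat) \<Rightarrow> ((nat \<Rightarrow> nat) \<Rightarrow> real)" where
  "polytabloid n T = (\<lambda>r. \<Sum>q\<in>column_stabilizer n T.
     of_int (sign q) * of_bool (r = tabloid n (T \<circ> inv' q)))"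

definition fun_scale :: "real \<Rightarrow> ('a \<Rightarrow> real) \<Rightarrow> ('a \<Rightarrow> real)" where
  "fun_scale c f = (\<lambda>x. c * f x)"

interpretation fun_space: vector_space "fun_scale :: real \<Rightarrow> ('a \<Rightarrow> real) \<Rightarrow> ('a \<Rightarrow> real)"
  by unfold_locales (auto simp: fun_scale_def algebra_simps)

text \<open>
  The Specht module of shape \<open>la\<close>. The shape \<open>(n)\<close> yields the trivial representation and
  the shape \<open>(1, \<dots>, 1)\<close> the sign representation.
\<close>

definition specht_module :: "nat \<Rightarrow> nat list \<Rightarrow> ((nat \<Rightarrow> nat) \<Rightarrow> real) set" where
  "specht_module n la = fun_space.span (polytabloid n ` tableaux n la)"

text \<open>
  The permutation \<open>g\<close> sends the tabloid \<open>r\<close> to \<open>r \<circ> inv g\<close>; on formal linear combinations this is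
  precomposition with the inverse map.
\<close>

definition tabloid_action :: "(nat \<Rightarrow> nat) \<Rightarrow> ((nat \<Rightarrow> nat) \<Rightarrow> real) \<Rightarrow> ((nat \<Rightarrow> nat) \<Rightarrow> real)" where
  "tabloid_action g f = (\<lambda>r. f (r \<circ> g))"


section \<open>Orthogonal representations and multiplicities\<close>

definition orthogonal_group :: "nat \<Rightarrow> real mat monoid" where
  "orthogonal_group d =
     \<lparr>carrier = {A \<in> carrier_mat d d. A * transpose_mat A = 1\<^sub>m d}, mult = (*), one = 1\<^sub>m d\<rparr>"

definition subrepresentation ::
    "nat \<Rightarrow> nat \<Rightarrow> ((nat \<Rightarrow> nat) \<Rightarrow> real mat) \<Rightarrow> real vec set \<Rightarrow> bool" where
  "subrepresentation n d \<rho> W \<longleftrightarrow>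
     subspace class_ring W (module_vec TYPE(real) d) \<and>
     (\<forall>g\<in>carrier (sym_group n). \<forall>w\<in>W. \<rho> g *\<^sub>v w \<in> W)"

definition irreducible_subrepresentation ::
    "nat \<Rightarrow> nat \<Rightarrow> ((nat \<Rightarrow> nat) \<Rightarrow> real mat) \<Rightarrow> real vec set \<Rightarrow> bool" where
  "irreducible_subrepresentation n d \<rho> W \<longleftrightarrow>
     subrepresentation n d \<rho> W \<and> W \<noteq> {0\<^sub>v d} \<and>
     (\<forall>U. subrepresentation n d \<rho> U \<and> U \<subseteq> W \<longrightarrow> U = {0\<^sub>v d} \<or> U = W)"

text \<open>\<open>\<real>\<^sup>d\<close> is the internal direct sum of the irreducible subrepresentations in the list.\<close>

definition irreducible_decomposition ::
    "nat \<Rightarrow> nat \<Rightarrow> ((nat \<Rightarrow> nat) \<Rightarrow> real mat) \<Rightarrow> real vec set list \<Rightarrow> bool" where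
  "irreducible_decomposition n d \<rho> Ws \<longleftrightarrow>
     (\<forall>W\<in>set Ws. irreducible_subrepresentation n d \<rho> W) \<and>
     (\<forall>v\<in>carrier_vec d. \<exists>!w. w \<in> (\<Pi>\<^sub>E i\<in>{..<length Ws}. Ws ! i) \<and>
        v = finsum_vec TYPE(real) d w {..<length Ws})"

definition iso_specht ::
    "nat \<Rightarrow> ((nat \<Rightarrow> nat) \<Rightarrow> real mat) \<Rightarrow> real vec set \<Rightarrow> nat list \<Rightarrow> bool" where
  "iso_specht n \<rho> W la \<longleftrightarrow> (\<exists>f. bij_betw f W (specht_module n la) \<and>
     (\<forall>v\<in>W. \<forall>w\<in>W. f (v + w) = f v + f w) \<and>
     (\<forall>c. \<forall>w\<in>W. f (c \<cdot>\<^sub>v w) = fun_scale c (f w)) \<and>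
     (\<forall>g\<in>carrier (sym_group n). \<forall>w\<in>W. f (\<rho> g *\<^sub>v w) = tabloid_action g (f w)))"

text \<open>
  The multiplicity is stated as a relation. By Maschke and Krull-Schmidt it holds for exactly one \<open>a\<close>.
\<close>

definition has_multiplicity ::
    "nat \<Rightarrow> nat \<Rightarrow> ((nat \<Rightarrow> nat) \<Rightarrow> real mat) \<Rightarrow> nat list \<Rightarrow> nat \<Rightarrow> bool" where
  "has_multiplicity n d \<rho> la a \<longleftrightarrow> (\<exists>Ws. irreducible_decomposition n d \<rho> Ws \<and>
     a = card {i. i < length Ws \<and> iso_specht n \<rho> (Ws ! i) la})"

end

theory Submission
  imports Defs
begin

text \<open>
  Let \<open>X k\<close> be the Jucys-Murphy element, the sum of the transpositions \<open>(j k)\<close> with \<open>j < k\<close>. For a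
  partition \<open>la\<close> let \<open>W la\<close> be the joint eigenspace of the \<open>X k\<close> whose eigenvalues are the contents of the
  row reading tableau of shape \<open>la\<close>. Its vectors are the highest weight vectors: they are invariant
  under the row group, and symmetrizing them over a row together with an entry of a later row gives zero.
  These conditions determine all matrix coefficients \<open>\<langle>v, g v\<rangle>\<close> up to the factor \<open>\<langle>v, v\<rangle>\<close>, because \<open>g\<close> can be
  straightened row by row. Hence an irreducible representation with \<open>W la \<noteq> 0\<close> is unique up to
  isomorphism, and \<open>W la\<close> is then one-dimensional. The Specht module is generated by the
  orthogonal projection of a tabloid, which lies in \<open>W la\<close>; so it is this representation, and
  the multiplicity of \<open>la\<close> is the dimension of \<open>W la\<close>. Neither the irreducibility of Specht modules nor the
  completeness of their list is needed.

  The algorithm is a depth first search over row reading tableaux: starting from the whole space, the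
  next entry is placed at the end of the last row or in a new row, and the space is cut down to the kernel
  of the next Jucys-Murphy element minus the content. The two kernels are independent, so on every level the
  dimensions add up to at most \<open>d\<close>, and a level costs \<open>O(d\<^sup>3)\<close> operations on reals.
\<close>

section \<open>Spaces of finitely supported functions\<close>

text \<open>Both \<open>\<real>^d\<close> and the formal combinations of tabloids are modelled as
  functions on a finite index set, so that one locale covers the given representation and the Specht
  modules. Orthogonality carries the argument: Jucys-Murphy elements are self-adjoint and
  symmetrizers are positive, so the eigenvalue equations force invariance and annihilation without
  Young's explicit formulas. The search also enters compositions that are not partitions; positivity
  shows that their joint eigenspaces are zero, so these branches die without a test of the shape.
  The obstacle in the running time is that a level may have \<open>d\<close> nodes. A kernel on an
  \<open>m\<close>-dimensional space must therefore cost \<open>m * d^2\<close> and not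
  \<open>d^3\<close>, which is why each vector is stored together with its image and only basis
  vectors are eliminated. The Jucys-Murphy matrices and the kernels cost \<open>n * d^3\<close>
  each; copying and printing compositions costs \<open>n\<close> per node with nonzero space, hence
  \<open>n^2 * d\<close> in all, and this is the source of the square of \<open>n\<close>.\<close>

lemma fun_scale_apply: "fun_scale c f x = c * f x"
  by (simp add: fun_scale_def)

text \<open>As default simplification rules these rewrite bare functions to abstractions.\<close>

declare plus_fun_apply [simp del] zero_fun_apply [simp del]

lemmas fun_apply = plus_fun_apply zero_fun_apply fun_scale_apply minus_apply

lemma sum_fun_apply: "(\<Sum>a\<in>A. f a) x = (\<Sum>a\<in>A. f a x)" for f :: "'b \<Rightarrow> 'a \<Rightarrow> real"
  by (induction A rule: infinite_finite_induct) (auto simp: fun_apply)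

text \<open>The coordinate space on \<open>I\<close>, extended by zero to the whole type, so that
  the type-based theory of vector spaces applies.\<close>

definition supp_space :: "'a set \<Rightarrow> ('a \<Rightarrow> real) set" where
  "supp_space I = {f. \<forall>x. x \<notin> I \<longrightarrow> f x = 0}"

text \<open>Only semidefinite on arbitrary functions; definiteness holds on
  \<open>supp_space I\<close>.\<close>

definition ip :: "'a set \<Rightarrow> ('a \<Rightarrow> real) \<Rightarrow> ('a \<Rightarrow> real) \<Rightarrow> real" where
  "ip I f g = (\<Sum>x\<in>I. f x * g x)"

definition unit_fun :: "'a \<Rightarrow> 'a \<Rightarrow> real" where
  "unit_fun i = (\<lambda>x. of_bool (x = i))"

lemma subspace_supp_space: "fun_space.subspace (supp_space I)"
  by (auto simp: fun_space.subspace_def supp_space_def fun_apply)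

lemma ip_commute: "ip I f g = ip I g f"
  by (simp add: ip_def mult.commute)

lemma ip_add_left: "ip I (f + g) h = ip I f h + ip I g h"
  by (simp add: ip_def sum.distrib algebra_simps fun_apply)

lemma ip_diff_left: "ip I (f - g) h = ip I f h - ip I g h"
  by (simp add: ip_def sum_subtractf algebra_simps fun_apply)

lemma ip_scale_left: "ip I (fun_scale c f) h = c * ip I f h"
  by (simp add: ip_def sum_distrib_left algebra_simps fun_apply)

lemma ip_zero_left [simp]: "ip I 0 h = 0"
  by (simp add: ip_def fun_apply)

lemma ip_sum_left: "ip I (\<Sum>a\<in>A. f a) h = (\<Sum>a\<in>A. ip I (f a) h)"
  by (induction A rule: infinite_finite_induct) (auto simp: ip_add_left)

lemma ip_add_right: "ip I h (f + g) = ip I h f + ip I h g"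
  and ip_diff_right: "ip I h (f - g) = ip I h f - ip I h g"
  and ip_scale_right: "ip I h (fun_scale c f) = c * ip I h f"
  and ip_zero_right [simp]: "ip I h 0 = 0"
  and ip_sum_right: "ip I h (\<Sum>a\<in>A. F a) = (\<Sum>a\<in>A. ip I h (F a))"
  by (simp_all add: ip_commute[of I h] ip_add_left ip_diff_left ip_scale_left ip_sum_left)

lemmas ip_simps = ip_add_left ip_diff_left ip_scale_left ip_sum_left
  ip_add_right ip_diff_right ip_scale_right ip_sum_right

lemma ip_nonneg: "0 \<le> ip I f f"
  by (simp add: ip_def sum_nonneg)

lemma ip_eq_0_iff:
  assumes "finite I" "f \<in> supp_space I"
  shows "ip I f f = 0 \<longleftrightarrow> f = 0"
  using assms by (auto simp: ip_def supp_space_def sum_nonneg_eq_0_iff fun_eq_iff fun_apply)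

lemma ip_self_0_imp:
  assumes "finite I" "ip I f f = 0"
  shows "ip I g f = 0"
  using assms by (simp add: ip_def sum_nonneg_eq_0_iff)

lemma ip_span_0:
  assumes "\<And>b. b \<in> B \<Longrightarrow> ip I x b = 0" "u \<in> fun_space.span B"
  shows "ip I x u = 0"
  using assms(2) by (induction rule: fun_space.span_induct_alt) (auto simp: ip_simps assms(1))

lemma ip_unit_right:
  assumes "finite I" "i \<in> I"
  shows "ip I f (unit_fun i) = f i"
  using assms by (simp add: ip_def unit_fun_def if_distrib[of "\<lambda>x. _ * x"] of_bool_def cong: if_cong)

lemma supp_space_expand:
  assumes "finite I" "f \<in> supp_space I"
  shows "f = (\<Sum>i\<in>I. fun_scale (f i) (unit_fun i))"
  using assms
  by (intro ext) (auto simp: sum_fun_apply fun_apply unit_fun_def supp_space_def of_bool_def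
      if_distrib[of "\<lambda>x. _ * x"] cong: if_cong)

lemma unit_fun_in_supp: "i \<in> I \<Longrightarrow> unit_fun i \<in> supp_space I"
  by (auto simp: unit_fun_def supp_space_def)

lemma supp_space_span:
  assumes "finite I"
  shows "supp_space I = fun_space.span (unit_fun ` I)"
proof
  show "supp_space I \<subseteq> fun_space.span (unit_fun ` I)"
  proof
    fix f assume "f \<in> supp_space I"
    have "(\<Sum>i\<in>I. fun_scale (f i) (unit_fun i)) \<in> fun_space.span (unit_fun ` I)"
      by (intro fun_space.span_sum fun_space.span_scale fun_space.span_base) auto
    then show "f \<in> fun_space.span (unit_fun ` I)"
      using supp_space_expand[OF assms \<open>f \<in> supp_space I\<close>] by simp
  qed
  show "fun_space.span (unit_fun ` I) \<subseteq> supp_space I"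
    using unit_fun_in_supp by (intro fun_space.span_minimal subspace_supp_space) auto
qed

lemma inj_unit_fun: "inj unit_fun"
  by (rule injI) (metis unit_fun_def of_bool_eq_iff)

lemma independent_unit_fun:
  assumes "finite I"
  shows "fun_space.independent (unit_fun ` I)"
proof (rule fun_space.independent_if_scalars_zero)
  show "finite (unit_fun ` I)" using assms by simp
  fix c and x :: "'a \<Rightarrow> real" 
  assume 0: "(\<Sum>x\<in>unit_fun ` I. fun_scale (c x) x) = 0" and x: "x \<in> unit_fun ` I"
  then obtain i where i: "i \<in> I" "x = unit_fun i" by auto
  have "(\<Sum>j\<in>I. fun_scale (c (unit_fun j)) (unit_fun j)) = 0"
    using 0 by (subst (asm) sum.reindex) (auto intro: inj_on_subset[OF inj_unit_fun])
  then have "(\<Sum>j\<in>I. fun_scale (c (unit_fun j)) (unit_fun j)) i = 0" by (simp add: fun_apply)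
  then show "c x = 0"
    using i assms by (simp add: sum_fun_apply fun_apply unit_fun_def of_bool_def if_distrib[of "\<lambda>x. _ * x"] cong: if_cong)
qed

section \<open>Dimensions of subspaces\<close>

lemma dim_supp_space:
  assumes "finite I"
  shows "fun_space.dim (supp_space I) = card I"
  using assms
  using fun_space.dim_span_eq_card_independent[OF independent_unit_fun[OF assms]]
    card_image[OF inj_on_subset[OF inj_unit_fun subset_UNIV]]
  unfolding supp_space_span[OF assms] by metis

lemma finite_basis:
  assumes "finite I" "U \<subseteq> supp_space I"
  obtains B where "finite B" "B \<subseteq> U" "fun_space.independent B" "U \<subseteq> fun_space.span B"
    "card B = fun_space.dim U"
proof -
  obtain B where B: "B \<subseteq> U" "fun_space.independent B" "U \<subseteq> fun_space.span B" "card B = fun_space.dim U"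
    using fun_space.basis_exists by blast
  have "finite B"
    using fun_space.independent_span_bound[of "unit_fun ` I" B] B assms supp_space_span[OF assms(1)] by auto
  with B show thesis using that by blast
qed

lemma dim_mono:
  assumes "finite I" "V \<subseteq> supp_space I" "U \<subseteq> V"
  shows "fun_space.dim U \<le> fun_space.dim V"
proof -
  obtain B where "finite B" "V \<subseteq> fun_space.span B" "card B = fun_space.dim V"
    using finite_basis[OF assms(1,2)] by metis
  then show ?thesis using fun_space.dim_le_card[of U B] assms by auto
qed

lemma independent_card_le_dim:
  assumes "finite I" "V \<subseteq> supp_space I" "B \<subseteq> V" "fun_space.independent B"
  shows "card B \<le> fun_space.dim V"
  using dim_mono[OF assms(1-3)] fun_space.dim_eq_card_independent[OF assms(4)] by simp

lemma dim_strict_mono: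
  assumes "finite I" "V \<subseteq> supp_space I" "U \<subset> V" "fun_space.subspace U"
  shows "fun_space.dim U < fun_space.dim V"
proof -
  have US: "U \<subseteq> supp_space I" using assms by auto
  obtain B where B: "finite B" "B \<subseteq> U" "fun_space.independent B" "U \<subseteq> fun_space.span B" "card B = fun_space.dim U"
    using finite_basis[OF assms(1) US] by blast
  obtain v where v: "v \<in> V" "v \<notin> U" using assms by auto
  have span: "fun_space.span B \<subseteq> U" using B assms(4) by (intro fun_space.span_minimal)
  have "card (insert v B) \<le> fun_space.dim V"
    using v B assms span by (intro independent_card_le_dim[OF assms(1,2)] fun_space.independent_insertI) auto
  moreover have "v \<notin> B" using v B by auto
  ultimately show ?thesis using B by simp
qed

lemma dim_eq_0_iff:
  assumes "finite I" "U \<subseteq> supp_space I" "fun_space.subspace U"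
  shows "fun_space.dim U = 0 \<longleftrightarrow> U = {0}"
proof
  assume 0: "fun_space.dim U = 0"
  show "U = {0}"
  proof (rule ccontr)
    assume "U \<noteq> {0}"
    then have "{0} \<subset> U" using assms(3) by (auto simp: fun_space.subspace_0)
    from dim_strict_mono[OF assms(1,2) this] 0 show False by simp
  qed
next
  assume "U = {0}"
  then show "fun_space.dim U = 0"
    using fun_space.dim_le_card[of U "{}"] by simp
qed

text \<open>The union of two bases stays independent, because a relation would put one vector into
  both subspaces. Applied to the two children of a search node, this bounds the total dimension of a
  level.\<close>

lemma dim_disjoint_sum:
  assumes "finite I" "V \<subseteq> supp_space I" "U1 \<subseteq> V" "U2 \<subseteq> V"
    and sub: "fun_space.subspace U1" "fun_space.subspace U2" and "U1 \<inter> U2 \<subseteq> {0}"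
  shows "fun_space.dim U1 + fun_space.dim U2 \<le> fun_space.dim V"
proof -
  have S: "U1 \<subseteq> supp_space I" "U2 \<subseteq> supp_space I" using assms by auto
  obtain B1 where B1: "finite B1" "B1 \<subseteq> U1" "fun_space.independent B1" "card B1 = fun_space.dim U1"
    using finite_basis[OF assms(1) S(1)] by metis
  obtain B2 where B2: "finite B2" "B2 \<subseteq> U2" "fun_space.independent B2" "card B2 = fun_space.dim U2"
    using finite_basis[OF assms(1) S(2)] by metis
  have "0 \<notin> B1" "0 \<notin> B2" using B1 B2 fun_space.dependent_zero by blast+
  then have disj: "B1 \<inter> B2 = {}" using B1 B2 assms by auto
  have ind: "fun_space.independent (B1 \<union> B2)"
  proof (rule fun_space.independent_if_scalars_zero)
    show "finite (B1 \<union> B2)" using B1 B2 by simp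
    fix f x assume 0: "(\<Sum>x\<in>B1 \<union> B2. fun_scale (f x) x) = 0" and x: "x \<in> B1 \<union> B2"
    let ?s = "\<lambda>B. \<Sum>x\<in>B. fun_scale (f x) x"
    have sum0: "?s B1 + ?s B2 = 0"
      using 0 B1 B2 disj by (simp add: sum.union_disjoint)
    have m1: "?s B1 \<in> U1" using sub(1) B1 by (intro fun_space.subspace_sum fun_space.subspace_scale) auto
    have m2: "?s B2 \<in> U2" using sub(2) B2 by (intro fun_space.subspace_sum fun_space.subspace_scale) auto
    have "?s B1 = - ?s B2" using sum0 by (simp add: add_eq_0_iff2)
    then have "?s B1 \<in> U2" using m2 fun_space.subspace_neg[OF sub(2)] by simp
    then have 1: "?s B1 = 0" using m1 assms(7) by auto
    then have 2: "?s B2 = 0" using sum0 by simp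
    show "f x = 0"
      using x B1 B2 1 2 unfolding fun_space.independent_explicit_finite_subsets by blast
  qed
  have "card (B1 \<union> B2) \<le> fun_space.dim V"
    using B1 B2 assms ind by (intro independent_card_le_dim[OF assms(1,2)]) auto
  then show ?thesis using B1 B2 disj by (simp add: card_Un_disjoint)
qed

text \<open>Gram-Schmidt by induction on the spanning set: the new vector is first made orthogonal
  to the span of the old ones.\<close>

lemma projection_span:
  assumes "finite I" "finite B"
  shows "\<exists>p\<in>fun_space.span B. \<forall>b\<in>B. ip I (x - p) b = 0"
  using assms(2)
proof (induction B arbitrary: x)
  case empty
  then show ?case by simp
next
  case (insert b B)
  obtain b0 where b0: "b0 \<in> fun_space.span B" "\<forall>c\<in>B. ip I (b - b0) c = 0" using insert.IH by blast
  obtain p0 where p0: "p0 \<in> fun_space.span B" "\<forall>c\<in>B. ip I (x - p0) c = 0" using insert.IH by blast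
  define b' where "b' = b - b0"
  \<comment> \<open>If \<open>b'\<close> has norm zero, the quotient is \<open>0\<close> by the
    convention for division, and every vector is orthogonal to \<open>b'\<close> anyway.\<close>
  define p where "p = p0 + fun_scale (ip I x b' / ip I b' b') b'"
  have sub: "fun_space.span B \<subseteq> fun_space.span (insert b B)"
    by (rule fun_space.span_mono) auto
  have "b' \<in> fun_space.span (insert b B)"
    unfolding b'_def using b0 sub fun_space.span_base[of b "insert b B"] by (intro fun_space.span_diff) auto
  then have mem: "p \<in> fun_space.span (insert b B)"
    unfolding p_def using p0 sub by (intro fun_space.span_add fun_space.span_scale) auto
  have b'B: "ip I b' y = 0" if "y \<in> fun_space.span B" for y
    using ip_span_0[OF _ that, of I b'] b0 by (simp add: b'_def)
  have orthB: "ip I (x - p) c = 0" if "c \<in> B" for c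
    using that p0 b'B[of c] by (simp add: p_def ip_simps fun_space.span_base)
  have "ip I (x - p) b' = 0"
  proof (cases "ip I b' b' = 0")
    case True
    then show ?thesis using ip_self_0_imp[OF assms(1) True] by simp
  next
    case False
    then show ?thesis using b'B[OF p0(1)] by (simp add: p_def ip_simps ip_commute[of I p0])
  qed
  moreover have "ip I (x - p) b0 = 0" using ip_span_0[OF orthB b0(1)] .
  moreover have "b = b' + b0" by (simp add: b'_def)
  ultimately have "ip I (x - p) b = 0" by (simp add: ip_add_right)
  then show ?case using mem orthB by blast
qed

lemma projection_exists:
  assumes "finite I" "U \<subseteq> supp_space I" "fun_space.subspace U"
  shows "\<exists>p\<in>U. \<forall>u\<in>U. ip I (x - p) u = 0"
proof -
  obtain B where B: "finite B" "B \<subseteq> U" "U \<subseteq> fun_space.span B"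
    using finite_basis[OF assms(1,2)] by metis
  have "fun_space.span B \<subseteq> U" using B assms(3) by (intro fun_space.span_minimal)
  then show ?thesis using projection_span[OF assms(1) B(1), of x] B ip_span_0[of B I] by blast
qed

section \<open>Highest weight vectors in orthogonal representations\<close>

lemma comp_transpose: "bij g \<Longrightarrow> g \<circ> transpose a b = transpose (g a) (g b) \<circ> g"
  by (auto simp: fun_eq_iff transpose_def bij_is_inj inj_eq)

text \<open>The rows of the row reading tableau of shape \<open>mu\<close>, with entries in \<open>{1..sum_list mu}\<close>.\<close>

definition rstart :: "nat list \<Rightarrow> nat \<Rightarrow> nat" where
  "rstart mu r = sum_list (take r mu)"

definition rows :: "nat list \<Rightarrow> nat \<Rightarrow> nat set" where
  "rows mu r = {rstart mu r<..rstart mu (Suc r)}"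

lemma rstart_0 [simp]: "rstart mu 0 = 0"
  by (simp add: rstart_def)

lemma rstart_Suc: "r < length mu \<Longrightarrow> rstart mu (Suc r) = rstart mu r + mu ! r"
  by (simp add: rstart_def take_Suc_conv_app_nth)

lemma rstart_mono: "r \<le> s \<Longrightarrow> rstart mu r \<le> rstart mu s"
  by (metis le_add1 le_add_diff_inverse rstart_def sum_list_append take_add)

lemma rstart_length: "length mu \<le> r \<Longrightarrow> rstart mu r = sum_list mu"
  by (simp add: rstart_def)

lemma rstart_le: "rstart mu r \<le> sum_list mu"
  by (metis append_take_drop_id le_add1 rstart_def sum_list_append)

lemma finite_rows [simp]: "finite (rows mu r)"
  by (simp add: rows_def)

lemma card_rows: "r < length mu \<Longrightarrow> card (rows mu r) = mu ! r"
  by (simp add: rows_def rstart_Suc)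

lemma rows_subset: "sum_list mu \<le> n \<Longrightarrow> rows mu r \<subseteq> {1..n}"
  using rstart_le[of mu "Suc r"] by (auto simp: rows_def)

lemma rows_disjoint: "r \<noteq> s \<Longrightarrow> x \<in> rows mu r \<Longrightarrow> x \<notin> rows mu s"
  using rstart_mono[of "Suc r" s mu] rstart_mono[of "Suc s" r mu]
  by (cases r s rule: linorder_cases) (auto simp: rows_def Suc_le_eq)

lemma rows_cover:
  assumes "x \<in> {1..sum_list mu}"
  obtains r where "r < length mu" "x \<in> rows mu r"
proof -
  define r where "r = (LEAST r. x \<le> rstart mu (Suc r))"
  have ex: "x \<le> rstart mu (Suc (length mu))" using assms by (simp add: rstart_length)
  have 1: "x \<le> rstart mu (Suc r)" unfolding r_def by (rule LeastI[of _ "length mu"]) (rule ex)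
  have 2: "rstart mu r < x"
  proof (cases r)
    case 0
    then show ?thesis using assms by simp
  next
    case (Suc q)
    then have "\<not> x \<le> rstart mu (Suc q)" unfolding r_def by (metis lessI not_less_Least)
    then show ?thesis using Suc by simp
  qed
  have "r < length mu"
  proof (rule ccontr)
    assume "\<not> r < length mu"
    then have "rstart mu r = sum_list mu" by (simp add: rstart_length)
    then show False using 2 assms by simp
  qed
  then show thesis using 1 2 that by (auto simp: rows_def)
qed

lemma sum_rows:
  "(\<Sum>i\<in>{0<..rstart mu s}. g i) = (\<Sum>r<s. \<Sum>i\<in>rows mu r. g i)" for g :: "nat \<Rightarrow> 'b::comm_monoid_add"
proof (induction s)
  case (Suc s)
  have "{0<..rstart mu (Suc s)} = {0<..rstart mu s} \<union> rows mu s"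
    using rstart_mono[of s "Suc s" mu] by (auto simp: rows_def)
  moreover have "{0<..rstart mu s} \<inter> rows mu s = {}" by (auto simp: rows_def)
  ultimately show ?case using Suc by (simp add: sum.union_disjoint)
qed simp

text \<open>The identity law is restricted to supported functions because applying a matrix cuts a
  function off outside \<open>{..<d}\<close>; the composition law is restricted to permutations of
  \<open>{1..n}\<close>, outside of which an instance is arbitrary.\<close>

locale ortho_rep =
  fixes n :: nat and I :: "'a set" and act :: "(nat \<Rightarrow> nat) \<Rightarrow> ('a \<Rightarrow> real) \<Rightarrow> ('a \<Rightarrow> real)"
  assumes finite_I: "finite I"
    and act_add: "act g (f + h) = act g f + act g h"
    and act_scale: "act g (fun_scale c f) = fun_scale c (act g f)"
    and act_supp: "g permutes {1..n} \<Longrightarrow> f \<in> supp_space I \<Longrightarrow> act g f \<in> supp_space I"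
    and act_id: "f \<in> supp_space I \<Longrightarrow> act id f = f"
    and act_comp: "g permutes {1..n} \<Longrightarrow> k permutes {1..n} \<Longrightarrow> act (g \<circ> k) f = act g (act k f)"
    and ip_act: "g permutes {1..n} \<Longrightarrow> ip I (act g f) (act g h) = ip I f h"
begin

abbreviation V :: "('a \<Rightarrow> real) set" where "V \<equiv> supp_space I"

definition invariant_on :: "nat set \<Rightarrow> ('a \<Rightarrow> real) \<Rightarrow> bool" where
  "invariant_on A f \<longleftrightarrow> (\<forall>x\<in>A. \<forall>y\<in>A. act (transpose x y) f = f)"

text \<open>Up to a factor, the sum over the symmetric group on \<open>insert x A\<close>
  if \<open>f\<close> is invariant on \<open>A\<close> and \<open>x \<notin> A\<close>.\<close>

definition raise :: "nat set \<Rightarrow> nat \<Rightarrow> ('a \<Rightarrow> real) \<Rightarrow> ('a \<Rightarrow> real)" where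
  "raise A x f = f + (\<Sum>i\<in>A. act (transpose i x) f)"

definition JM :: "nat \<Rightarrow> ('a \<Rightarrow> real) \<Rightarrow> ('a \<Rightarrow> real)" where
  "JM k f = (\<Sum>i\<in>{0<..<k}. act (transpose i k) f)"

definition row_invariant :: "nat list \<Rightarrow> ('a \<Rightarrow> real) \<Rightarrow> bool" where
  "row_invariant mu f \<longleftrightarrow> f \<in> V \<and> (\<forall>r<length mu. invariant_on (rows mu r) f)"

definition HW :: "nat list \<Rightarrow> ('a \<Rightarrow> real) set" where
  "HW mu = {f. row_invariant mu f \<and> (\<forall>s<length mu. \<forall>r<s. \<forall>x\<in>rows mu s. raise (rows mu r) x f = 0)}"

text \<open>The eigenvalue is the content, column minus row, of the entry \<open>k\<close>: counted
  from zero, its column is \<open>k - 1 - rstart mu r\<close> and its row is \<open>r\<close>.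
  Contents may be negative, hence the subtraction of reals.\<close>

definition W :: "nat list \<Rightarrow> ('a \<Rightarrow> real) set" where
  "W mu = {f \<in> V. \<forall>r<length mu. \<forall>k\<in>rows mu r.
     JM k f = fun_scale (real k - 1 - real (rstart mu r) - real r) f}"

lemma V_add: "f \<in> V \<Longrightarrow> g \<in> V \<Longrightarrow> f + g \<in> V"
  and V_diff: "f \<in> V \<Longrightarrow> g \<in> V \<Longrightarrow> f - g \<in> V"
  and V_scale: "f \<in> V \<Longrightarrow> fun_scale c f \<in> V"
  and V_zero: "0 \<in> V"
  using subspace_supp_space[of I]
  by (simp_all add: fun_space.subspace_add fun_space.subspace_diff fun_space.subspace_scale fun_space.subspace_0)

lemma V_sum: "(\<And>a. a \<in> A \<Longrightarrow> f a \<in> V) \<Longrightarrow> (\<Sum>a\<in>A. f a) \<in> V"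
  using subspace_supp_space[of I] by (simp add: fun_space.subspace_sum)

lemma act_zero [simp]: "act g 0 = 0"
  using act_scale[of g 0 0] by simp

lemma act_neg: "act g (- f) = - act g f"
  using act_add[of g f "- f"] by (simp add: eq_neg_iff_add_eq_0 add.commute)

lemma act_diff: "act g (f - h) = act g f - act g h"
  using act_add[of g f "- h"] by (simp add: act_neg)

lemma act_sum: "act g (\<Sum>a\<in>A. f a) = (\<Sum>a\<in>A. act g (f a))"
  by (induction A rule: infinite_finite_induct) (auto simp: act_add)

lemma ip_0D: "f \<in> V \<Longrightarrow> ip I f f = 0 \<Longrightarrow> f = 0"
  using ip_eq_0_iff[OF finite_I] by blast

lemma act_inv:
  assumes "g permutes {1..n}" "f \<in> V"
  shows "act (inv' g) (act g f) = f" "act g (act (inv' g) f) = f"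
  using act_comp[OF permutes_inv[OF assms(1)] assms(1), of f]
    act_comp[OF assms(1) permutes_inv[OF assms(1)], of f] act_id[OF assms(2)]
    permutes_inv_o[OF assms(1)] by simp_all

lemma ip_act_left:
  assumes "g permutes {1..n}" "f \<in> V" "h \<in> V"
  shows "ip I (act g f) h = ip I f (act (inv' g) h)"
  using ip_act[OF assms(1), of f "act (inv' g) h"] act_inv[OF assms(1,3)] by simp

lemma transpose_permutes: "x \<in> {1..n} \<Longrightarrow> y \<in> {1..n} \<Longrightarrow> transpose x y permutes {1..n}"
  by (rule permutes_swap_id)

lemma act_transpose_twice:
  assumes "x \<in> {1..n}" "y \<in> {1..n}" "f \<in> V"
  shows "act (transpose x y) (act (transpose x y) f) = f"
  using act_comp[OF transpose_permutes[OF assms(1,2)] transpose_permutes[OF assms(1,2)], of f] act_id[OF assms(3)]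
  by simp

lemma ip_transpose:
  assumes "x \<in> {1..n}" "y \<in> {1..n}" "f \<in> V" "h \<in> V"
  shows "ip I (act (transpose x y) f) h = ip I f (act (transpose x y) h)"
  using ip_act_left[OF transpose_permutes[OF assms(1,2)] assms(3,4)] by simp

lemma act_conj:
  assumes "g permutes {1..n}" "x \<in> {1..n}" "y \<in> {1..n}"
  shows "act g (act (transpose x y) f) = act (transpose (g x) (g y)) (act g f)"
proof -
  have gx: "g x \<in> {1..n}" "g y \<in> {1..n}" using assms permutes_in_image[OF assms(1)] by blast+
  have "g \<circ> transpose x y = transpose (g x) (g y) \<circ> g"
    using comp_transpose[OF permutes_bij[OF assms(1)]] .
  then show ?thesis
    using act_comp[OF assms(1) transpose_permutes[OF assms(2,3)], of f]
      act_comp[OF transpose_permutes[OF gx] assms(1), of f] by simp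
qed

lemma raise_V:
  assumes "A \<subseteq> {1..n}" "x \<in> {1..n}" "f \<in> V"
  shows "raise A x f \<in> V"
  unfolding raise_def using assms by (intro V_add V_sum act_supp transpose_permutes) auto

text \<open>The transposition of \<open>j\<close> and \<open>x\<close> swaps the term
  \<open>f\<close> with the term of \<open>j\<close>. It fixes the term of every other
  \<open>i\<close>, since \<open>(i x)(j i) = (j x)(i x)\<close> and \<open>f\<close> is invariant
  under \<open>(j i)\<close>.\<close>

lemma raise_invariant:
  assumes A: "A \<subseteq> {1..n}" and x: "x \<in> {1..n}" "x \<notin> A" and f: "f \<in> V" "invariant_on A f" and j: "j \<in> A"
  shows "act (transpose j x) (raise A x f) = raise A x f"
proof -
  have fA: "finite A" using A finite_subset by blast
  have j1: "j \<in> {1..n}" using A j by auto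
  have *: "act (transpose j x) (act (transpose i x) f) = act (transpose i x) f" if i: "i \<in> A - {j}" for i
  proof -
    have i1: "i \<in> {1..n}" using A i by auto
    have "act (transpose i x) f = act (transpose i x) (act (transpose j i) f)"
      using f(2) i j by (simp add: invariant_on_def)
    also have "\<dots> = act (transpose (transpose i x j) (transpose i x i)) (act (transpose i x) f)"
      using act_conj[OF transpose_permutes[OF i1 x(1)] j1 i1] .
    also have "transpose i x j = j"
      using i j x(2) by (intro transpose_apply_other) auto
    finally show ?thesis by simp
  qed
  have "raise A x f = f + (act (transpose j x) f + (\<Sum>i\<in>A - {j}. act (transpose i x) f))"
    unfolding raise_def using fA j by (simp add: sum.remove)
  moreover have "act (transpose j x) \<dots> =
      act (transpose j x) f + (f + (\<Sum>i\<in>A - {j}. act (transpose i x) f))"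
    using * act_transpose_twice[OF j1 x(1) f(1)] by (simp add: act_add act_sum)
  ultimately show ?thesis by (simp add: add.left_commute)
qed

text \<open>The raised vector is invariant under each \<open>transpose i x\<close>, so it has the
  same inner product with all of its \<open>1 + card A\<close> summands. Thus \<open>raise\<close>
  behaves like a positive multiple of an orthogonal projection.\<close>

lemma ip_raise:
  assumes A: "A \<subseteq> {1..n}" and x: "x \<in> {1..n}" "x \<notin> A" and f: "f \<in> V" "invariant_on A f"
  shows "ip I (raise A x f) (raise A x f) = (1 + card A) * ip I (raise A x f) f"
proof -
  let ?h = "raise A x f"
  have "ip I ?h (act (transpose i x) f) = ip I ?h f" if "i \<in> A" for i
    using ip_transpose[of i x ?h f] raise_invariant[OF A x f that] raise_V[OF A x(1) f(1)] f x A that by auto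
  then have "ip I ?h (f + (\<Sum>i\<in>A. act (transpose i x) f)) = ip I ?h f + card A * ip I ?h f"
    by (simp add: ip_simps)
  then show ?thesis by (simp add: raise_def[of A x f] algebra_simps)
qed

text \<open>The positivity on which everything rests: if a sum of such inner products vanishes, then
  so does every raised vector.\<close>

lemma ip_raise_nonneg:
  assumes "A \<subseteq> {1..n}" "x \<in> {1..n}" "x \<notin> A" "f \<in> V" "invariant_on A f"
  shows "0 \<le> ip I (raise A x f) f"
    and "ip I (raise A x f) f = 0 \<Longrightarrow> raise A x f = 0"
proof -
  have "0 \<le> (1 + real (card A)) * ip I (raise A x f) f"
    using ip_raise[OF assms] ip_nonneg[of I "raise A x f"] by simp
  then show "0 \<le> ip I (raise A x f) f" by (simp add: zero_le_mult_iff)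
  assume "ip I (raise A x f) f = 0"
  then show "raise A x f = 0"
    using ip_raise[OF assms] ip_0D[OF raise_V[OF assms(1,2,4)]] by simp
qed

section \<open>Jucys-Murphy eigenvectors and highest weight vectors\<close>

lemma JM_add: "JM k (f + g) = JM k f + JM k g"
  by (simp add: JM_def act_add sum.distrib)

lemma JM_scale: "JM k (fun_scale c f) = fun_scale c (JM k f)"
  by (simp add: JM_def act_scale fun_space.scale_sum_right)

lemma JM_zero: "JM k 0 = 0"
  by (simp add: JM_def)

lemma ip_JM:
  assumes "k \<in> {1..n}" "f \<in> V" "h \<in> V"
  shows "ip I (JM k f) h = ip I f (JM k h)"
  using assms by (auto simp: JM_def ip_simps intro!: sum.cong ip_transpose)

lemma subspace_W: "fun_space.subspace (W mu)"
  unfolding fun_space.subspace_def W_def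
  by (auto simp: V_zero V_add V_scale JM_add JM_scale JM_zero fun_space.scale_right_distrib
      mult.commute)

lemma W_subset_V: "W mu \<subseteq> V"
  by (auto simp: W_def)

text \<open>The degenerate Hecke relation \<open>X (k + 1) s = s X k + 1\<close> for the simple
  transposition \<open>s\<close>: conjugation by \<open>s\<close> carries \<open>(i k)\<close> to
  \<open>(i k+1)\<close>, and the additional summand of \<open>X (k + 1)\<close> is \<open>s\<close>
  itself.\<close>

lemma JM_Suc_transpose:
  assumes k: "k \<in> {1..n}" "Suc k \<in> {1..n}" and f: "f \<in> V"
  shows "JM (Suc k) (act (transpose k (Suc k)) f) = act (transpose k (Suc k)) (JM k f) + f"
proof -
  let ?t = "transpose k (Suc k)"
  have *: "act (transpose i (Suc k)) (act ?t f) = act ?t (act (transpose i k) f)" if i: "i \<in> {0<..<k}" for i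
    using act_conj[OF transpose_permutes[OF k] _ k(1), of i f] i k by (auto simp: transpose_apply_other)
  have "{0<..<Suc k} = insert k {0<..<k}" using k by auto
  then have "JM (Suc k) (act ?t f) = act ?t (act ?t f) + (\<Sum>i\<in>{0<..<k}. act (transpose i (Suc k)) (act ?t f))"
    by (simp add: JM_def)
  also have "\<dots> = f + (\<Sum>i\<in>{0<..<k}. act ?t (act (transpose i k) f))"
    using * act_transpose_twice[OF k f] by simp
  finally show ?thesis by (simp add: JM_def act_sum add.commute)
qed

text \<open>If consecutive contents differ by one, then Cauchy-Schwarz holds with equality
  for \<open>f\<close> and its image under the simple transposition.\<close>

lemma content_step_invariant:
  assumes k: "k \<in> {1..n}" "Suc k \<in> {1..n}" and f: "f \<in> V"
    and c: "JM k f = fun_scale c f" "JM (Suc k) f = fun_scale (c + 1) f"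
  shows "act (transpose k (Suc k)) f = f"
proof -
  let ?tf = "act (transpose k (Suc k)) f"
  have tf: "?tf \<in> V" using act_supp[OF transpose_permutes[OF k] f] .
  \<comment> \<open>The same inner product is evaluated twice, by moving \<open>JM\<close> over to
    \<open>f\<close> and by the commutation relation; since the eigenvalues differ by one, exactly
    \<open>ip I f f\<close> is left.\<close>
  have "(c + 1) * ip I ?tf f = ip I (JM (Suc k) ?tf) f"
    using ip_JM[OF k(2) tf f] c by (simp add: ip_simps)
  also have "\<dots> = c * ip I ?tf f + ip I f f"
    using JM_Suc_transpose[OF k f] c by (simp add: ip_simps act_scale)
  finally have "ip I ?tf f = ip I f f" by (simp add: algebra_simps)
  then have "ip I (?tf - f) (?tf - f) = 0"
    using ip_act[OF transpose_permutes[OF k], of f f] by (simp add: ip_simps ip_commute[of I f ?tf])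
  then show ?thesis using ip_0D[OF V_diff[OF tf f]] by simp
qed

text \<open>Along a row the contents increase by one, so transpositions of row neighbours act
  trivially; conjugation yields the other transpositions of the row.\<close>

lemma W_row_invariant:
  assumes mu: "sum_list mu \<le> n" and f: "f \<in> W mu"
  shows "row_invariant mu f"
proof -
  have fV: "f \<in> V" using f by (simp add: W_def)
  have adj: "act (transpose k (Suc k)) f = f" if r: "r < length mu" "k \<in> rows mu r" "Suc k \<in> rows mu r" for r k
  proof (rule content_step_invariant[OF _ _ fV, where c = "real k - 1 - real (rstart mu r) - real r"])
    show "k \<in> {1..n}" "Suc k \<in> {1..n}" using rows_subset[OF mu] r by blast+
    show "JM k f = fun_scale (real k - 1 - real (rstart mu r) - real r) f" using f r by (auto simp: W_def)
    have "JM (Suc k) f = fun_scale (real (Suc k) - 1 - real (rstart mu r) - real r) f" using f r by (auto simp: W_def)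
    then show "JM (Suc k) f = fun_scale (real k - 1 - real (rstart mu r) - real r + 1) f"
      by (simp add: algebra_simps)
  qed
  have lt: "act (transpose x (Suc (x + m))) f = f"
    if r: "r < length mu" "x \<in> rows mu r" "Suc (x + m) \<in> rows mu r" for r x m
    using r
  proof (induction m)
    case 0
    then show ?case using adj by simp
  next
    case (Suc m)
    let ?y = "Suc (x + m)"
    have y: "?y \<in> rows mu r" using Suc by (auto simp: rows_def)
    have IH: "act (transpose x ?y) f = f" using Suc y by simp
    have a: "act (transpose ?y (Suc ?y)) f = f" using adj[OF r(1) y] Suc by simp
    have sub: "x \<in> {1..n}" "?y \<in> {1..n}" "Suc ?y \<in> {1..n}" using rows_subset[OF mu] Suc.prems y by (blast, blast, force)
    have "act (transpose ?y (Suc ?y)) (act (transpose x ?y) f) = act (transpose x (Suc ?y)) (act (transpose ?y (Suc ?y)) f)"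
      using act_conj[OF transpose_permutes[OF sub(2,3)] sub(1,2), of f] by (simp add: transpose_apply_other)
    then show ?case using IH a by simp
  qed
  have "act (transpose x y) f = f" if r: "r < length mu" "x \<in> rows mu r" "y \<in> rows mu r" for r x y
  proof (cases x y rule: linorder_cases)
    case less
    then show ?thesis using lt[OF r(1,2), of "y - x - 1"] r by simp
  next
    case equal
    then show ?thesis using act_id[OF fV] by simp
  next
    case greater
    then show ?thesis using lt[OF r(1,3), of "x - y - 1"] r by (simp add: transpose_commute)
  qed
  then show ?thesis using fV by (simp add: row_invariant_def invariant_on_def)
qed

text \<open>The transposition of \<open>x\<close> and \<open>y\<close> fixes \<open>f\<close> and
  every entry of row \<open>r\<close>, so it carries one raised vector to the other. Hence one entry
  of each row suffices.\<close>

lemma raise_transport: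
  assumes mu: "sum_list mu \<le> n" and f: "row_invariant mu f" and s: "s < length mu" and r: "r < s"
    and x: "x \<in> rows mu s" and y: "y \<in> rows mu s" and 0: "raise (rows mu r) x f = 0"
  shows "raise (rows mu r) y f = 0"
proof -
  have sub: "rows mu s \<subseteq> {1..n}" "rows mu r \<subseteq> {1..n}" using rows_subset[OF mu] by auto
  have xy: "x \<in> {1..n}" "y \<in> {1..n}" using sub x y by auto
  have g: "transpose x y permutes {1..n}" using transpose_permutes[OF xy] .
  have ff: "act (transpose x y) f = f" using f s x y by (simp add: row_invariant_def invariant_on_def)
  have "act (transpose x y) (act (transpose i x) f) = act (transpose i y) f" if i: "i \<in> rows mu r" for i
  proof -
    have "i \<noteq> x" "i \<noteq> y" using rows_disjoint[OF _ i, of s] r x y by auto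
    then have "transpose x y i = i" by (simp add: transpose_apply_other)
    moreover have "i \<in> {1..n}" using i sub by blast
    ultimately show ?thesis using act_conj[OF g _ xy(1), of i f] by (simp only: ff transpose_apply_first)
  qed
  then have "act (transpose x y) (raise (rows mu r) x f) = raise (rows mu r) y f"
    using ff by (simp add: raise_def act_add act_sum)
  then show ?thesis using 0 by simp
qed

text \<open>The first entry of row \<open>s\<close> has content \<open>-s\<close>, and its
  Jucys-Murphy element runs over exactly \<open>s\<close> full rows. By positivity each of them
  contributes at least \<open>- ip I f f\<close> to the inner product with \<open>f\<close>, so
  equality in the sum is equality in each row. Conversely, each annihilated row contributes
  \<open>-f\<close> and each earlier entry of the same row contributes \<open>f\<close>, which adds
  up to the content.\<close>

lemma W_eq_HW:
  assumes mu: "sum_list mu \<le> n"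
  shows "W mu = HW mu"
proof (intro Set.set_eqI iffI)
  fix f assume f: "f \<in> W mu"
  have inv: "row_invariant mu f" using W_row_invariant[OF mu f] .
  have fV: "f \<in> V" using f by (simp add: W_def)
  have "raise (rows mu r) x f = 0" if s: "s < length mu" "r < s" "x \<in> rows mu s" for r s x
  proof -
    let ?y = "Suc (rstart mu s)"
    have y: "?y \<in> rows mu s" using s by (auto simp: rows_def)
    have y1: "?y \<in> {1..n}" using y rows_subset[OF mu] by blast
    have nn: "0 \<le> ip I (raise (rows mu q) ?y f) f"
      and z: "ip I (raise (rows mu q) ?y f) f = 0 \<Longrightarrow> raise (rows mu q) ?y f = 0" if "q < s" for q
      using ip_raise_nonneg[of "rows mu q" ?y f] rows_subset[OF mu, of q] y1 rows_disjoint[of s q ?y mu] y fV inv that s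
      by (auto simp: row_invariant_def)
    have "JM ?y f = fun_scale (real ?y - 1 - real (rstart mu s) - real s) f"
      using f s y unfolding W_def by blast
    then have "JM ?y f = fun_scale (- real s) f" by simp
    moreover have "{0<..<?y} = {0<..rstart mu s}" by auto
    ultimately have "(\<Sum>q<s. \<Sum>i\<in>rows mu q. act (transpose i ?y) f) = fun_scale (- real s) f"
      by (simp add: JM_def sum_rows)
    moreover have "(\<Sum>q<s. f) = fun_scale (real s) f"
      by (simp add: fun_eq_iff sum_fun_apply fun_apply)
    ultimately have "(\<Sum>q<s. raise (rows mu q) ?y f) = 0"
      unfolding raise_def sum.distrib by (simp add: fun_eq_iff fun_apply)
    then have "(\<Sum>q<s. ip I (raise (rows mu q) ?y f) f) = 0"
      by (simp flip: ip_sum_left)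
    then have "ip I (raise (rows mu r) ?y f) f = 0"
      using nn s(2) by (subst (asm) sum_nonneg_eq_0_iff) auto
    then show ?thesis using raise_transport[OF mu inv s(1,2) y s(3)] z[OF s(2)] by simp
  qed
  then show "f \<in> HW mu" using inv by (simp add: HW_def)
next
  fix f assume f: "f \<in> HW mu"
  have inv: "row_invariant mu f" and fV: "f \<in> V" using f by (auto simp: HW_def row_invariant_def)
  have "JM k f = fun_scale (real k - 1 - real (rstart mu s) - real s) f" if s: "s < length mu" "k \<in> rows mu s" for s k
  proof -
    have "{0<..<k} = {0<..rstart mu s} \<union> {rstart mu s<..<k}" using s by (auto simp: rows_def)
    then have "JM k f = (\<Sum>i\<in>{0<..rstart mu s}. act (transpose i k) f) + (\<Sum>i\<in>{rstart mu s<..<k}. act (transpose i k) f)"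
      unfolding JM_def by (simp add: sum.union_disjoint ivl_disj_int)
    also have "(\<Sum>i\<in>{rstart mu s<..<k}. act (transpose i k) f) = (\<Sum>i\<in>{rstart mu s<..<k}. f)"
      using inv s by (intro sum.cong) (auto simp: row_invariant_def invariant_on_def rows_def)
    also have "(\<Sum>i\<in>{0<..rstart mu s}. act (transpose i k) f) = (\<Sum>r<s. - f)"
    proof -
      have "(\<Sum>i\<in>rows mu r. act (transpose i k) f) = - f" if "r < s" for r
      proof -
        have "raise (rows mu r) k f = 0" using f s that by (simp add: HW_def)
        then show ?thesis by (simp add: raise_def eq_neg_iff_add_eq_0 add.commute)
      qed
      then show ?thesis by (simp add: sum_rows)
    qed
    also have "(\<Sum>r<s. - f) + (\<Sum>i\<in>{rstart mu s<..<k}. f) = fun_scale (real k - 1 - real (rstart mu s) - real s) f"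
      using s by (simp add: fun_eq_iff sum_fun_apply fun_apply fun_Compl_def rows_def of_nat_diff algebra_simps)
    finally show ?thesis .
  qed
  then show "f \<in> W mu" using fV by (simp add: W_def)
qed

text \<open>Summing the operators \<open>raise\<close> from row \<open>s\<close> to row \<open>r\<close> over both rows compares the row lengths.\<close>

lemma HW_decreasing:
  assumes mu: "sum_list mu \<le> n" and f: "f \<in> HW mu" "f \<noteq> 0"
  shows "sorted_wrt (\<ge>) mu"
proof -
  have inv: "row_invariant mu f" and fV: "f \<in> V" using f by (auto simp: HW_def row_invariant_def)
  have pos: "0 < ip I f f" using f(2) ip_0D[OF fV] ip_nonneg[of I f] by (auto simp: less_le)
  have "mu ! s \<le> mu ! r" if s: "s < length mu" "r < s" for r s
  proof -
    let ?R = "rows mu r" and ?S = "rows mu s"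
    have sub: "?R \<subseteq> {1..n}" "?S \<subseteq> {1..n}" using rows_subset[OF mu] by auto
    \<comment> \<open>An entry of the later row \<open>s\<close>, raised over row \<open>r\<close>,
      annihilates \<open>f\<close>, which fixes this sum exactly.\<close>
    have "(\<Sum>i\<in>?R. ip I (act (transpose i x) f) f) = - ip I f f" if "x \<in> ?S" for x
    proof -
      have "raise ?R x f = 0" using f s that by (simp add: HW_def)
      then have "ip I (raise ?R x f) f = 0" by simp
      then show ?thesis by (simp add: raise_def ip_simps)
    qed
    then have 1: "(\<Sum>x\<in>?S. \<Sum>i\<in>?R. ip I (act (transpose i x) f) f) = - (real (mu ! s) * ip I f f)"
      using s by (simp add: card_rows)
    \<comment> \<open>For an entry of row \<open>r\<close> raised over row \<open>s\<close> only
      positivity is available, so this direction gives an inequality; exchanging the two sums then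
      compares the lengths.\<close>
    have "- ip I f f \<le> (\<Sum>x\<in>?S. ip I (act (transpose i x) f) f)" if i: "i \<in> ?R" for i
    proof -
      have "i \<notin> ?S" using rows_disjoint[OF _ i] s by auto
      then have "0 \<le> ip I (raise ?S i f) f"
        using ip_raise_nonneg(1)[OF sub(2) _ _ fV] i sub inv s by (auto simp: row_invariant_def)
      then show ?thesis by (simp add: raise_def ip_simps transpose_commute[of _ i])
    qed
    then have "(\<Sum>i\<in>?R. - ip I f f) \<le> (\<Sum>i\<in>?R. \<Sum>x\<in>?S. ip I (act (transpose i x) f) f)"
      by (rule sum_mono)
    also have "\<dots> = - (real (mu ! s) * ip I f f)" using 1 by (subst sum.swap)
    finally have "real (mu ! s) * ip I f f \<le> real (mu ! r) * ip I f f" using s by (simp add: card_rows)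
    then show ?thesis using pos by simp
  qed
  then show ?thesis by (simp add: sorted_wrt_iff_nth_less)
qed

end

section \<open>Eigenspaces of shapes grown by one cell\<close>

lemma rstart_append: "r \<le> length mu \<Longrightarrow> rstart (mu @ nu) r = rstart mu r"
  by (simp add: rstart_def)

lemma rows_append: "r < length mu \<Longrightarrow> rows (mu @ nu) r = rows mu r"
  by (simp add: rows_def rstart_append)

lemma rows_snoc: "rows (nu @ [l]) (length nu) = {sum_list nu<..sum_list nu + l}"
  by (simp add: rows_def rstart_def)

context ortho_rep
begin

text \<open>The root of the search: the first Jucys-Murphy element is an empty sum and the first
  cell has content zero.\<close>

lemma W_singleton: "W [1] = V"
proof -
  have "rows [1] 0 = {1}" by (auto simp: rows_def rstart_def)
  moreover have "{0<..<Suc 0} = {}" by auto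
  ultimately show ?thesis unfolding W_def JM_def by simp
qed

lemma W_snoc: "W (nu @ [l]) = {f \<in> W nu. \<forall>k\<in>{sum_list nu<..sum_list nu + l}.
    JM k f = fun_scale (real k - 1 - real (sum_list nu) - real (length nu)) f}"
proof -
  have "rstart (nu @ [l]) (length nu) = sum_list nu" by (simp add: rstart_def)
  then show ?thesis
    unfolding W_def by (auto simp: less_Suc_eq rows_append rows_snoc rstart_append all_conj_distrib)
qed

lemma W_new_row:
  "W (mu @ [1]) = {f \<in> W mu. JM (Suc (sum_list mu)) f = fun_scale (- real (length mu)) f}"
proof -
  have "{sum_list mu<..sum_list mu + 1} = {Suc (sum_list mu)}" by auto
  then show ?thesis unfolding W_snoc by simp
qed

lemma W_extend_row:
  "W (nu @ [Suc l]) = {f \<in> W (nu @ [l]). JM (Suc (sum_list nu + l)) f = fun_scale (real l - real (length nu)) f}"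
proof -
  have "{sum_list nu<..sum_list nu + Suc l} = insert (Suc (sum_list nu + l)) {sum_list nu<..sum_list nu + l}" by auto
  then show ?thesis unfolding W_snoc by auto
qed

text \<open>Both children prescribe an eigenvalue of the same Jucys-Murphy element, and
  \<open>l - length nu\<close> exceeds \<open>- (length nu + 1)\<close> by \<open>l + 1\<close>,
  which is positive.\<close>

lemma W_children_disjoint: "W ((nu @ [l]) @ [1]) \<inter> W (nu @ [Suc l]) \<subseteq> {0}"
proof
  fix f assume "f \<in> W ((nu @ [l]) @ [1]) \<inter> W (nu @ [Suc l])"
  then have *: "fun_scale (- real (Suc (length nu))) f = fun_scale (real l - real (length nu)) f"
    unfolding W_new_row W_extend_row by auto
  have "f x = 0" for x
  proof -
    have "- real (Suc (length nu)) * f x = (real l - real (length nu)) * f x"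
      using fun_cong[OF *, of x] by (simp only: fun_apply)
    moreover have "(real l + 1) * f x =
        (real l - real (length nu)) * f x - (- real (Suc (length nu)) * f x)"
      by (simp add: algebra_simps)
    ultimately have "(real l + 1) * f x = 0" by simp
    then show ?thesis by simp
  qed
  then have "f = 0" by (simp add: fun_eq_iff fun_apply)
  then show "f \<in> {0}" by simp
qed

section \<open>Matrix coefficients of highest weight vectors\<close>

lemma subspace_HW:
  assumes "sum_list mu \<le> n"
  shows "fun_space.subspace (HW mu)"
  using subspace_W W_eq_HW[OF assms] by metis

text \<open>Induction on the number of moved points: \<open>x\<close> and \<open>g x\<close> lie in
  the same row, and composing with their transposition makes \<open>x\<close> a fixed point without
  moving a new one.\<close>

lemma row_preserving_fixes:
  assumes mu: "sum_list mu = n" and f: "row_invariant mu f"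
    and g: "g permutes {1..n}" "\<And>r. r < length mu \<Longrightarrow> g ` rows mu r = rows mu r"
  shows "act g f = f"
  using g
proof (induction "card {x. g x \<noteq> x}" arbitrary: g rule: less_induct)
  case less
  have fV: "f \<in> V" using f by (simp add: row_invariant_def)
  show ?case
  proof (cases "g = id")
    case True
    then show ?thesis using act_id[OF fV] by simp
  next
    case False
    then obtain x where x: "g x \<noteq> x" by (auto simp: fun_eq_iff)
    have inj: "inj g" using less.prems(1) permutes_inj by blast
    have x1: "x \<in> {1..n}" using x permutes_not_in[OF less.prems(1)] by blast
    obtain r where r: "r < length mu" "x \<in> rows mu r" using rows_cover x1 mu by metis
    have gx: "g x \<in> rows mu r" using less.prems(2)[OF r(1)] r(2) by blast
    have gx1: "g x \<in> {1..n}" using gx rows_subset[of mu n] mu by blast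
    define h where "h = transpose x (g x) \<circ> g"
    have h: "h permutes {1..n}" unfolding h_def
      by (rule permutes_compose[OF less.prems(1) transpose_permutes[OF x1 gx1]])
    have gh: "g = transpose x (g x) \<circ> h" by (simp add: h_def fun_eq_iff)
    have "{y. h y \<noteq> y} \<subseteq> {y. g y \<noteq> y} - {x}"
    proof
      fix y assume y: "y \<in> {y. h y \<noteq> y}"
      have "y \<noteq> x" using y by (auto simp: h_def)
      moreover have "g y \<noteq> y"
      proof
        assume gy: "g y = y"
        then have "y \<noteq> g x" using x inj_eq[OF inj] by metis
        then have "h y = y" using gy \<open>y \<noteq> x\<close> by (simp add: h_def transpose_apply_other)
        then show False using y by simp
      qed
      ultimately show "y \<in> {y. g y \<noteq> y} - {x}" by simp
    qed
    moreover have fin: "finite {y. g y \<noteq> y}"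
      using less.prems(1) by (intro finite_subset[of "{y. g y \<noteq> y}" "{1..n}"]) (auto simp: permutes_def)
    ultimately have "card {y. h y \<noteq> y} < card {y. g y \<noteq> y}"
      using x by (intro psubset_card_mono) auto
    moreover have "h ` rows mu q = rows mu q" if q: "q < length mu" for q
    proof -
      have "transpose x (g x) ` rows mu q = rows mu q"
      proof (cases "q = r")
        case True
        then have "x \<in> rows mu q" "g x \<in> rows mu q" using r gx by auto
        then show ?thesis by (simp add: transpose_image_eq)
      next
        case False
        then have "x \<notin> rows mu q" "g x \<notin> rows mu q" using r gx rows_disjoint by blast+
        then show ?thesis by (simp add: transpose_image_eq)
      qed
      then show ?thesis using less.prems(2)[OF q] unfolding h_def image_comp[symmetric] by simp
    qed
    ultimately have "act h f = f" using less.hyps h by blast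
    moreover have "act (transpose x (g x)) f = f"
      using f r gx by (simp add: row_invariant_def invariant_on_def)
    ultimately show ?thesis
      using act_comp[OF transpose_permutes[OF x1 gx1] h, of f] gh by simp
  qed
qed

text \<open>Moving the entry \<open>x\<close> out of the \<open>g\<close>-image of row \<open>r\<close>, given that \<open>raise\<close> annihilates \<open>v\<close>.\<close>

lemma coefficient_recurrence:
  assumes mu: "sum_list mu = n" and v: "v \<in> HW mu" and v2: "row_invariant mu v2"
    and g: "g permutes {1..n}" and r: "r < length mu"
    and pres: "\<And>q. q < r \<Longrightarrow> g ` rows mu q = rows mu q"
    and x: "x \<in> g ` rows mu r - rows mu r"
  shows "(1 + card (rows mu r \<inter> g ` rows mu r)) * ip I v (act g v2) =
    - (\<Sum>i\<in>rows mu r - g ` rows mu r. ip I v (act (transpose i x \<circ> g) v2))"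
proof -
  let ?R = "rows mu r"
  have sub: "rows mu q \<subseteq> {1..n}" for q using rows_subset mu by simp
  have inj: "inj g" using g permutes_inj by blast
  obtain b where b: "b \<in> ?R" "x = g b" using x by auto
  have x1: "x \<in> {1..n}" using b sub permutes_in_image[OF g] by blast
  obtain s where s: "s < length mu" "x \<in> rows mu s" using rows_cover x1 mu by metis
  have "s \<noteq> r" using x s by auto
  \<comment> \<open>The earlier rows are their own images, while the preimage of \<open>x\<close>
    lies in row \<open>r\<close>. So \<open>x\<close> belongs to a later row, where
    \<open>raise\<close> annihilates \<open>v\<close>.\<close>
  moreover have "\<not> s < r"
  proof
    assume "s < r"
    then have "x \<in> g ` rows mu s" using pres s by simp
    then have "b \<in> rows mu s" using b inj_eq[OF inj] by auto
    then show False using rows_disjoint[OF _ b(1), of s] \<open>s < r\<close> by simp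
  qed
  ultimately have rs: "r < s" by simp
  have vV: "v \<in> V" using v by (simp add: HW_def row_invariant_def)
  have wV: "act g v2 \<in> V" using v2 g by (simp add: row_invariant_def act_supp)
  have "raise ?R x v = 0" using v s rs by (simp add: HW_def)
  then have "ip I (raise ?R x v) (act g v2) = 0" by simp
  then have "ip I v (act g v2) + (\<Sum>i\<in>?R. ip I (act (transpose i x) v) (act g v2)) = 0"
    by (simp add: raise_def ip_simps)
  moreover have "ip I (act (transpose i x) v) (act g v2) = ip I v (act (transpose i x \<circ> g) v2)" if "i \<in> ?R" for i
  proof -
    have i: "i \<in> {1..n}" using that sub by blast
    show ?thesis using ip_transpose[OF i x1 vV wV] act_comp[OF transpose_permutes[OF i x1] g, of v2] by simp
  qed
  ultimately have "ip I v (act g v2) + (\<Sum>i\<in>?R. ip I v (act (transpose i x \<circ> g) v2)) = 0" by simp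
  moreover have "(\<Sum>i\<in>?R. ip I v (act (transpose i x \<circ> g) v2)) =
      (\<Sum>i\<in>?R \<inter> g ` ?R. ip I v (act (transpose i x \<circ> g) v2)) +
      (\<Sum>i\<in>?R - g ` ?R. ip I v (act (transpose i x \<circ> g) v2))"
    by (rule sum.Int_Diff) simp
  \<comment> \<open>Here \<open>i\<close> and \<open>x\<close> are both images of entries of row
    \<open>r\<close>, so the transposition can be pulled through \<open>g\<close> to one inside the
    row, which fixes \<open>v2\<close>. These terms repeat the original coefficient and produce the
    factor on the left.\<close>
  moreover have "ip I v (act (transpose i x \<circ> g) v2) = ip I v (act g v2)" if i: "i \<in> ?R \<inter> g ` ?R" for i
  proof -
    obtain a where a: "a \<in> ?R" "i = g a" using i by auto
    have ab: "a \<in> {1..n}" "b \<in> {1..n}" using a b sub by blast+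
    have i1: "i \<in> {1..n}" using i sub by blast
    have "act (transpose a b) v2 = v2" using v2 r a b by (simp add: row_invariant_def invariant_on_def)
    then have "act (transpose i x) (act g v2) = act g v2"
      using act_conj[OF g ab, of v2] a b by simp
    then show ?thesis using act_comp[OF transpose_permutes[OF i1 x1] g, of v2] by simp
  qed
  ultimately show ?thesis by (simp add: algebra_simps)
qed

section \<open>Cyclic subrepresentations\<close>

definition subrep :: "('a \<Rightarrow> real) set \<Rightarrow> bool" where
  "subrep U \<longleftrightarrow> fun_space.subspace U \<and> U \<subseteq> V \<and> (\<forall>g. g permutes {1..n} \<longrightarrow> (\<forall>f\<in>U. act g f \<in> U))"

definition irrep :: "('a \<Rightarrow> real) set \<Rightarrow> bool" where
  "irrep U \<longleftrightarrow> subrep U \<and> U \<noteq> {0} \<and> (\<forall>U'. subrep U' \<and> U' \<subseteq> U \<longrightarrow> U' = {0} \<or> U' = U)"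

definition cyclic :: "('a \<Rightarrow> real) \<Rightarrow> ('a \<Rightarrow> real) set" where
  "cyclic v = fun_space.span ((\<lambda>g. act g v) ` {g. g permutes {1..n}})"

lemma act_in_cyclic: "g permutes {1..n} \<Longrightarrow> act g v \<in> cyclic v"
  unfolding cyclic_def by (intro fun_space.span_base) auto

lemma cyclic_subset: "subrep U \<Longrightarrow> v \<in> U \<Longrightarrow> cyclic v \<subseteq> U"
  unfolding cyclic_def subrep_def by (intro fun_space.span_minimal) auto

text \<open>Coefficients are attached to permutations rather than to translates, which may coincide;
  the same coefficients can then be used in another representation.\<close>

lemma cyclic_coeffs:
  assumes "w \<in> cyclic v"
  obtains c where "w = (\<Sum>g | g permutes {1..n}. fun_scale (c g) (act g v))"
proof -
  let ?P = "{g. g permutes {1..n}}"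
  have fin: "finite ?P" by (simp add: finite_permutations)
  have "\<exists>c. w = (\<Sum>g\<in>?P. fun_scale (c g) (act g v))"
    using assms unfolding cyclic_def
  proof (induction rule: fun_space.span_induct_alt)
    case base
    show ?case by (rule exI[of _ "\<lambda>_. 0"]) simp
  next
    case (step a x y)
    then obtain c h where c: "y = (\<Sum>g\<in>?P. fun_scale (c g) (act g v))" and h: "h \<in> ?P" "x = act h v" by auto
    have "(\<Sum>g\<in>?P. fun_scale (a * of_bool (g = h)) (act g v)) = fun_scale a x"
    proof -
      have "(\<Sum>g\<in>?P. fun_scale (a * of_bool (g = h)) (act g v)) = (\<Sum>g\<in>?P. if g = h then fun_scale a x else 0)"
        using h by (intro sum.cong) auto
      then show ?thesis using fin h by simp
    qed
    then have "fun_scale a x + y = (\<Sum>g\<in>?P. fun_scale (a * of_bool (g = h) + c g) (act g v))"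
      by (simp add: c fun_space.scale_left_distrib sum.distrib)
    then show ?case by (intro exI)
  qed
  then show thesis using that by blast
qed

lemma act_cyclic:
  assumes "h permutes {1..n}" "w \<in> cyclic v"
  shows "act h w \<in> cyclic v"
  using assms(2) unfolding cyclic_def
proof (induction rule: fun_space.span_induct_alt)
  case (step c x y)
  then obtain g where "g permutes {1..n}" "x = act g v" by auto
  then have "act h x \<in> fun_space.span ((\<lambda>g. act g v) ` {g. g permutes {1..n}})"
    using act_in_cyclic[OF permutes_compose[OF _ assms(1)], of g v] act_comp[OF assms(1)] by (simp add: cyclic_def)
  then show ?case using step by (simp add: act_add act_scale fun_space.span_add fun_space.span_scale)
qed (simp add: fun_space.span_zero)

lemma subrep_cyclic:
  assumes "v \<in> V"
  shows "subrep (cyclic v)"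
  unfolding subrep_def
proof (intro conjI allI impI ballI)
  show "fun_space.subspace (cyclic v)" by (simp add: cyclic_def)
  show "cyclic v \<subseteq> V" unfolding cyclic_def
    using assms act_supp by (intro fun_space.span_minimal subspace_supp_space) auto
qed (rule act_cyclic)

lemma self_in_cyclic: "v \<in> V \<Longrightarrow> v \<in> cyclic v"
  using act_in_cyclic[OF permutes_id, of v] act_id by simp

lemma irrep_eq_cyclic:
  assumes "irrep U" "v \<in> U" "v \<noteq> 0"
  shows "U = cyclic v"
proof -
  have U: "subrep U" using assms by (simp add: irrep_def)
  have vV: "v \<in> V" using U assms(2) by (auto simp: subrep_def)
  then have "cyclic v \<noteq> {0}" using self_in_cyclic assms(3) by blast
  then show ?thesis using assms(1) subrep_cyclic[OF vV] cyclic_subset[OF U assms(2)] by (auto simp: irrep_def)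
qed

text \<open>Elements of a cyclic subrepresentation are therefore determined by their inner products
  with the translates of the generator.\<close>

lemma orthogonal_cyclic_eq_0:
  assumes "v \<in> V" "w \<in> cyclic v" "\<And>g. g permutes {1..n} \<Longrightarrow> ip I w (act g v) = 0"
  shows "w = 0"
proof -
  have "ip I w w = 0"
    using assms(2) unfolding cyclic_def by (rule ip_span_0[rotated]) (use assms(3) in blast)
  then show ?thesis using ip_0D subrep_cyclic[OF assms(1)] assms(2) by (auto simp: subrep_def)
qed

end

section \<open>Comparing two representations by their matrix coefficients\<close>

locale two_reps = A: ortho_rep n I act + B: ortho_rep n J bct
  for n :: nat and I :: "'a set" and act and J :: "'b set" and bct
begin

text \<open>With \<open>coefficient_recurrence\<close> the rows of \<open>g\<close> are straightened one after the other.\<close>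

lemma coefficients_agree:
  assumes mu: "sum_list mu = n" and v: "v \<in> A.HW mu" and v2: "A.row_invariant mu v2"
    and u: "u \<in> B.HW mu" and u2: "B.row_invariant mu u2" and g: "g permutes {1..n}"
  shows "ip I v (act g v2) * ip J u u2 = ip J u (bct g u2) * ip I v v2"
proof -
  \<comment> \<open>The cross-multiplied form avoids a division by \<open>ip I v v2\<close>, which
    is zero when the lemma is applied to show that \<open>HW\<close> is one-dimensional in an
    irreducible representation.\<close>
  let ?P = "\<lambda>g. ip I v (act g v2) * ip J u u2 = ip J u (bct g u2) * ip I v v2"
  have sub: "rows mu q \<subseteq> {1..n}" for q using rows_subset mu by simp
  \<comment> \<open>Descending induction on the number \<open>r\<close> of initial rows that
    \<open>g\<close> maps to themselves; when all rows are, \<open>g\<close> fixes \<open>v2\<close>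
    and \<open>u2\<close>.\<close>
  have "?P g" if "r \<le> length mu" "g permutes {1..n}" "\<And>q. q < r \<Longrightarrow> g ` rows mu q = rows mu q" for r g
    using that
  proof (induction r arbitrary: g rule: inc_induct)
    case base
    then show ?case using A.row_preserving_fixes[OF mu v2 base(1)] B.row_preserving_fixes[OF mu u2 base(1)]
      by simp
  next
    case (step r)
    let ?R = "rows mu r"
    show ?case using step.prems
    \<comment> \<open>The inner induction counts the entries that leave row \<open>r\<close> under
      \<open>g\<close>: exchanging such an \<open>x\<close> with an entry \<open>i\<close> missing
      from the image lowers the count and does not touch the earlier rows.\<close>
    proof (induction "card (g ` ?R - ?R)" arbitrary: g rule: less_induct)
      case (less g)
      have inj: "inj g" using less.prems(1) permutes_inj by blast
      show ?case
      proof (cases "g ` ?R \<subseteq> ?R")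
        case True
        have "g ` ?R = ?R" using True card_image[OF inj_on_subset[OF inj subset_UNIV]] by (intro card_subset_eq) simp_all
        then have "g ` rows mu q = rows mu q" if "q < Suc r" for q
          using less.prems(2)[of q] that by (cases "q = r") auto
        then show ?thesis using step.IH less.prems(1) by blast
      next
        case False
        then obtain x where x: "x \<in> g ` ?R - ?R" by blast
        have x1: "x \<in> {1..n}" using x sub permutes_in_image[OF less.prems(1)] by blast
        have P: "?P (transpose i x \<circ> g)" if i: "i \<in> ?R - g ` ?R" for i
        proof (rule less.hyps)
          let ?g = "transpose i x \<circ> g"
          have i1: "i \<in> {1..n}" using i sub by blast
          show "?g permutes {1..n}" by (rule permutes_compose[OF less.prems(1) A.transpose_permutes[OF i1 x1]])
          have "?g ` ?R - ?R \<subseteq> (g ` ?R - ?R) - {x}"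
          proof
            fix y assume y: "y \<in> ?g ` ?R - ?R"
            then obtain a where a: "a \<in> ?R" "y = transpose i x (g a)" by auto
            have "g a \<noteq> i" using a i by auto
            moreover have "g a \<noteq> x" using a y i by auto
            ultimately have "y = g a" using a by (simp add: transpose_apply_other)
            then show "y \<in> (g ` ?R - ?R) - {x}" using a y \<open>g a \<noteq> x\<close> by auto
          qed
          then show "card (?g ` ?R - ?R) < card (g ` ?R - ?R)"
            using x by (intro psubset_card_mono) auto
          fix q assume q: "q < r"
          have "i \<notin> rows mu q" using i q rows_disjoint[of r q i mu] by simp
          moreover have "x \<notin> rows mu q"
          proof
            assume "x \<in> rows mu q"
            then have "x \<in> g ` rows mu q" using less.prems(2)[OF q] by simp
            moreover have "g ` ?R \<inter> g ` rows mu q = g ` (?R \<inter> rows mu q)" using inj by (simp add: image_Int)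
            moreover have "?R \<inter> rows mu q = {}" using q rows_disjoint[of r q _ mu] by auto
            ultimately show False using x by blast
          qed
          ultimately have "transpose i x ` rows mu q = rows mu q" by (simp add: transpose_image_eq)
          then show "?g ` rows mu q = rows mu q"
            using less.prems(2)[OF q] unfolding image_comp[symmetric] by simp
        qed
        \<comment> \<open>The recurrence has the same positive factor and the same index set in both
          representations, since these depend only on \<open>g\<close> and
          \<open>mu\<close>.\<close>
        define N where "N = real (1 + card (?R \<inter> g ` ?R))"
        have "N * (ip I v (act g v2) * ip J u u2) =
            - (\<Sum>i\<in>?R - g ` ?R. ip I v (act (transpose i x \<circ> g) v2) * ip J u u2)"
          using A.coefficient_recurrence[OF mu v v2 less.prems(1) step.hyps(2) less.prems(2) x]
          by (simp add: N_def sum_distrib_right mult.assoc[symmetric])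
        also have "\<dots> = - (\<Sum>i\<in>?R - g ` ?R. ip J u (bct (transpose i x \<circ> g) u2) * ip I v v2)"
          using P by simp
        also have "\<dots> = N * (ip J u (bct g u2) * ip I v v2)"
          using B.coefficient_recurrence[OF mu u u2 less.prems(1) step.hyps(2) less.prems(2) x]
          by (simp add: N_def sum_distrib_right mult.assoc[symmetric])
        finally show ?thesis by (simp add: N_def)
      qed
    qed
  qed
  from this[of 0] g show ?thesis by simp
qed

text \<open>\<open>y\<close> is the same combination of translates of \<open>u\<close> as
  \<open>w\<close> is of \<open>v\<close>. The conclusion describes it by inner products, so that
  the non-unique choice of coefficients leaves no trace.\<close>

lemma intertwiner_exists:
  assumes mu: "sum_list mu = n" and v: "v \<in> A.HW mu" and u: "u \<in> B.HW mu" and w: "w \<in> A.cyclic v"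
  shows "\<exists>y\<in>B.cyclic u. \<forall>g. g permutes {1..n} \<longrightarrow> ip J y (bct g u) * ip I v v = ip I w (act g v) * ip J u u"
proof -
  let ?P = "{g. g permutes {1..n}}"
  obtain c where c: "w = (\<Sum>g\<in>?P. fun_scale (c g) (act g v))" using A.cyclic_coeffs[OF w] by blast
  define y where "y = (\<Sum>g\<in>?P. fun_scale (c g) (bct g u))"
  have "y \<in> B.cyclic u" unfolding y_def
    using B.act_in_cyclic by (auto simp: B.cyclic_def intro!: fun_space.span_sum fun_space.span_scale)
  moreover have inv: "A.row_invariant mu v" "B.row_invariant mu u" using u v by (auto simp: A.HW_def B.HW_def)
  then have V: "v \<in> A.V" "u \<in> B.V" by (auto simp: A.row_invariant_def B.row_invariant_def)
  have "ip J y (bct g u) * ip I v v = ip I w (act g v) * ip J u u" if g: "g permutes {1..n}" for g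
  proof -
    have "ip J (bct h u) (bct g u) * ip I v v = ip I (act h v) (act g v) * ip J u u" if h: "h \<in> ?P" for h
    proof -
      have h: "h permutes {1..n}" using h by simp
      \<comment> \<open>By orthogonality the inner product of two translates is a single matrix
        coefficient, taken at \<open>inv' h \<circ> g\<close>.\<close>
      have hg: "inv' h \<circ> g permutes {1..n}" by (rule permutes_compose[OF g permutes_inv[OF h]])
      show ?thesis
        using coefficients_agree[OF mu v inv(1) u inv(2) hg]
          A.ip_act_left[OF h V(1) A.act_supp[OF g V(1)]] B.ip_act_left[OF h V(2) B.act_supp[OF g V(2)]]
          A.act_comp[OF permutes_inv[OF h] g] B.act_comp[OF permutes_inv[OF h] g] by simp
    qed
    then show ?thesis
      by (simp add: c y_def ip_simps sum_distrib_right mult.assoc)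
  qed
  ultimately show ?thesis by blast
qed

lemma swapped: "two_reps n J bct I act"
  by (intro two_reps.intro A.ortho_rep_axioms B.ortho_rep_axioms)

text \<open>The uniqueness part of the Gelfand-Naimark-Segal construction.\<close>

lemma intertwiner:
  assumes mu: "sum_list mu = n" and v: "v \<in> A.HW mu" "v \<noteq> 0" and u: "u \<in> B.HW mu" "u \<noteq> 0"
  obtains F where "bij_betw F (A.cyclic v) (B.cyclic u)"
    "\<And>x y. x \<in> A.cyclic v \<Longrightarrow> y \<in> A.cyclic v \<Longrightarrow> F (x + y) = F x + F y"
    "\<And>c x. x \<in> A.cyclic v \<Longrightarrow> F (fun_scale c x) = fun_scale c (F x)"
    "\<And>g x. g permutes {1..n} \<Longrightarrow> x \<in> A.cyclic v \<Longrightarrow> F (act g x) = bct g (F x)"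
proof -
  \<comment> \<open>The graph of the intertwiner, given by inner products with translates; the
    factors compensate that \<open>v\<close> and \<open>u\<close> are not normalized.\<close>
  define R where "R w y \<longleftrightarrow> y \<in> B.cyclic u \<and>
    (\<forall>g. g permutes {1..n} \<longrightarrow> ip J y (bct g u) * ip I v v = ip I w (act g v) * ip J u u)" for w y
  have V: "v \<in> A.V" "u \<in> B.V" using v u by (auto simp: A.row_invariant_def B.row_invariant_def A.HW_def B.HW_def)
  have nz: "ip I v v \<noteq> 0" "ip J u u \<noteq> 0" using A.ip_0D[OF V(1)] B.ip_0D[OF V(2)] u v by blast+
  have cA: "fun_space.subspace (A.cyclic v)" "A.cyclic v \<subseteq> A.V" using A.subrep_cyclic[OF V(1)] by (auto simp: A.subrep_def)
  have cB: "fun_space.subspace (B.cyclic u)" "B.cyclic u \<subseteq> B.V" using B.subrep_cyclic[OF V(2)] by (auto simp: B.subrep_def)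
  have ex: "\<exists>y. R w y" if "w \<in> A.cyclic v" for w
    using intertwiner_exists[OF mu v(1) u(1) that] by (auto simp: R_def)
  have uniq: "y = z" if "R w y" "R w z" for w y z
  proof -
    have "y - z = 0"
    proof (rule B.orthogonal_cyclic_eq_0[OF V(2)])
      show "y - z \<in> B.cyclic u" using that cB by (auto simp: R_def fun_space.subspace_diff)
      show "ip J (y - z) (bct g u) = 0" if g: "g permutes {1..n}" for g
      proof -
        have "ip J y (bct g u) * ip I v v = ip J z (bct g u) * ip I v v"
          using \<open>R w y\<close> \<open>R w z\<close> g by (simp add: R_def)
        then show ?thesis using nz by (simp add: ip_simps)
      qed
    qed
    then show ?thesis by simp
  qed
  define F where "F w = (THE y. R w y)" for w
  have F: "R w (F w)" if "w \<in> A.cyclic v" for w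
    unfolding F_def using ex[OF that] uniq by (metis theI)
  have FI: "F w = y" if "R w y" for w y
    unfolding F_def using that uniq by blast
  \<comment> \<open>Surjectivity is existence with the two representations exchanged.\<close>
  have sur: "\<exists>w\<in>A.cyclic v. R w y" if y: "y \<in> B.cyclic u" for y
  proof -
    obtain w where w: "w \<in> A.cyclic v"
      "\<And>g. g permutes {1..n} \<Longrightarrow> ip I w (act g v) * ip J u u = ip J y (bct g u) * ip I v v"
      using two_reps.intertwiner_exists[OF swapped mu u(1) v(1) y] by blast
    then show ?thesis using y unfolding R_def by metis
  qed
  have injF: "inj_on F (A.cyclic v)"
  proof (rule inj_onI)
    fix x y assume xy: "x \<in> A.cyclic v" "y \<in> A.cyclic v" "F x = F y"
    have "x - y = 0"
    proof (rule A.orthogonal_cyclic_eq_0[OF V(1)])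
      show "x - y \<in> A.cyclic v" using xy cA by (simp add: fun_space.subspace_diff)
      show "ip I (x - y) (act g v) = 0" if g: "g permutes {1..n}" for g
      proof -
        have "ip I x (act g v) * ip J u u = ip I y (act g v) * ip J u u"
          using F[OF xy(1)] F[OF xy(2)] xy(3) g by (simp add: R_def)
        then show ?thesis using nz by (simp add: ip_simps)
      qed
    qed
    then show "x = y" by simp
  qed
  show thesis
  proof
    show "bij_betw F (A.cyclic v) (B.cyclic u)"
    proof (rule bij_betw_imageI[OF injF])
      show "F ` A.cyclic v = B.cyclic u"
      proof
        show "F ` A.cyclic v \<subseteq> B.cyclic u" using F by (auto simp: R_def)
        show "B.cyclic u \<subseteq> F ` A.cyclic v" using sur FI by (metis image_eqI subsetI)
      qed
    qed
    show "F (x + y) = F x + F y" if xy: "x \<in> A.cyclic v" "y \<in> A.cyclic v" for x y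
    proof (rule FI)
      show "R (x + y) (F x + F y)" using F[OF xy(1)] F[OF xy(2)] cB
        by (simp add: R_def fun_space.subspace_add ip_simps distrib_right)
    qed
    show "F (fun_scale c x) = fun_scale c (F x)" if x: "x \<in> A.cyclic v" for c x
    proof (rule FI)
      show "R (fun_scale c x) (fun_scale c (F x))" using F[OF x] cB
        by (simp add: R_def fun_space.subspace_scale ip_simps mult.assoc)
    qed
    show "F (act g x) = bct g (F x)" if g: "g permutes {1..n}" and x: "x \<in> A.cyclic v" for g x
    proof (rule FI)
      have Fx: "F x \<in> B.cyclic u" using F[OF x] by (simp add: R_def)
      show "R (act g x) (bct g (F x))" unfolding R_def
      proof (intro conjI allI impI)
        show "bct g (F x) \<in> B.cyclic u" using B.act_cyclic[OF g Fx] .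
        fix h assume h: "h permutes {1..n}"
        have k: "inv' g \<circ> h permutes {1..n}" by (rule permutes_compose[OF h permutes_inv[OF g]])
        have "ip J (F x) (bct (inv' g \<circ> h) u) * ip I v v = ip I x (act (inv' g \<circ> h) v) * ip J u u"
          using F[OF x] k unfolding R_def by blast
        moreover have "x \<in> A.V" "F x \<in> B.V" using x Fx cA cB by auto
        ultimately show "ip J (bct g (F x)) (bct h u) * ip I v v = ip I (act g x) (act h v) * ip J u u"
          using A.ip_act_left[OF g _ A.act_supp[OF h V(1)], of x] B.ip_act_left[OF g _ B.act_supp[OF h V(2)], of "F x"]
            A.act_comp[OF permutes_inv[OF g] h, of v] B.act_comp[OF permutes_inv[OF g] h, of u] by simp
      qed
    qed
  qed
qed

end

context ortho_rep
begin

text \<open>The component \<open>z\<close> of \<open>x\<close> orthogonal to \<open>y\<close> is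
  again a highest weight vector. Comparing its coefficients with those of \<open>y\<close> shows
  that it is orthogonal to all translates of \<open>y\<close>, and these span
  \<open>U\<close>.\<close>

lemma irrep_HW_dim_1:
  assumes mu: "sum_list mu = n" and U: "irrep U"
    and x: "x \<in> HW mu" "x \<in> U" and y: "y \<in> HW mu" "y \<in> U" "y \<noteq> 0"
  shows "\<exists>c. x = fun_scale c y"
proof -
  interpret two_reps n I act I act by (intro two_reps.intro ortho_rep_axioms)
  define z where "z = x - fun_scale (ip I x y / ip I y y) y"
  have yV: "y \<in> V" using y by (simp add: HW_def row_invariant_def)
  have nz: "ip I y y \<noteq> 0" using ip_0D[OF yV] y by blast
  have zy: "ip I z y = 0" using nz by (simp add: z_def ip_simps)
  have zHW: "z \<in> HW mu" unfolding z_def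
    using x y subspace_HW[of mu] mu by (simp add: fun_space.subspace_diff fun_space.subspace_scale)
  have subU: "fun_space.subspace U" using U by (auto simp: irrep_def subrep_def)
  have "z \<in> U" unfolding z_def
    using x y subU by (simp add: fun_space.subspace_diff fun_space.subspace_scale)
  then have "z \<in> cyclic y" using irrep_eq_cyclic[OF U y(2,3)] by simp
  moreover have "ip I z (act g y) = 0" if "g permutes {1..n}" for g
    using coefficients_agree[OF mu zHW _ y(1) _ that, of y y] y(1) zy nz by (simp add: HW_def)
  ultimately have "z = 0" using orthogonal_cyclic_eq_0[OF yV] by blast
  then show ?thesis by (auto simp: z_def)
qed

end

section \<open>Specht modules\<close>

definition tabloids :: "nat \<Rightarrow> nat list \<Rightarrow> (nat \<Rightarrow> nat) set" where
  "tabloids n la = tabloid n ` tableaux n la"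

definition row_index :: "nat list \<Rightarrow> nat \<Rightarrow> nat" where
  "row_index la x = (THE r. r < length la \<and> x \<in> rows la r)"

definition row_reading :: "nat list \<Rightarrow> nat \<Rightarrow> nat \<times> nat" where
  "row_reading la x = (row_index la x, x - Suc (rstart la (row_index la x)))"

lemma row_index_eq: "r < length la \<Longrightarrow> x \<in> rows la r \<Longrightarrow> row_index la x = r"
  unfolding row_index_def by (rule the_equality) (use rows_disjoint in blast)+

lemma row_index_rows:
  assumes "x \<in> {1..sum_list la}"
  shows "row_index la x < length la" "x \<in> rows la (row_index la x)"
  using rows_cover[OF assms] row_index_eq by metis+

lemma tabloid_comp:
  assumes "g permutes {1..n}"
  shows "tabloid n T \<circ> g = tabloid n (T \<circ> g)"
proof
  fix x
  have "g x \<in> {1..n} \<longleftrightarrow> x \<in> {1..n}" using permutes_in_image[OF assms] .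
  then show "(tabloid n T \<circ> g) x = tabloid n (T \<circ> g) x" by (auto simp: tabloid_def)
qed

lemma tableaux_comp: "g permutes {1..n} \<Longrightarrow> T \<in> tableaux n la \<Longrightarrow> T \<circ> g \<in> tableaux n la"
  unfolding tableaux_def using bij_betw_trans[OF permutes_imp_bij] by blast

lemma tabloids_comp: "g permutes {1..n} \<Longrightarrow> r \<in> tabloids n la \<Longrightarrow> r \<circ> g \<in> tabloids n la"
  unfolding tabloids_def using tabloid_comp tableaux_comp by fastforce

lemma comp_inv_cancel:
  assumes "g permutes S"
  shows "r \<circ> g \<circ> inv' g = r" "r \<circ> inv' g \<circ> g = r"
  using permutes_inv_o[OF assms] by (simp_all add: comp_assoc)

lemma finite_tabloids: "finite (tabloids n la)"
proof (rule finite_subset)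
  show "tabloids n la \<subseteq> {1..n} \<rightarrow>\<^sub>E {..<length la}"
  proof
    fix r assume "r \<in> tabloids n la"
    then obtain T where T: "bij_betw T {1..n} (cells la)" "r = tabloid n T" by (auto simp: tabloids_def tableaux_def)
    have "T x \<in> cells la" if "x \<in> {1..n}" for x using bij_betwE[OF T(1)] that by blast
    then show "r \<in> {1..n} \<rightarrow>\<^sub>E {..<length la}"
      unfolding T(2) tabloid_def cells_def by (intro restrict_PiE_iff[THEN iffD2]) fastforce
  qed
qed (simp add: finite_PiE)

text \<open>The tabloids are an orthonormal basis that is permuted by the group.\<close>

lemma ortho_rep_tabloids: "ortho_rep n (tabloids n la) tabloid_action"
proof
  show "tabloid_action g (f + h) = tabloid_action g f + tabloid_action g h" for g f h
    by (simp add: tabloid_action_def fun_eq_iff fun_apply)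
  show "tabloid_action g (fun_scale c f) = fun_scale c (tabloid_action g f)" for g c f
    by (simp add: tabloid_action_def fun_eq_iff fun_apply)
  show "tabloid_action g f \<in> supp_space (tabloids n la)"
    if "g permutes {1..n}" "f \<in> supp_space (tabloids n la)" for g f
  proof -
    have "r \<in> tabloids n la" if "r \<circ> g \<in> tabloids n la" for r
      using tabloids_comp[OF permutes_inv[OF \<open>g permutes {1..n}\<close>] that]
        comp_inv_cancel(1)[OF \<open>g permutes {1..n}\<close>, of r] by simp
    then show ?thesis using that(2) by (auto simp: supp_space_def tabloid_action_def)
  qed
  show "tabloid_action (g \<circ> k) f = tabloid_action g (tabloid_action k f)" for g k f
    by (simp add: tabloid_action_def comp_assoc)
  show "ip (tabloids n la) (tabloid_action g f) (tabloid_action g h) = ip (tabloids n la) f h"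
    if g: "g permutes {1..n}" for g f h
  proof -
    have "bij_betw (\<lambda>r. r \<circ> g) (tabloids n la) (tabloids n la)"
      using tabloids_comp[OF g] tabloids_comp[OF permutes_inv[OF g]] comp_inv_cancel[OF g]
      by (intro bij_betw_byWitness[where f' = "\<lambda>r. r \<circ> inv' g"]) auto
    from sum.reindex_bij_betw[OF this, of "\<lambda>r. f r * h r"] show ?thesis
      by (simp add: ip_def tabloid_action_def)
  qed
qed (simp_all add: finite_tabloids tabloid_action_def)

locale specht =
  fixes n :: nat and la :: "nat list"
  assumes la: "la \<in> partitions n"
begin

sublocale ortho_rep n "tabloids n la" tabloid_action
  by (rule ortho_rep_tabloids)

abbreviation S :: "((nat \<Rightarrow> nat) \<Rightarrow> real) set" where
  "S \<equiv> specht_module n la"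

lemma sum_la: "sum_list la = n"
  using la by (simp add: partitions_def)

lemma la_decreasing: "i \<le> j \<Longrightarrow> j < length la \<Longrightarrow> la ! j \<le> la ! i"
  using la by (cases "i = j") (auto simp: partitions_def sorted_wrt_iff_nth_less)

lemma row_reading_tableau: "row_reading la \<in> tableaux n la"
proof -
  have "bij_betw (row_reading la) {1..n} (cells la)"
  proof (rule bij_betw_byWitness[where f' = "\<lambda>(r, j). rstart la r + Suc j"])
    show "\<forall>x\<in>{1..n}. (\<lambda>(r, j). rstart la r + Suc j) (row_reading la x) = x"
    proof
      fix x assume "x \<in> {1..n}"
      then have "rstart la (row_index la x) < x" using row_index_rows(2)[of x la] by (simp add: rows_def sum_la)
      then show "(\<lambda>(r, j). rstart la r + Suc j) (row_reading la x) = x" by (simp add: row_reading_def)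
    qed
    have c: "rstart la r + Suc j \<in> rows la r" "rstart la r + Suc j \<in> {1..n}" "r < length la" if "(r, j) \<in> cells la" for r j
      using that rstart_le[of la "Suc r"] sum_la by (auto simp: cells_def rows_def rstart_Suc)
    show "\<forall>p\<in>cells la. row_reading la ((\<lambda>(r, j). rstart la r + Suc j) p) = p"
    proof clarify
      fix r j assume "(r, j) \<in> cells la"
      then have "row_index la (rstart la r + Suc j) = r" using c(1,3) row_index_eq by blast
      then show "row_reading la (rstart la r + Suc j) = (r, j)" by (simp add: row_reading_def)
    qed
    show "row_reading la ` {1..n} \<subseteq> cells la"
    proof
      fix p assume "p \<in> row_reading la ` {1..n}"
      then obtain x where x: "x \<in> {1..n}" "p = row_reading la x" by auto
      from row_index_rows[of x la] x show "p \<in> cells la"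
        by (auto simp: row_reading_def cells_def rows_def rstart_Suc sum_la)
    qed
    show "(\<lambda>(r, j). rstart la r + Suc j) ` cells la \<subseteq> {1..n}"
      using c by auto
  qed
  then show ?thesis by (simp add: tableaux_def)
qed

section \<open>Polytabloids\<close>

lemma finite_column_stabilizer: "finite (column_stabilizer n T)"
  by (rule finite_subset[OF _ finite_permutations[of "{1..n}"]]) (auto simp: column_stabilizer_def)

lemma polytabloid_V:
  assumes "T \<in> tableaux n la"
  shows "polytabloid n T \<in> V"
proof -
  have "tabloid n (T \<circ> inv' q) \<in> tabloids n la" if "q \<in> column_stabilizer n T" for q
    using tableaux_comp[OF permutes_inv assms] that by (auto simp: tabloids_def column_stabilizer_def)
  then show ?thesis
    unfolding supp_space_def polytabloid_def by (auto intro!: sum.neutral)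
qed

lemma polytabloid_in_S: "T \<in> tableaux n la \<Longrightarrow> polytabloid n T \<in> S"
  unfolding specht_module_def by (intro fun_space.span_base) auto

lemma subspace_S: "fun_space.subspace S"
  by (simp add: specht_module_def)

lemma S_subset_V: "S \<subseteq> V"
  unfolding specht_module_def using polytabloid_V by (intro fun_space.span_minimal subspace_supp_space) auto

text \<open>Conjugation by \<open>g\<close> carries the column stabilizer of \<open>T\<close> to
  that of the moved tableau and preserves signs.\<close>

lemma act_polytabloid:
  assumes g: "g permutes {1..n}"
  shows "tabloid_action g (polytabloid n T) = polytabloid n (T \<circ> inv' g)"
proof
  fix r
  let ?T = "T \<circ> inv' g"
  have gi: "inv' g permutes {1..n}" using permutes_inv[OF g] .
  have conj: "g \<circ> q \<circ> inv' g permutes {1..n}" "inv' g \<circ> q \<circ> g permutes {1..n}" if "q permutes {1..n}" for q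
    using that g gi by (simp_all add: permutes_compose)
  have im: "g x \<in> {1..n} \<longleftrightarrow> x \<in> {1..n}" "inv' g x \<in> {1..n} \<longleftrightarrow> x \<in> {1..n}" for x
    using permutes_in_image[OF g] permutes_in_image[OF gi] by blast+
  have gg: "g (inv' g x) = x" "inv' g (g x) = x" for x using permutes_inverses[OF g] by auto
  have bij: "bij_betw (\<lambda>q. g \<circ> q \<circ> inv' g) (column_stabilizer n T) (column_stabilizer n ?T)"
  proof (rule bij_betw_byWitness[where f' = "\<lambda>q. inv' g \<circ> q \<circ> g"])
    show "(\<lambda>q. g \<circ> q \<circ> inv' g) ` column_stabilizer n T \<subseteq> column_stabilizer n ?T"
      using conj im gg by (auto simp del: atLeastAtMost_iff simp: column_stabilizer_def)
    show "(\<lambda>q. inv' g \<circ> q \<circ> g) ` column_stabilizer n ?T \<subseteq> column_stabilizer n T"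
    proof
      fix k assume "k \<in> (\<lambda>q. inv' g \<circ> q \<circ> g) ` column_stabilizer n ?T"
      then obtain q where q: "q permutes {1..n}" "\<And>x. x \<in> {1..n} \<Longrightarrow> snd (?T (q x)) = snd (?T x)"
        and k: "k = inv' g \<circ> q \<circ> g" by (auto simp: column_stabilizer_def)
      have "snd (T (k x)) = snd (T x)" if "x \<in> {1..n}" for x
        using q(2)[of "g x"] im(1)[of x] that by (simp add: k gg)
      then show "k \<in> column_stabilizer n T" using conj(2)[OF q(1)] by (simp add: column_stabilizer_def k)
    qed
  qed (auto simp: fun_eq_iff gg)
  have *: "of_int (sign q) * of_bool (r \<circ> g = tabloid n (T \<circ> inv' q)) =
    of_int (sign (g \<circ> q \<circ> inv' g)) * (of_bool (r = tabloid n (?T \<circ> inv' (g \<circ> q \<circ> inv' g))) :: real)"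
    if q: "q \<in> column_stabilizer n T" for q
  proof -
    have qp: "q permutes {1..n}" using q by (simp add: column_stabilizer_def)
    have fin: "permutation q" "permutation g" "permutation (inv' g)"
      using qp g gi by (auto simp: permutation_permutes)
    have "sign (g \<circ> q \<circ> inv' g) = sign g * sign q * sign g"
      using fin by (simp add: sign_compose permutation_compose sign_inverse)
    then have s: "sign (g \<circ> q \<circ> inv' g) = sign q" by (simp add: sign_def)
    have "inv' (g \<circ> q \<circ> inv' g) = g \<circ> inv' q \<circ> inv' g"
      using permutes_inverses[OF g] permutes_inverses[OF qp]
      by (intro inv_unique_comp) (auto simp: fun_eq_iff)
    then have "?T \<circ> inv' (g \<circ> q \<circ> inv' g) = (T \<circ> inv' q) \<circ> inv' g"
      by (simp add: fun_eq_iff gg)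
    then have t: "tabloid n (?T \<circ> inv' (g \<circ> q \<circ> inv' g)) = tabloid n (T \<circ> inv' q) \<circ> inv' g"
      using tabloid_comp[OF gi] by simp
    have "r \<circ> g = tabloid n (T \<circ> inv' q) \<longleftrightarrow> r = tabloid n (T \<circ> inv' q) \<circ> inv' g"
      using comp_inv_cancel[OF g] by metis
    then show ?thesis using s t by simp
  qed
  have "tabloid_action g (polytabloid n T) r =
      (\<Sum>q\<in>column_stabilizer n T. of_int (sign q) * of_bool (r \<circ> g = tabloid n (T \<circ> inv' q)))"
    by (simp add: tabloid_action_def polytabloid_def)
  also have "\<dots> = polytabloid n ?T r"
    unfolding polytabloid_def sum.reindex_bij_betw[OF bij, symmetric] using * by (intro sum.cong refl)
  finally show "tabloid_action g (polytabloid n T) r = polytabloid n ?T r" .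
qed

text \<open>Composition with the transposition is a sign-reversing bijection of the column
  stabilizer.\<close>

lemma act_transpose_polytabloid:
  assumes ab: "a \<in> {1..n}" "b \<in> {1..n}" "a \<noteq> b" "snd (T a) = snd (T b)"
  shows "tabloid_action (transpose a b) (polytabloid n T) = - polytabloid n T"
proof
  fix r
  let ?t = "transpose a b"
  have t: "?t permutes {1..n}" using transpose_permutes ab by blast
  have Tt: "snd (T (?t x)) = snd (T x)" for x using ab by (auto simp: transpose_def)
  have bij: "bij_betw (\<lambda>q. ?t \<circ> q) (column_stabilizer n T) (column_stabilizer n T)"
    using Tt permutes_compose[OF _ t]
    by (intro bij_betw_byWitness[where f' = "\<lambda>q. ?t \<circ> q"]) (auto simp: column_stabilizer_def fun_eq_iff)
  have *: "of_int (sign q) * of_bool (r \<circ> ?t = tabloid n (T \<circ> inv' q)) =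
    - (of_int (sign (?t \<circ> q)) * (of_bool (r = tabloid n (T \<circ> inv' (?t \<circ> q))) :: real))"
    if q: "q \<in> column_stabilizer n T" for q
  proof -
    have qp: "q permutes {1..n}" using q by (simp add: column_stabilizer_def)
    have "permutation q" "permutation ?t" using qp t by (auto simp: permutation_permutes)
    then have s: "sign (?t \<circ> q) = - sign q" using ab by (simp add: sign_compose sign_swap_id)
    have "inv' (?t \<circ> q) = inv' q \<circ> ?t"
      using permutes_inverses[OF qp] by (intro inv_unique_comp) (auto simp: fun_eq_iff)
    then have "tabloid n (T \<circ> inv' (?t \<circ> q)) = tabloid n (T \<circ> inv' q) \<circ> ?t"
      using tabloid_comp[OF t, of "T \<circ> inv' q"] by (simp add: comp_assoc)
    moreover have "r \<circ> ?t = tabloid n (T \<circ> inv' q) \<longleftrightarrow> r = tabloid n (T \<circ> inv' q) \<circ> ?t"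
      by (metis comp_assoc comp_id transpose_comp_involutory)
    ultimately show ?thesis using s by simp
  qed
  have "tabloid_action ?t (polytabloid n T) r =
      (\<Sum>q\<in>column_stabilizer n T. of_int (sign q) * of_bool (r \<circ> ?t = tabloid n (T \<circ> inv' q)))"
    by (simp add: tabloid_action_def polytabloid_def)
  also have "\<dots> = (\<Sum>q\<in>column_stabilizer n T. - (of_int (sign (?t \<circ> q)) * of_bool (r = tabloid n (T \<circ> inv' (?t \<circ> q)))))"
    using * by (rule sum.cong[OF refl])
  also have "\<dots> = - polytabloid n T r"
    unfolding polytabloid_def sum_negf
    using sum.reindex_bij_betw[OF bij, of "\<lambda>q. of_int (sign q) * of_bool (r = tabloid n (T \<circ> inv' q))"] by simp
  finally show "tabloid_action ?t (polytabloid n T) r = (- polytabloid n T) r" by simp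
qed

text \<open>A column permutation that also preserves the tabloid keeps the row and the column of
  every entry, so it is the identity and only one summand survives. This makes the generator of the
  Specht module nonzero.\<close>

lemma polytabloid_self:
  assumes T: "T \<in> tableaux n la"
  shows "polytabloid n T (tabloid n T) = 1"
proof -
  have inj: "inj_on T {1..n}" using T by (simp add: tableaux_def bij_betw_def)
  have "of_int (sign q) * of_bool (tabloid n T = tabloid n (T \<circ> inv' q)) = (if q = id then 1 else 0 :: real)"
    if q: "q \<in> column_stabilizer n T" for q
  proof (cases "q = id")
    case False
    have qp: "q permutes {1..n}" using q by (simp add: column_stabilizer_def)
    have "tabloid n T \<noteq> tabloid n (T \<circ> inv' q)"
    proof
      assume eq: "tabloid n T = tabloid n (T \<circ> inv' q)"
      have "q x = x" if x: "x \<in> {1..n}" for x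
      proof -
        have qx: "q x \<in> {1..n}" using x permutes_in_image[OF qp] by blast
        have "fst (T (q x)) = fst (T x)"
          using fun_cong[OF eq, of "q x"] qx permutes_inverses[OF qp] by (simp add: tabloid_def)
        moreover have "snd (T (q x)) = snd (T x)" using q x by (simp add: column_stabilizer_def)
        ultimately show ?thesis using inj_onD[OF inj _ qx x] by (simp add: prod_eq_iff)
      qed
      then have "q = id" using permutes_not_in[OF qp] by (auto simp: fun_eq_iff)
      with False show False ..
    qed
    then show ?thesis using False by simp
  qed (simp add: sign_id)
  then have "polytabloid n T (tabloid n T) = (\<Sum>q\<in>column_stabilizer n T. if q = id then 1 else 0)"
    unfolding polytabloid_def by (intro sum.cong refl)
  also have "\<dots> = 1"
    using finite_column_stabilizer by (simp add: column_stabilizer_def permutes_id)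
  finally show ?thesis .
qed

lemma subrep_S: "subrep S"
  unfolding subrep_def
proof (intro conjI allI impI ballI)
  fix g f assume g: "g permutes {1..n}" and f: "f \<in> S"
  from f show "tabloid_action g f \<in> S" unfolding specht_module_def
  proof (induction rule: fun_space.span_induct_alt)
    case base
    then show ?case by (simp add: fun_space.span_zero)
  next
    case (step c x y)
    then obtain T where T: "T \<in> tableaux n la" "x = polytabloid n T" by auto
    then have "tabloid_action g x \<in> S"
      using act_polytabloid[OF g] polytabloid_in_S tableaux_comp[OF permutes_inv[OF g]] by simp
    then show ?case using step
      by (simp add: act_add act_scale fun_space.span_add fun_space.span_scale specht_module_def)
  qed
qed (use subspace_S S_subset_V in auto)

text \<open>Otherwise an injection into the cells of the rows up to \<open>r\<close> would send an entry to its block and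
  column or, in a column that does not reach row \<open>r\<close>, to its cell.\<close>

lemma column_pigeonhole:
  assumes T: "T \<in> tableaux n la" and s: "r < s" "s < length la" and x: "x \<in> rows la s"
  obtains q a b where "q < r \<and> a \<in> rows la q \<and> b \<in> rows la q \<or> a \<in> insert x (rows la r) \<and> b \<in> insert x (rows la r)"
    "q < length la" "a \<noteq> b" "snd (T a) = snd (T b)"
proof (rule ccontr)
  assume no: "\<not> thesis"
  \<comment> \<open>\<open>D\<close> has \<open>rstart la (Suc r) + 1\<close> elements, one more
    than there are cells in the rows up to \<open>r\<close>; \<open>bi\<close> assigns the
    additional entry \<open>x\<close> to block \<open>r\<close>.\<close>
  define D where "D = insert x {0<..rstart la (Suc r)}"
  define bi where "bi y = (if y = x then r else row_index la y)" for y
  define K where "K = Sigma {..r} (\<lambda>i. {..<la ! i})"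
  define F where "F y = (if (r, snd (T y)) \<in> cells la then (bi y, snd (T y)) else T y)" for y
  have xD: "x \<notin> {0<..rstart la (Suc r)}" using x rstart_mono[of "Suc r" s la] s by (auto simp: rows_def)
  have D1: "D \<subseteq> {1..n}" using x rows_subset[of la n s] rstart_le[of la "Suc r"] sum_la by (auto simp: D_def)
  have bi: "bi y \<le> r" "y \<in> (if bi y = r then insert x (rows la r) else rows la (bi y))" if y: "y \<in> D" for y
  proof -
    have "bi y \<le> r \<and> y \<in> (if bi y = r then insert x (rows la r) else rows la (bi y))"
    proof (cases "y = x")
      case False
      then have y1: "y \<in> {1..sum_list la}" "y \<le> rstart la (Suc r)"
        using y rstart_le[of la "Suc r"] by (auto simp: D_def)
      have "row_index la y \<le> r"
        using row_index_rows[OF y1(1)] y1(2) rstart_mono[of "Suc r" "row_index la y" la]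
        by (auto simp: rows_def not_le[symmetric] intro: ccontr)
      then show ?thesis using row_index_rows(2)[OF y1(1)] False by (auto simp: bi_def)
    qed (simp add: bi_def)
    then show "bi y \<le> r" "y \<in> (if bi y = r then insert x (rows la r) else rows la (bi y))" by auto
  qed
  have cell: "T y \<in> cells la" if "y \<in> D" for y
    using T D1 that by (auto simp: tableaux_def bij_betw_def)
  have FK: "F y \<in> K" if y: "y \<in> D" for y
  proof (cases "(r, snd (T y)) \<in> cells la")
    case True
    then show ?thesis using bi(1)[OF y] la_decreasing[OF bi(1)[OF y]]
      by (auto simp: F_def K_def cells_def intro: less_le_trans)
  next
    case False
    obtain i j where ij: "T y = (i, j)" by force
    then have c: "i < length la" "j < la ! i" using cell[OF y] by (auto simp: cells_def)
    \<comment> \<open>A cell below row \<open>r\<close> would make its column reach row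
      \<open>r\<close>, because the row lengths decrease.\<close>
    have "i \<le> r"
    proof (rule ccontr)
      assume "\<not> i \<le> r"
      then have "la ! i \<le> la ! r" using la_decreasing c by simp
      then show False using False ij c s by (auto simp: cells_def)
    qed
    then show ?thesis using False ij c by (simp add: F_def K_def)
  qed
  have "inj_on F D"
  proof (rule inj_onI)
    fix y z assume yz: "y \<in> D" "z \<in> D" "F y = F z"
    have col: "snd (T y) = snd (T z)"
      using arg_cong[OF yz(3), of snd] by (simp add: F_def split: if_splits)
    show "y = z"
    proof (cases "(r, snd (T y)) \<in> cells la")
      case True
      then have b: "bi y = bi z" using yz(3) col by (simp add: F_def)
      show ?thesis
      proof (rule ccontr)
        assume "y \<noteq> z"
        then show False using no that[of "bi y" y z] bi[OF yz(1)] bi[OF yz(2)] b col s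
          by (cases "bi y = r") auto
      qed
    next
      case False
      then have "T y = T z" using yz(3) col by (simp add: F_def)
      then show ?thesis using T D1 yz by (auto simp: tableaux_def bij_betw_def inj_on_def)
    qed
  qed
  moreover have "F ` D \<subseteq> K" using FK by blast
  moreover have "finite K" by (simp add: K_def)
  ultimately have "card D \<le> card K" by (rule card_inj_on_le)
  moreover have "card D = Suc (rstart la (Suc r))" using xD by (simp add: D_def)
  moreover have "card K = rstart la (Suc r)"
  proof -
    have "(\<Sum>i\<le>q. la ! i) = rstart la (Suc q)" if "q < length la" for q
      using that by (induction q) (simp_all add: rstart_Suc)
    then show ?thesis using s by (simp add: K_def)
  qed
  ultimately show False by simp
qed

text \<open>In every tableau some column contains two entries of one block. Their transposition
  fixes \<open>h\<close> and negates the polytabloid, so \<open>h\<close> is orthogonal to a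
  spanning set of the space in which it lies.\<close>

lemma S_block_invariant_eq_0:
  assumes h: "h \<in> S" and s: "r < s" "s < length la" and x: "x \<in> rows la s"
    and inv: "\<And>q. q < r \<Longrightarrow> invariant_on (rows la q) h" "invariant_on (insert x (rows la r)) h"
  shows "h = 0"
proof -
  have hV: "h \<in> V" using h S_subset_V by auto
  have sub: "rows la q \<subseteq> {1..n}" for q using rows_subset sum_la by simp
  have "ip (tabloids n la) h (polytabloid n T) = 0" if T: "T \<in> tableaux n la" for T
  proof -
    obtain q a b where ab: "q < r \<and> a \<in> rows la q \<and> b \<in> rows la q \<or> a \<in> insert x (rows la r) \<and> b \<in> insert x (rows la r)"
      "q < length la" "a \<noteq> b" "snd (T a) = snd (T b)"
      using column_pigeonhole[OF T s x] by metis
    have ab1: "a \<in> {1..n}" "b \<in> {1..n}" using ab(1) x sub by blast+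
    have "tabloid_action (transpose a b) h = h" using ab(1) inv by (auto simp: invariant_on_def)
    then have "ip (tabloids n la) h (polytabloid n T) = ip (tabloids n la) h (- polytabloid n T)"
      using ip_transpose[OF ab1 hV polytabloid_V[OF T]] act_transpose_polytabloid[OF ab1 ab(3,4)] by simp
    also have "\<dots> = - ip (tabloids n la) h (polytabloid n T)"
      using ip_diff_right[of "tabloids n la" h 0 "polytabloid n T"] by simp
    finally show ?thesis by simp
  qed
  then have "ip (tabloids n la) h h = 0"
    using ip_span_0[of "polytabloid n ` tableaux n la" "tabloids n la" h h] h by (auto simp: specht_module_def)
  then show ?thesis using ip_0D[OF hV] by simp
qed

text \<open>Raising stays inside \<open>S\<close> and yields a vector invariant on row
  \<open>r\<close> enlarged by \<open>x\<close> and on all earlier rows; the pigeonhole principle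
  for columns makes such a vector zero.\<close>

lemma row_invariant_S_HW:
  assumes f: "f \<in> S" "row_invariant la f"
  shows "f \<in> HW la"
proof -
  have fV: "f \<in> V" using f S_subset_V by auto
  have sub: "rows la q \<subseteq> {1..n}" for q using rows_subset sum_la by simp
  have "raise (rows la r) x f = 0" if s: "s < length la" "r < s" and x: "x \<in> rows la s" for r s x
  proof (rule S_block_invariant_eq_0[OF _ s(2,1) x])
    let ?h = "raise (rows la r) x f"
    have x1: "x \<in> {1..n}" using x sub by blast
    have xr: "x \<notin> rows la r" using rows_disjoint[OF _ x] s by simp
    have fr: "invariant_on (rows la r) f" using f s by (simp add: row_invariant_def)
    have hV: "?h \<in> V" using raise_V[OF sub x1 fV] .
    have "tabloid_action (transpose i x) f \<in> S" if "i \<in> rows la r" for i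
      using subrep_S transpose_permutes[OF _ x1] that sub f(1) unfolding subrep_def by blast
    then show "?h \<in> S" unfolding raise_def
      using f(1) subspace_S by (intro fun_space.subspace_add fun_space.subspace_sum)
    have ax: "tabloid_action (transpose a x) ?h = ?h" if "a \<in> rows la r" for a
      using raise_invariant[OF sub x1 xr fV fr that] .
    \<comment> \<open>A transposition inside row \<open>r\<close> arises by conjugating one that
      involves \<open>x\<close> with another such one.\<close>
    have ab: "tabloid_action (transpose b a) ?h = ?h" if ab: "a \<in> rows la r" "b \<in> rows la r" "a \<noteq> b" for a b
    proof -
      have ab1: "a \<in> {1..n}" "b \<in> {1..n}" using ab sub by blast+
      have "transpose a x b = b" using ab xr by (intro transpose_apply_other) auto
      then show ?thesis using act_conj[OF transpose_permutes[OF ab1(1) x1] ab1(2) x1, of ?h] ax ab by simp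
    qed
    show "invariant_on (insert x (rows la r)) ?h"
      using ax ab act_id[OF hV] unfolding invariant_on_def
      by (metis insertE transpose_commute transpose_same)
    fix q assume q: "q < r"
    have "tabloid_action (transpose a b) ?h = ?h" if ab: "a \<in> rows la q" "b \<in> rows la q" for a b
    proof -
      have ab1: "a \<in> {1..n}" "b \<in> {1..n}" using ab sub by blast+
      have nx: "transpose a b x = x"
        using rows_disjoint[OF _ ab(1), of s] rows_disjoint[OF _ ab(2), of s] x q s by (intro transpose_apply_other) auto
      have "q < length la" using q s by simp
      then have ff: "tabloid_action (transpose a b) f = f" using f ab by (simp add: row_invariant_def invariant_on_def)
      have "tabloid_action (transpose a b) (tabloid_action (transpose i x) f) = tabloid_action (transpose i x) f"
        if i: "i \<in> rows la r" for i
      proof -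
        have "transpose a b i = i"
          using rows_disjoint[OF _ ab(1), of r] rows_disjoint[OF _ ab(2), of r] i q by (intro transpose_apply_other) auto
        moreover have "i \<in> {1..n}" using i sub by blast
        ultimately show ?thesis using act_conj[OF transpose_permutes[OF ab1] _ x1, of i f] nx ff by simp
      qed
      then show ?thesis using ff by (simp add: raise_def act_add act_sum)
    qed
    then show "invariant_on (rows la q) ?h" by (simp add: invariant_on_def)
  qed
  then show ?thesis using f by (simp add: HW_def)
qed

text \<open>The generator is the orthogonal projection of the row reading tabloid.\<close>

lemma specht_generator:
  obtains u where "u \<in> HW la" "u \<noteq> 0" "cyclic u = S"
proof -
  let ?ip = "ip (tabloids n la)"
  define r0 where "r0 = tabloid n (row_reading la)"
  define e0 where "e0 = unit_fun r0"
  have r0: "r0 \<in> tabloids n la" using row_reading_tableau by (simp add: r0_def tabloids_def)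
  have e0V: "e0 \<in> V" using unit_fun_in_supp[OF r0] by (simp add: e0_def)
  obtain u where u: "u \<in> S" "\<And>y. y \<in> S \<Longrightarrow> ?ip (e0 - u) y = 0"
    using projection_exists[OF finite_tabloids S_subset_V subspace_S, of e0] by metis
  have uV: "u \<in> V" using u S_subset_V by auto
  have SG: "tabloid_action g y \<in> S" if "g permutes {1..n}" "y \<in> S" for g y
    using subrep_S that by (auto simp: subrep_def)
  \<comment> \<open>The orthogonal projection onto the invariant subspace \<open>S\<close> commutes
    with the action.\<close>
  have proj: "?ip (tabloid_action g e0 - tabloid_action g u) y = 0" if g: "g permutes {1..n}" and y: "y \<in> S" for g y
  proof -
    have "?ip (tabloid_action g (e0 - u)) y = ?ip (e0 - u) (tabloid_action (inv' g) y)"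
      using y S_subset_V by (intro ip_act_left[OF g V_diff[OF e0V uV]]) auto
    then show ?thesis using u(2)[OF SG[OF permutes_inv[OF g] y]] by (simp add: act_diff)
  qed
  \<comment> \<open>If \<open>g\<close> fixes \<open>e0\<close>, then \<open>u\<close> and its
    translate are both the projection of \<open>e0\<close>.\<close>
  have fix_u: "tabloid_action g u = u" if g: "g permutes {1..n}" and e: "tabloid_action g e0 = e0" for g
  proof -
    let ?d = "tabloid_action g u - u"
    have d: "?d \<in> S" using SG[OF g u(1)] u(1) subspace_S by (simp add: fun_space.subspace_diff)
    have "?ip (e0 - u) ?d - ?ip (e0 - tabloid_action g u) ?d = 0"
      using proj[OF g d] u(2)[OF d] e by simp
    then have "?ip ?d ?d = 0" by (simp add: ip_simps)
    then have "?d = 0" using d S_subset_V ip_0D by blast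
    then show ?thesis by simp
  qed
  have act_e0: "tabloid_action g e0 = unit_fun (r0 \<circ> inv' g)" if g: "g permutes {1..n}" for g
  proof -
    have "r \<circ> g = r0 \<longleftrightarrow> r = r0 \<circ> inv' g" for r using comp_inv_cancel[OF g] by metis
    then show ?thesis by (simp add: e0_def tabloid_action_def unit_fun_def)
  qed
  have "row_invariant la u"
    unfolding row_invariant_def invariant_on_def
  proof (intro conjI allI impI ballI uV)
    fix r x y assume r: "r < length la" and xy: "x \<in> rows la r" "y \<in> rows la r"
    have xy1: "x \<in> {1..n}" "y \<in> {1..n}" using xy rows_subset[of la n r] sum_la by auto
    have "r0 \<circ> transpose x y = r0"
    proof
      fix z
      have "r0 x = r0 y" using xy xy1 row_index_eq[OF r] by (simp add: r0_def tabloid_def row_reading_def)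
      then show "(r0 \<circ> transpose x y) z = r0 z" by (auto simp: transpose_def)
    qed
    then have "tabloid_action (transpose x y) e0 = e0"
      using act_e0[OF transpose_permutes[OF xy1]] by (simp add: e0_def)
    then show "tabloid_action (transpose x y) u = u" using fix_u[OF transpose_permutes[OF xy1]] by blast
  qed
  then have HWu: "u \<in> HW la" using row_invariant_S_HW[OF u(1)] by blast
  let ?e = "polytabloid n (row_reading la)"
  have "?ip u ?e = ?ip e0 ?e"
    using u(2)[OF polytabloid_in_S[OF row_reading_tableau]] by (simp add: ip_simps)
  also have "\<dots> = 1"
    using ip_unit_right[OF finite_tabloids r0, of ?e] polytabloid_self[OF row_reading_tableau]
    by (simp add: e0_def r0_def ip_commute)
  finally have u0: "u \<noteq> 0" by auto
  have "S \<subseteq> cyclic u"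
  proof
    fix y assume y: "y \<in> S"
    have "\<exists>g. g permutes {1..n} \<and> r = r0 \<circ> inv' g" if r: "r \<in> tabloids n la" for r
    proof -
      obtain T where T: "T \<in> tableaux n la" "r = tabloid n T" using r by (auto simp: tabloids_def)
      let ?T0 = "row_reading la"
      have bT: "bij_betw T {1..n} (cells la)" and b0: "bij_betw ?T0 {1..n} (cells la)"
        using T row_reading_tableau by (auto simp: tableaux_def)
      \<comment> \<open>\<open>k\<close> sends an entry to the one occupying the same cell of the
        row reading tableau; this shows that the action on tabloids is transitive.\<close>
      define k where "k x = (if x \<in> {1..n} then inv_into {1..n} ?T0 (T x) else x)" for x
      have "bij_betw (inv_into {1..n} ?T0 \<circ> T) {1..n} {1..n}"
        using bij_betw_trans[OF bT bij_betw_inv_into[OF b0]] .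
      then have "bij_betw k {1..n} {1..n}"
        by (subst bij_betw_cong[of _ _ "inv_into {1..n} ?T0 \<circ> T"]) (auto simp: k_def)
      then have k: "k permutes {1..n}" by (rule bij_imp_permutes) (simp only: k_def if_False)
      have "?T0 (k x) = T x" if "x \<in> {1..n}" for x
        using that bij_betw_inv_into_right[OF b0] bij_betwE[OF bT] by (simp add: k_def)
      then have "r = tabloid n (?T0 \<circ> k)"
        unfolding T(2) tabloid_def by (intro restrict_ext) simp
      then have "r = r0 \<circ> k" using tabloid_comp[OF k, of ?T0] by (simp add: r0_def)
      then show ?thesis using permutes_inv[OF k] permutes_inv_inv[OF k] by (intro exI[of _ "inv' k"]) simp
    qed
    then obtain g where g: "\<And>r. r \<in> tabloids n la \<Longrightarrow> g r permutes {1..n} \<and> r = r0 \<circ> inv' (g r)" by metis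
    \<comment> \<open>\<open>y\<close> is a combination of translates of \<open>e0\<close>, and
      \<open>p\<close> is the same combination of translates of \<open>u\<close>. So
      \<open>p\<close> is the projection of \<open>y\<close> to \<open>S\<close>, which is
      \<open>y\<close> itself.\<close>
    define p where "p = (\<Sum>r\<in>tabloids n la. fun_scale (y r) (tabloid_action (g r) u))"
    have p: "p \<in> cyclic u" unfolding p_def
      using act_in_cyclic g by (auto simp: cyclic_def intro!: fun_space.span_sum fun_space.span_scale)
    have pS: "p \<in> S" using cyclic_subset[OF subrep_S u(1)] p by auto
    have "y = (\<Sum>r\<in>tabloids n la. fun_scale (y r) (unit_fun r))"
      using supp_space_expand[OF finite_tabloids] y S_subset_V by blast
    also have "\<dots> = (\<Sum>r\<in>tabloids n la. fun_scale (y r) (tabloid_action (g r) e0))"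
      using act_e0 g by (intro sum.cong refl) metis
    finally have yp: "y - p = (\<Sum>r\<in>tabloids n la. fun_scale (y r) (tabloid_action (g r) e0 - tabloid_action (g r) u))"
      by (simp add: p_def fun_space.scale_right_diff_distrib sum_subtractf)
    have ypS: "y - p \<in> S" using y pS subspace_S by (simp add: fun_space.subspace_diff)
    have "?ip (y - p) (y - p) = 0"
      unfolding yp ip_sum_left ip_scale_left using proj g ypS by (intro sum.neutral) (simp add: yp)
    then have "y - p = 0" using ypS S_subset_V ip_0D by blast
    then show "y \<in> cyclic u" using p by simp
  qed
  then have "cyclic u = S" using cyclic_subset[OF subrep_S u(1)] by auto
  then show thesis using that HWu u0 by blast
qed

end

section \<open>Multiplicities\<close>

context ortho_rep
begin

text \<open>Directness is stated for the zero vector only; uniqueness of components follows by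
  subtraction.\<close>

definition decomposition :: "('a \<Rightarrow> real) set list \<Rightarrow> bool" where
  "decomposition Us \<longleftrightarrow> (\<forall>U\<in>set Us. irrep U) \<and>
     (\<forall>v\<in>V. \<exists>w. (\<forall>i<length Us. w i \<in> Us ! i) \<and> v = (\<Sum>i<length Us. w i)) \<and>
     (\<forall>w. (\<forall>i<length Us. w i \<in> Us ! i) \<and> (\<Sum>i<length Us. w i) = 0 \<longrightarrow> (\<forall>i<length Us. w i = 0))"

lemma JM_subrep:
  assumes U: "subrep U" and k: "k \<in> {1..n}" and f: "f \<in> U"
  shows "JM k f \<in> U"
  unfolding JM_def
proof (rule fun_space.subspace_sum)
  show "fun_space.subspace U" using U by (simp add: subrep_def)
  fix i assume "i \<in> {0<..<k}"
  then have "transpose i k permutes {1..n}" using k by (intro transpose_permutes) auto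
  then show "act (transpose i k) f \<in> U" using U f by (simp add: subrep_def)
qed

text \<open>Jucys-Murphy elements preserve every summand, so the components of a joint eigenvector
  are joint eigenvectors and \<open>HW mu\<close> splits along the decomposition. An irreducible
  summand contributes dimension zero or one.\<close>

lemma dim_HW_decomposition:
  assumes mu: "sum_list mu = n" and D: "decomposition Us"
  shows "fun_space.dim (HW mu) = card {i. i < length Us \<and> HW mu \<inter> Us ! i \<noteq> {0}}"
proof -
  let ?k = "length Us"
  have irr: "irrep (Us ! i)" if "i < ?k" for i using D that by (simp add: decomposition_def)
  then have sub: "subrep (Us ! i)" if "i < ?k" for i using that by (simp add: irrep_def)
  then have ss: "fun_space.subspace (Us ! i)" if "i < ?k" for i using that by (simp add: subrep_def)
  have zero: "w i = 0" if "\<And>i. i < ?k \<Longrightarrow> w i \<in> Us ! i" "(\<Sum>i<?k. w i) = 0" "i < ?k" for w i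
    using D that unfolding decomposition_def by blast
  have WH: "W mu = HW mu" using W_eq_HW mu by simp
  define J where "J = {i. i < ?k \<and> HW mu \<inter> Us ! i \<noteq> {0}}"
  have subHW: "fun_space.subspace (HW mu)" using subspace_HW mu by simp
  have "\<exists>h. h \<in> HW mu \<inter> Us ! i \<and> h \<noteq> 0" if "i \<in> J" for i
    using that subHW ss[of i] fun_space.subspace_0 unfolding J_def by blast
  then obtain h where h: "\<And>i. i \<in> J \<Longrightarrow> h i \<in> HW mu \<inter> Us ! i \<and> h i \<noteq> 0" by metis
  have Jk: "J \<subseteq> {..<?k}" by (auto simp: J_def)
  have finJ: "finite J" using Jk finite_subset by blast
  have indep0: "c i = 0" if "(\<Sum>i\<in>J. fun_scale (c i) (h i)) = 0" "i \<in> J" for c i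
  proof -
    \<comment> \<open>Padding with zeros turns the relation into one between all summands, to which
      directness applies.\<close>
    let ?w = "\<lambda>i. if i \<in> J then fun_scale (c i) (h i) else 0"
    have "(\<Sum>i<?k. ?w i) = (\<Sum>i\<in>J. ?w i)" using Jk by (intro sum.mono_neutral_right) auto
    then have "(\<Sum>i<?k. ?w i) = 0" using that(1) by simp
    moreover have "?w i \<in> Us ! i" if "i < ?k" for i
      using h ss[OF that] by (simp add: fun_space.subspace_0 fun_space.subspace_scale)
    ultimately have "?w i = 0" using zero[of ?w i] that(2) Jk by auto
    then show ?thesis using h that(2) by auto
  qed
  have injh: "inj_on h J"
  proof (rule inj_onI, rule ccontr)
    fix i j assume ij: "i \<in> J" "j \<in> J" "h i = h j" "i \<noteq> j"
    let ?c = "\<lambda>q. if q = i then 1 else if q = j then -1 else 0 :: real"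
    have "(\<Sum>q\<in>J. fun_scale (?c q) (h q)) = (\<Sum>q\<in>{i, j}. fun_scale (?c q) (h q))"
      using ij finJ by (intro sum.mono_neutral_right) auto
    also have "\<dots> = 0" using ij by simp
    finally have "?c i = 0" using indep0[of ?c i] ij(1) by blast
    then show False by simp
  qed
  have ind: "fun_space.independent (h ` J)"
  proof (rule fun_space.independent_if_scalars_zero)
    fix c x assume "(\<Sum>x\<in>h ` J. fun_scale (c x) x) = 0" "x \<in> h ` J"
    then show "c x = 0" using indep0[of "c \<circ> h"] by (auto simp: sum.reindex[OF injh])
  qed (use finJ in simp)
  have "HW mu \<subseteq> fun_space.span (h ` J)"
  proof
    fix v assume v: "v \<in> HW mu"
    then have vV: "v \<in> V" by (simp add: HW_def row_invariant_def)
    obtain w where w: "\<And>i. i < ?k \<Longrightarrow> w i \<in> Us ! i" "v = (\<Sum>i<?k. w i)"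
      using D vV unfolding decomposition_def by blast
    \<comment> \<open>The eigenvalue equation for \<open>v\<close> says that the defects of the
      components sum to zero; each defect lies in its own summand, so each is zero.\<close>
    have "w i \<in> W mu" if i: "i < ?k" for i
      unfolding W_def
    proof (clarify, intro conjI allI ballI impI)
      show "w i \<in> V" using w(1)[OF i] sub[OF i] by (auto simp: subrep_def)
      fix r k assume r: "r < length mu" "k \<in> rows mu r"
      let ?c = "real k - 1 - real (rstart mu r) - real r"
      have k1: "k \<in> {1..n}" using rows_subset[of mu n r] mu r by auto
      have "JM k v = fun_scale ?c v" using v r unfolding WH[symmetric] W_def by blast
      then have "(\<Sum>i<?k. JM k (w i) - fun_scale ?c (w i)) = 0"
        unfolding w(2) sum_subtractf
        by (simp add: JM_def act_sum sum.swap[of _ _ "{..<?k}"] fun_space.scale_sum_right)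
      moreover have "JM k (w i) - fun_scale ?c (w i) \<in> Us ! i" if "i < ?k" for i
        using w(1)[OF that] ss[OF that] JM_subrep[OF sub[OF that] k1]
        by (simp add: fun_space.subspace_diff fun_space.subspace_scale)
      ultimately show "JM k (w i) = fun_scale ?c (w i)"
        using zero[of "\<lambda>i. JM k (w i) - fun_scale ?c (w i)" i] i by simp
    qed
    then have wHW: "w i \<in> HW mu" if "i < ?k" for i using that WH by simp
    have "w i \<in> fun_space.span (h ` J)" if i: "i < ?k" for i
    proof (cases "i \<in> J")
      case True
      then obtain c where "w i = fun_scale c (h i)"
        using irrep_HW_dim_1[OF mu irr[OF i] wHW[OF i] w(1)[OF i]] h by blast
      then show ?thesis using True by (simp add: fun_space.span_scale fun_space.span_base)
    next
      case False
      then have "w i = 0" using wHW[OF i] w(1)[OF i] i by (auto simp: J_def)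
      then show ?thesis by (simp add: fun_space.span_zero)
    qed
    then show "v \<in> fun_space.span (h ` J)" unfolding w(2) by (intro fun_space.span_sum) simp
  qed
  then have "fun_space.dim (HW mu) = card (h ` J)"
    using h ind by (intro fun_space.dim_unique) auto
  then show ?thesis using card_image[OF injh] by (simp add: J_def)
qed

section \<open>Complete reducibility\<close>

lemma orthogonal_complement_subrep:
  assumes U: "subrep U" and X: "subrep X"
  shows "subrep {f \<in> U. \<forall>x\<in>X. ip I f x = 0}"
  unfolding subrep_def
proof (intro conjI allI impI ballI)
  show "fun_space.subspace {f \<in> U. \<forall>x\<in>X. ip I f x = 0}"
    using U unfolding subrep_def fun_space.subspace_def by (auto simp: ip_simps)
  show "{f \<in> U. \<forall>x\<in>X. ip I f x = 0} \<subseteq> V" using U by (auto simp: subrep_def)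
  fix g f assume g: "g permutes {1..n}" and f: "f \<in> {f \<in> U. \<forall>x\<in>X. ip I f x = 0}"
  have "ip I (act g f) x = 0" if x: "x \<in> X" for x
  proof -
    have "f \<in> V" "x \<in> V" using f x U X by (auto simp: subrep_def)
    moreover have "act (inv' g) x \<in> X" using X x permutes_inv[OF g] by (simp add: subrep_def)
    ultimately show ?thesis using ip_act_left[OF g] f by simp
  qed
  then show "act g f \<in> {f \<in> U. \<forall>x\<in>X. ip I f x = 0}" using U f g by (simp add: subrep_def)
qed

text \<open>A nonzero subrepresentation of least dimension is irreducible, since proper subspaces
  have smaller dimension.\<close>

lemma irrep_exists:
  assumes "subrep U" "U \<noteq> {0}"
  obtains X where "irrep X" "X \<subseteq> U"
proof -
  let ?P = "\<lambda>X. subrep X \<and> X \<noteq> {0} \<and> X \<subseteq> U"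
  have "?P U" using assms by simp
  from ex_has_least_nat[of ?P, OF this, of fun_space.dim]
  obtain X where X: "?P X" "\<And>Y. ?P Y \<Longrightarrow> fun_space.dim X \<le> fun_space.dim Y" by blast
  have "irrep X" unfolding irrep_def
  proof (intro conjI allI impI)
    fix Y assume Y: "subrep Y \<and> Y \<subseteq> X"
    show "Y = {0} \<or> Y = X"
    proof (rule ccontr)
      assume no: "\<not> (Y = {0} \<or> Y = X)"
      then have "fun_space.dim Y < fun_space.dim X"
        using Y X(1) by (intro dim_strict_mono[OF finite_I]) (auto simp: subrep_def)
      then show False using X(2)[of Y] X(1) Y no by auto
    qed
  qed (use X in auto)
  then show thesis using X that by blast
qed

lemma subrep_V: "subrep V"
  unfolding subrep_def using act_supp subspace_supp_space by auto

lemma decomposition_exists: "\<exists>Us. decomposition Us"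
proof -
  \<comment> \<open>Stated for all subrepresentations \<open>U\<close> instead of \<open>V\<close>,
    so that induction on the dimension can split the orthogonal complement of an irreducible
    piece.\<close>
  have "\<exists>Us. (\<forall>X\<in>set Us. irrep X \<and> X \<subseteq> U) \<and>
     (\<forall>v\<in>U. \<exists>w. (\<forall>i<length Us. w i \<in> Us ! i) \<and> v = (\<Sum>i<length Us. w i)) \<and>
     (\<forall>w. (\<forall>i<length Us. w i \<in> Us ! i) \<and> (\<Sum>i<length Us. w i) = 0 \<longrightarrow> (\<forall>i<length Us. w i = 0))"
    if "subrep U" for U
    using that
  proof (induction "fun_space.dim U" arbitrary: U rule: less_induct)
    case (less U)
    show ?case
    proof (cases "U = {0}")
      case True
      then show ?thesis by (intro exI[of _ "[]"]) auto
    next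
      case False
      obtain X where X: "irrep X" "X \<subseteq> U" using irrep_exists[OF less.prems False] .
      have sX: "subrep X" using X by (simp add: irrep_def)
      define U' where "U' = {f \<in> U. \<forall>x\<in>X. ip I f x = 0}"
      have sU': "subrep U'" unfolding U'_def by (rule orthogonal_complement_subrep[OF less.prems sX])
      have ssU': "fun_space.subspace U'" and ssX: "fun_space.subspace X" and ssU: "fun_space.subspace U"
        using sU' sX less.prems by (auto simp: subrep_def)
      have V: "X \<subseteq> V" "U \<subseteq> V" using sX less.prems by (auto simp: subrep_def)
      have "X \<noteq> {0}" using X by (simp add: irrep_def)
      then obtain x where x: "x \<in> X" "x \<noteq> 0" using fun_space.subspace_0[OF ssX] by blast
      have "x \<notin> U'" using x V ip_0D[of x] by (auto simp: U'_def)
      then have "U' \<subset> U" using x X by (auto simp: U'_def)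
      then have "fun_space.dim U' < fun_space.dim U" by (rule dim_strict_mono[OF finite_I V(2) _ ssU'])
      then obtain Us where IH: "(\<forall>X\<in>set Us. irrep X \<and> X \<subseteq> U') \<and>
        (\<forall>v\<in>U'. \<exists>w. (\<forall>i<length Us. w i \<in> Us ! i) \<and> v = (\<Sum>i<length Us. w i)) \<and>
        (\<forall>w. (\<forall>i<length Us. w i \<in> Us ! i) \<and> (\<Sum>i<length Us. w i) = 0 \<longrightarrow> (\<forall>i<length Us. w i = 0))"
        using less.hyps[OF _ sU'] by blast
      note Us = IH[THEN conjunct1] IH[THEN conjunct2, THEN conjunct1] IH[THEN conjunct2, THEN conjunct2]
      let ?Us = "X # Us"
      have 1: "\<forall>Y\<in>set ?Us. irrep Y \<and> Y \<subseteq> U" using Us(1) X by (auto simp: U'_def)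
      have 2: "\<exists>w. (\<forall>i<length ?Us. w i \<in> ?Us ! i) \<and> v = (\<Sum>i<length ?Us. w i)" if v: "v \<in> U" for v
      proof -
        obtain p where p: "p \<in> X" "\<And>x. x \<in> X \<Longrightarrow> ip I (v - p) x = 0"
          using projection_exists[OF finite_I V(1) ssX, of v] by metis
        have "v - p \<in> U'" using p v X(2) ssU by (auto simp: U'_def fun_space.subspace_diff)
        then obtain w where w: "\<forall>i<length Us. w i \<in> Us ! i" "v - p = (\<Sum>i<length Us. w i)" using Us(2) by blast
        define w' where "w' = case_nat p w"
        have "v = p + (\<Sum>i<length Us. w i)" using w(2) by (simp add: algebra_simps)
        then have "v = (\<Sum>i<length ?Us. w' i)"
          using sum.lessThan_Suc_shift[of w' "length Us"] by (simp add: w'_def del: sum.lessThan_Suc)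
        moreover have "\<forall>i<length ?Us. w' i \<in> ?Us ! i"
          using w(1) p(1) by (auto simp: w'_def less_Suc_eq_0_disj)
        ultimately show ?thesis by blast
      qed
      have 3: "w i = 0" if w: "\<forall>i<length ?Us. w i \<in> ?Us ! i" "(\<Sum>i<length ?Us. w i) = 0" and i: "i < length ?Us" for w i
      proof -
        have w0: "w 0 \<in> X" and ws: "\<forall>i<length Us. w (Suc i) \<in> Us ! i" using w(1) by auto
        let ?s = "\<Sum>i<length Us. w (Suc i)"
        have sum: "w 0 + ?s = 0"
          using w(2) sum.lessThan_Suc_shift[of w "length Us"] by (simp del: sum.lessThan_Suc)
        have "w (Suc i) \<in> U'" if "i < length Us" for i using ws Us(1) that nth_mem by blast
        then have "?s \<in> U'" by (intro fun_space.subspace_sum[OF ssU']) auto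
        \<comment> \<open>The component in \<open>X\<close> is orthogonal to all others, so pairing
          the relation with it isolates its norm.\<close>
        then have "ip I ?s (w 0) = 0" using w0 by (simp add: U'_def)
        then have "ip I (w 0 + ?s) (w 0) = ip I (w 0) (w 0)" by (simp add: ip_simps)
        then have "ip I (w 0) (w 0) = 0" using sum by simp
        then have w00: "w 0 = 0" using ip_0D w0 V(1) by blast
        then have "?s = 0" using sum by simp
        then have "\<forall>i<length Us. w (Suc i) = 0"
          using spec[OF Us(3), of "\<lambda>i. w (Suc i)"] ws by blast
        moreover note w00
        ultimately show ?thesis using i by (cases i) simp_all
      qed
      show ?thesis by (intro exI[of _ ?Us] conjI ballI allI impI) (use 1 2 3 in blast)+
    qed
  qed
  from this[OF subrep_V] obtain Us where
    Us: "(\<forall>X\<in>set Us. irrep X \<and> X \<subseteq> V) \<and>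
     (\<forall>v\<in>V. \<exists>w. (\<forall>i<length Us. w i \<in> Us ! i) \<and> v = (\<Sum>i<length Us. w i)) \<and>
     (\<forall>w. (\<forall>i<length Us. w i \<in> Us ! i) \<and> (\<Sum>i<length Us. w i) = 0 \<longrightarrow> (\<forall>i<length Us. w i = 0))"
    by (rule exE)
  have "\<forall>X\<in>set Us. irrep X" using conjunct1[OF Us] by simp
  then show ?thesis
    unfolding decomposition_def using conjunct1[OF conjunct2[OF Us]] conjunct2[OF conjunct2[OF Us]]
    by (intro exI[of _ Us] conjI)
qed

end

section \<open>Vectors and matrices as coordinate functions\<close>

definition vec_fun :: "nat \<Rightarrow> real vec \<Rightarrow> nat \<Rightarrow> real" where
  "vec_fun d v = (\<lambda>i. if i < d then v $ i else 0)"

definition mat_act :: "nat \<Rightarrow> real mat \<Rightarrow> (nat \<Rightarrow> real) \<Rightarrow> nat \<Rightarrow> real" where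
  "mat_act d A f = (\<lambda>i. if i < d then \<Sum>j<d. A $$ (i, j) * f j else 0)"

lemma vec_fun_supp: "vec_fun d v \<in> supp_space {..<d}"
  by (simp add: vec_fun_def supp_space_def)

lemma vec_fun_vec: "f \<in> supp_space {..<d} \<Longrightarrow> vec_fun d (vec d f) = f"
  by (auto simp: vec_fun_def supp_space_def fun_eq_iff)

lemma vec_vec_fun: "v \<in> carrier_vec d \<Longrightarrow> vec d (vec_fun d v) = v"
  by (auto simp: vec_fun_def)

lemma vec_fun_inj: "v \<in> carrier_vec d \<Longrightarrow> w \<in> carrier_vec d \<Longrightarrow> vec_fun d v = vec_fun d w \<Longrightarrow> v = w"
  using vec_vec_fun by metis

lemma vec_fun_add: "v \<in> carrier_vec d \<Longrightarrow> w \<in> carrier_vec d \<Longrightarrow> vec_fun d (v + w) = vec_fun d v + vec_fun d w"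
  by (auto simp: vec_fun_def fun_eq_iff fun_apply)

lemma vec_fun_scale: "v \<in> carrier_vec d \<Longrightarrow> vec_fun d (c \<cdot>\<^sub>v v) = fun_scale c (vec_fun d v)"
  by (auto simp: vec_fun_def fun_eq_iff fun_apply)

lemma vec_fun_zero: "vec_fun d (0\<^sub>v d) = 0"
  by (auto simp: vec_fun_def fun_eq_iff fun_apply)

lemma vec_add: "vec d (f + g) = vec d f + vec d g" for f g :: "nat \<Rightarrow> real"
  by (intro eq_vecI) (auto simp: fun_apply)

lemma vec_fun_mat:
  assumes "A \<in> carrier_mat d d" "v \<in> carrier_vec d"
  shows "vec_fun d (A *\<^sub>v v) = mat_act d A (vec_fun d v)"
  using assms by (auto simp: vec_fun_def mat_act_def fun_eq_iff scalar_prod_def lessThan_atLeast0 intro!: sum.cong)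

lemma vec_fun_finsum:
  fixes k :: nat
  assumes "\<And>i. i < k \<Longrightarrow> w i \<in> carrier_vec d"
  shows "vec_fun d (finsum_vec TYPE(real) d w {..<k}) = (\<Sum>i<k. vec_fun d (w i))"
proof
  fix j
  show "vec_fun d (finsum_vec TYPE(real) d w {..<k}) j = (\<Sum>i<k. vec_fun d (w i)) j"
  proof (cases "j < d")
    case True
    have "finsum_vec TYPE(real) d w {..<k} $ j = (\<Sum>i<k. w i $ j)"
      by (rule index_finsum_vec[OF _ True]) (use assms in auto)
    then show ?thesis using True by (simp add: sum_fun_apply vec_fun_def)
  qed (simp add: sum_fun_apply vec_fun_def)
qed

lemma subspace_vec_iff:
  "subspace class_ring W (module_vec TYPE(real) d) \<longleftrightarrow>
     W \<subseteq> carrier_vec d \<and> 0\<^sub>v d \<in> W \<and> (\<forall>v\<in>W. \<forall>w\<in>W. v + w \<in> W) \<and> (\<forall>c. \<forall>v\<in>W. c \<cdot>\<^sub>v v \<in> W)"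
proof -
  have "vectorspace class_ring (module_vec TYPE(real) d)" by (rule vec_vs)
  moreover from this have "Module.module class_ring (module_vec TYPE(real) d)"
    by (simp add: vectorspace_def)
  ultimately show ?thesis
    by (auto simp: VectorSpace.subspace_def submodule_def module_vec_simps class_ring_simps)
qed

locale orthogonal_rep =
  fixes n d :: nat and rho :: "(nat \<Rightarrow> nat) \<Rightarrow> real mat"
  assumes rho: "rho \<in> hom (sym_group n) (orthogonal_group d)"
begin

lemma rho_carrier: "g permutes {1..n} \<Longrightarrow> rho g \<in> carrier_mat d d"
  and rho_orth: "g permutes {1..n} \<Longrightarrow> rho g * transpose_mat (rho g) = 1\<^sub>m d"
  and rho_mult: "g permutes {1..n} \<Longrightarrow> h permutes {1..n} \<Longrightarrow> rho (g \<circ> h) = rho g * rho h"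
  using rho by (auto simp: hom_def sym_group_def orthogonal_group_def)

text \<open>\<open>hom\<close> demands only multiplicativity. The image of \<open>id\<close> is
  idempotent and has its transpose as a right inverse, which forces the identity matrix.\<close>

lemma rho_id: "rho id = 1\<^sub>m d"
proof -
  let ?A = "rho id"
  have A: "?A \<in> carrier_mat d d" "?A * transpose_mat ?A = 1\<^sub>m d" "?A * ?A = ?A"
    using rho_carrier[OF permutes_id] rho_orth[OF permutes_id] rho_mult[OF permutes_id permutes_id] by auto
  have "?A = ?A * (?A * transpose_mat ?A)" using A by simp
  also have "\<dots> = (?A * ?A) * transpose_mat ?A" using A(1) by (intro assoc_mult_mat[symmetric]) auto
  finally show ?thesis using A by simp
qed

abbreviation act :: "(nat \<Rightarrow> nat) \<Rightarrow> (nat \<Rightarrow> real) \<Rightarrow> nat \<Rightarrow> real" where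
  "act g \<equiv> mat_act d (rho g)"

lemma ortho_rep_act: "ortho_rep n {..<d} act"
proof
  show "act g (f + h) = act g f + act g h" for g f h
    by (auto simp: mat_act_def fun_eq_iff fun_apply sum.distrib algebra_simps)
  show "act g (fun_scale c f) = fun_scale c (act g f)" for g c f
    by (auto simp: mat_act_def fun_eq_iff fun_apply sum_distrib_left algebra_simps)
  show "act g f \<in> supp_space {..<d}" for g f by (simp add: mat_act_def supp_space_def)
  show "act id f = f" if f: "f \<in> supp_space {..<d}" for f
  proof -
    have "(\<Sum>j<d. 1\<^sub>m d $$ (i, j) * f j) = f i" if "i < d" for i
    proof -
      have "(\<Sum>j<d. 1\<^sub>m d $$ (i, j) * f j) = (\<Sum>j<d. if j = i then f j else 0)"
        using that by (intro sum.cong) auto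
      then show ?thesis using that by simp
    qed
    then show ?thesis using f by (auto simp: mat_act_def rho_id supp_space_def fun_eq_iff)
  qed
  show "act (g \<circ> k) f = act g (act k f)" if "g permutes {1..n}" "k permutes {1..n}" for g k f
  proof
    fix i
    have A: "rho g \<in> carrier_mat d d" "rho k \<in> carrier_mat d d" using rho_carrier that by auto
    show "act (g \<circ> k) f i = act g (act k f) i"
    proof (cases "i < d")
      case True
      have "act (g \<circ> k) f i = (\<Sum>j<d. \<Sum>l<d. rho g $$ (i, l) * rho k $$ (l, j) * f j)"
        using True A rho_mult[OF that]
        by (simp add: mat_act_def scalar_prod_def lessThan_atLeast0 sum_distrib_right)
      also have "\<dots> = (\<Sum>l<d. \<Sum>j<d. rho g $$ (i, l) * rho k $$ (l, j) * f j)" by (rule sum.swap)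
      also have "\<dots> = act g (act k f) i"
        using True by (simp add: mat_act_def sum_distrib_left mult.assoc)
      finally show ?thesis .
    qed (simp add: mat_act_def)
  qed
  show "ip {..<d} (act g f) (act g h) = ip {..<d} f h" if g: "g permutes {1..n}" for g f h
  proof -
    have A: "rho g \<in> carrier_mat d d" using rho_carrier[OF g] .
    \<comment> \<open>\<open>orthogonal_group\<close> states that the rows are orthonormal, but
      invariance of the inner product needs orthonormal columns; a one-sided inverse of a square
      matrix is two-sided.\<close>
    have "transpose_mat (rho g) * rho g = 1\<^sub>m d"
      using mat_mult_left_right_inverse[OF A _ rho_orth[OF g]] A by simp
    then have "(transpose_mat (rho g) * rho g) $$ (j, l) = 1\<^sub>m d $$ (j, l)" for j l by simp
    note * = this
    have AA: "(\<Sum>i<d. rho g $$ (i, j) * rho g $$ (i, l)) = of_bool (j = l)" if "j < d" "l < d" for j l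
      using that A *[of j l] by (simp add: scalar_prod_def lessThan_atLeast0)
    have "ip {..<d} (act g f) (act g h) =
        (\<Sum>i<d. \<Sum>j<d. \<Sum>l<d. (rho g $$ (i, j) * rho g $$ (i, l)) * (f j * h l))"
      by (simp add: ip_def mat_act_def sum_product algebra_simps)
    also have "\<dots> = (\<Sum>j<d. \<Sum>i<d. \<Sum>l<d. (rho g $$ (i, j) * rho g $$ (i, l)) * (f j * h l))"
      by (rule sum.swap)
    also have "\<dots> = (\<Sum>j<d. \<Sum>l<d. \<Sum>i<d. (rho g $$ (i, j) * rho g $$ (i, l)) * (f j * h l))"
      by (intro sum.cong refl sum.swap)
    also have "\<dots> = (\<Sum>j<d. \<Sum>l<d. of_bool (j = l) * (f j * h l))"
      using AA by (intro sum.cong refl) (simp add: sum_distrib_right[symmetric])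
    also have "\<dots> = (\<Sum>j<d. \<Sum>l<d. if l = j then f j * h l else 0)"
      by (intro sum.cong refl) auto
    also have "\<dots> = ip {..<d} f h" by (simp add: ip_def)
    finally show ?thesis .
  qed
qed simp

sublocale ortho_rep n "{..<d}" act
  by (rule ortho_rep_act)

lemma vec_fun_rho: "g permutes {1..n} \<Longrightarrow> v \<in> carrier_vec d \<Longrightarrow> vec_fun d (rho g *\<^sub>v v) = act g (vec_fun d v)"
  using vec_fun_mat rho_carrier by blast

lemma vec_act: "g permutes {1..n} \<Longrightarrow> vec d (act g f) = rho g *\<^sub>v vec d f" if "f \<in> V"
  using vec_fun_rho[of g "vec d f"] vec_vec_fun[of "rho g *\<^sub>v vec d f" d] vec_fun_vec[OF that] rho_carrier[of g]
  by simp

lemma subrepresentation_iff: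
  fixes W :: "real vec set"
  assumes W: "W \<subseteq> carrier_vec d"
  shows "subrepresentation n d rho W \<longleftrightarrow> subrep (vec_fun d ` W)"
proof
  assume "subrepresentation n d rho W"
  then have s: "0\<^sub>v d \<in> W" "\<And>v w. v \<in> W \<Longrightarrow> w \<in> W \<Longrightarrow> v + w \<in> W" "\<And>c v. v \<in> W \<Longrightarrow> c \<cdot>\<^sub>v v \<in> W"
    and g: "\<And>g w. g permutes {1..n} \<Longrightarrow> w \<in> W \<Longrightarrow> rho g *\<^sub>v w \<in> W"
    by (auto simp: subrepresentation_def subspace_vec_iff sym_group_def)
  show "subrep (vec_fun d ` W)"
    unfolding subrep_def fun_space.subspace_def
  proof (intro conjI allI impI ballI)
    show "0 \<in> vec_fun d ` W" using s(1) vec_fun_zero by (metis image_eqI)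
    show "vec_fun d ` W \<subseteq> V" using vec_fun_supp by auto
    fix x assume "x \<in> vec_fun d ` W"
    then obtain v where v: "v \<in> W" "x = vec_fun d v" by auto
    show "fun_scale c x \<in> vec_fun d ` W" for c
      using s(3)[OF v(1)] vec_fun_scale[of v d] v W by (metis image_eqI subsetD)
    show "act g x \<in> vec_fun d ` W" if "g permutes {1..n}" for g
      using g[OF that v(1)] vec_fun_rho[OF that, of v] v W by (metis image_eqI subsetD)
    fix y assume "y \<in> vec_fun d ` W"
    then obtain w where w: "w \<in> W" "y = vec_fun d w" by auto
    show "x + y \<in> vec_fun d ` W"
      using s(2)[OF v(1) w(1)] vec_fun_add[of v d w] v w W by (metis image_eqI subsetD)
  qed
next
  assume s: "subrep (vec_fun d ` W)"
  have mem: "v \<in> W" if "v \<in> carrier_vec d" "vec_fun d v \<in> vec_fun d ` W" for v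
    using that vec_fun_inj W by blast
  have ss: "fun_space.subspace (vec_fun d ` W)" using s by (simp add: subrep_def)
  show "subrepresentation n d rho W"
    unfolding subrepresentation_def subspace_vec_iff
  proof (intro conjI allI impI ballI W)
    show "0\<^sub>v d \<in> W" using fun_space.subspace_0[OF ss] by (intro mem) (auto simp: vec_fun_zero)
    fix v assume v: "v \<in> W"
    then have vc: "v \<in> carrier_vec d" using W by auto
    show "c \<cdot>\<^sub>v v \<in> W" for c
      using fun_space.subspace_scale[OF ss, of "vec_fun d v" c] v vc by (intro mem) (simp_all add: vec_fun_scale)
    show "v + w \<in> W" if w: "w \<in> W" for w
    proof -
      have "w \<in> carrier_vec d" using w W by auto
      then show ?thesis using fun_space.subspace_add[OF ss, of "vec_fun d v" "vec_fun d w"] v w vc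
        by (intro mem) (simp_all add: vec_fun_add)
    qed
  next
    fix g v assume "g \<in> carrier (sym_group n)" and v: "v \<in> W"
    then have g: "g permutes {1..n}" by (simp add: sym_group_def)
    have vc: "v \<in> carrier_vec d" using W v by auto
    show "rho g *\<^sub>v v \<in> W"
      using s v vc g rho_carrier[OF g] by (intro mem) (auto simp: vec_fun_rho subrep_def)
  qed
qed

lemma vec_image: "U \<subseteq> V \<Longrightarrow> vec_fun d ` vec d ` U = U"
proof -
  assume "U \<subseteq> V"
  then have "vec_fun d (vec d f) = f" if "f \<in> U" for f using that vec_fun_vec by blast
  then show ?thesis by (simp add: image_comp)
qed

lemma subrepresentation_carrier: "subrepresentation n d rho X \<Longrightarrow> X \<subseteq> carrier_vec d"
  by (simp add: subrepresentation_def subspace_vec_iff)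

lemma irreducible_iff:
  fixes W :: "real vec set"
  assumes W: "W \<subseteq> carrier_vec d"
  shows "irreducible_subrepresentation n d rho W \<longleftrightarrow> irrep (vec_fun d ` W)"
proof -
  have inj: "inj_on (vec_fun d) (carrier_vec d)" using vec_fun_inj by (intro inj_onI) blast
  have z: "X = {0\<^sub>v d} \<longleftrightarrow> vec_fun d ` X = {0}" if "X \<subseteq> carrier_vec d" for X
    using inj_on_image_eq_iff[OF inj that, of "{0\<^sub>v d}"] by (simp add: vec_fun_zero)
  have "(\<forall>U. subrepresentation n d rho U \<and> U \<subseteq> W \<longrightarrow> U = {0\<^sub>v d} \<or> U = W) \<longleftrightarrow>
      (\<forall>U'. subrep U' \<and> U' \<subseteq> vec_fun d ` W \<longrightarrow> U' = {0} \<or> U' = vec_fun d ` W)"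
  proof (intro iffI allI impI)
    fix U assume *: "\<forall>U. subrepresentation n d rho U \<and> U \<subseteq> W \<longrightarrow> U = {0\<^sub>v d} \<or> U = W"
      and U: "subrep U \<and> U \<subseteq> vec_fun d ` W"
    have UV: "U \<subseteq> V" using U by (simp add: subrep_def)
    let ?U = "vec d ` U"
    have im: "vec_fun d ` ?U = U" using vec_image[OF UV] .
    have c: "?U \<subseteq> carrier_vec d" by auto
    have "subrepresentation n d rho ?U" using subrepresentation_iff[OF c] U im by simp
    moreover have "?U \<subseteq> W" using U im inj_onD[OF inj] c W by blast
    ultimately have "?U = {0\<^sub>v d} \<or> ?U = W" using * by blast
    then show "U = {0} \<or> U = vec_fun d ` W" using z[OF c] im by auto
  next
    fix U assume *: "\<forall>U'. subrep U' \<and> U' \<subseteq> vec_fun d ` W \<longrightarrow> U' = {0} \<or> U' = vec_fun d ` W"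
      and U: "subrepresentation n d rho U \<and> U \<subseteq> W"
    have c: "U \<subseteq> carrier_vec d" using U W by auto
    have "subrep (vec_fun d ` U)" using subrepresentation_iff[OF c] U by simp
    moreover have "vec_fun d ` U \<subseteq> vec_fun d ` W" using U by blast
    ultimately have "vec_fun d ` U = {0} \<or> vec_fun d ` U = vec_fun d ` W" using * by blast
    then show "U = {0\<^sub>v d} \<or> U = W" using z[OF c] inj_on_image_eq_iff[OF inj c W] by simp
  qed
  then show ?thesis
    using subrepresentation_iff[OF W] z[OF W] by (simp add: irreducible_subrepresentation_def irrep_def)
qed

lemma decomposition_of_irreducible:
  assumes "irreducible_decomposition n d rho Ws"
  shows "decomposition (map ((`) (vec_fun d)) Ws)"
proof -
  let ?k = "length Ws"
  have irr: "\<And>W. W \<in> set Ws \<Longrightarrow> irreducible_subrepresentation n d rho W"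
    and ex1: "\<And>v. v \<in> carrier_vec d \<Longrightarrow> \<exists>!w. w \<in> (\<Pi>\<^sub>E i\<in>{..<?k}. Ws ! i) \<and> v = finsum_vec TYPE(real) d w {..<?k}"
    using assms by (auto simp: irreducible_decomposition_def)
  have c: "W \<subseteq> carrier_vec d" if "W \<in> set Ws" for W
    using irr[OF that] subrepresentation_carrier by (simp add: irreducible_subrepresentation_def)
  show ?thesis unfolding decomposition_def
  proof (intro conjI ballI allI impI)
    fix U assume "U \<in> set (map ((`) (vec_fun d)) Ws)"
    then show "irrep U" using irr irreducible_iff c by auto
  next
    fix v assume v: "v \<in> V"
    obtain w where w: "w \<in> (\<Pi>\<^sub>E i\<in>{..<?k}. Ws ! i)" "vec d v = finsum_vec TYPE(real) d w {..<?k}"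
      using ex1[of "vec d v"] by auto
    have wi: "w i \<in> Ws ! i" if "i < ?k" for i using w(1) that by auto
    have "v = (\<Sum>i<?k. vec_fun d (w i))"
      using w(2) vec_fun_vec[OF v] vec_fun_finsum[of ?k w d] wi c nth_mem by (metis subsetD)
    then show "\<exists>w. (\<forall>i<length (map ((`) (vec_fun d)) Ws). w i \<in> map ((`) (vec_fun d)) Ws ! i) \<and>
         v = (\<Sum>i<length (map ((`) (vec_fun d)) Ws). w i)"
      using wi by (intro exI[of _ "\<lambda>i. vec_fun d (w i)"]) auto
  next
    fix w i
    assume w: "(\<forall>i<length (map ((`) (vec_fun d)) Ws). w i \<in> map ((`) (vec_fun d)) Ws ! i) \<and>
         (\<Sum>i<length (map ((`) (vec_fun d)) Ws). w i) = 0"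
      and i: "i < length (map ((`) (vec_fun d)) Ws)"
    then have wi: "w i \<in> vec_fun d ` (Ws ! i)" if "i < ?k" for i using that by simp
    have sum0: "(\<Sum>i<?k. w i) = 0" using w by simp
    \<comment> \<open>The given family and the zero family both represent the zero vector. They are
      made extensional because uniqueness is stated in the extensional product.\<close>
    define w1 where "w1 = (\<lambda>i\<in>{..<?k}. vec d (w i))"
    define w2 where "w2 = (\<lambda>i\<in>{..<?k}. 0\<^sub>v d :: real vec)"
    have w1i: "w1 i \<in> Ws ! i \<and> vec_fun d (w1 i) = w i" if i: "i < ?k" for i
    proof -
      obtain x where "x \<in> Ws ! i" "w i = vec_fun d x" using wi[OF i] by auto
      then show ?thesis using i c[of "Ws ! i"] vec_vec_fun[of x d] by (auto simp: w1_def)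
    qed
    have z: "0\<^sub>v d \<in> Ws ! i" if "i < ?k" for i
      using irr[of "Ws ! i"] that
      by (auto simp: irreducible_subrepresentation_def subrepresentation_def subspace_vec_iff)
    have cc: "w1 i \<in> carrier_vec d" "w2 i \<in> carrier_vec d" if "i < ?k" for i using that by (auto simp: w1_def w2_def)
    have f1: "vec_fun d (finsum_vec TYPE(real) d w1 {..<?k}) = 0"
      using vec_fun_finsum[of ?k w1 d] cc w1i sum0 by simp
    have f2: "vec_fun d (finsum_vec TYPE(real) d w2 {..<?k}) = 0"
      using vec_fun_finsum[of ?k w2 d] cc by (simp add: w2_def vec_fun_zero)
    have car: "finsum_vec TYPE(real) d w1 {..<?k} \<in> carrier_vec d" "finsum_vec TYPE(real) d w2 {..<?k} \<in> carrier_vec d"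
      using cc by (auto intro!: finsum_vec_closed)
    have "0\<^sub>v d = finsum_vec TYPE(real) d w1 {..<?k}" "0\<^sub>v d = finsum_vec TYPE(real) d w2 {..<?k}"
      using f1 f2 car vec_fun_zero by (auto intro!: vec_fun_inj)
    moreover have "w1 \<in> (\<Pi>\<^sub>E i\<in>{..<?k}. Ws ! i)" "w2 \<in> (\<Pi>\<^sub>E i\<in>{..<?k}. Ws ! i)"
      using w1i z by (auto simp: w1_def w2_def)
    moreover obtain x where "\<And>w. w \<in> (\<Pi>\<^sub>E i\<in>{..<?k}. Ws ! i) \<and> 0\<^sub>v d = finsum_vec TYPE(real) d w {..<?k} \<Longrightarrow> w = x"
      using ex1[OF zero_carrier_vec] by (elim ex1E) blast
    ultimately have "w1 = w2" by metis
    then show "w i = 0" using w1i[of i] i by (simp add: w2_def vec_fun_zero)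
  qed
qed

lemma irreducible_decomposition_exists:
  obtains Ws where "irreducible_decomposition n d rho Ws"
proof -
  obtain Us where Us: "decomposition Us" using decomposition_exists by blast
  define Ws where "Ws = map ((`) (vec d)) Us"
  let ?k = "length Us"
  have irr: "irrep U" if "U \<in> set Us" for U using Us that by (simp add: decomposition_def)
  then have UV: "U \<subseteq> V" and sub: "fun_space.subspace U" if "U \<in> set Us" for U
    using that by (auto simp: irrep_def subrep_def)
  have Wi: "Ws ! i = vec d ` (Us ! i)" "vec_fun d ` (Ws ! i) = Us ! i" "Ws ! i \<subseteq> carrier_vec d" if "i < ?k" for i
    using that vec_image[OF UV, of "Us ! i"] by (auto simp: Ws_def)
  have "irreducible_decomposition n d rho Ws"
    unfolding irreducible_decomposition_def
  proof (intro conjI ballI)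
    fix W assume "W \<in> set Ws"
    then obtain U where U: "U \<in> set Us" "W = vec d ` U" by (auto simp: Ws_def)
    moreover from U have "W \<subseteq> carrier_vec d" by auto
    ultimately show "irreducible_subrepresentation n d rho W"
      using irreducible_iff[of W] irr vec_image[OF UV[OF U(1)]] by simp
  next
    fix v :: "real vec" assume v: "v \<in> carrier_vec d"
    obtain w where w: "\<And>i. i < ?k \<Longrightarrow> w i \<in> Us ! i" "vec_fun d v = (\<Sum>i<?k. w i)"
      using Us vec_fun_supp[of d v] unfolding decomposition_def by blast
    have zero: "w i = 0" if "\<And>i. i < ?k \<Longrightarrow> w i \<in> Us ! i" "(\<Sum>i<?k. w i) = 0" "i < ?k" for w i
      using Us that unfolding decomposition_def by blast
    define w1 where "w1 = (\<lambda>i\<in>{..<length Ws}. vec d (w i))"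
    have w1: "w1 i \<in> Ws ! i" "vec_fun d (w1 i) = w i" if "i < ?k" for i
      using that Wi(1)[OF that] w(1)[OF that] UV[of "Us ! i"] vec_fun_vec[of "w i" d] by (auto simp: w1_def Ws_def)
    show "\<exists>!w. w \<in> (\<Pi>\<^sub>E i\<in>{..<length Ws}. Ws ! i) \<and> v = finsum_vec TYPE(real) d w {..<length Ws}"
    proof (rule ex1I)
      have "w1 \<in> (\<Pi>\<^sub>E i\<in>{..<length Ws}. Ws ! i)" using w1 by (auto simp: w1_def Ws_def)
      moreover have "v = finsum_vec TYPE(real) d w1 {..<length Ws}"
      proof (rule vec_fun_inj[OF v])
        have cc: "w1 i \<in> carrier_vec d" if "i < ?k" for i using w1(1)[OF that] Wi(3)[OF that] by auto
        then show "finsum_vec TYPE(real) d w1 {..<length Ws} \<in> carrier_vec d"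
          by (auto intro!: finsum_vec_closed simp: Ws_def)
        show "vec_fun d v = vec_fun d (finsum_vec TYPE(real) d w1 {..<length Ws})"
          using vec_fun_finsum[of ?k w1 d] cc w1(2) w(2) by (simp add: Ws_def)
      qed
      ultimately show "w1 \<in> (\<Pi>\<^sub>E i\<in>{..<length Ws}. Ws ! i) \<and> v = finsum_vec TYPE(real) d w1 {..<length Ws}" ..
    next
      fix w2 assume w2: "w2 \<in> (\<Pi>\<^sub>E i\<in>{..<length Ws}. Ws ! i) \<and> v = finsum_vec TYPE(real) d w2 {..<length Ws}"
      have w2i: "w2 i \<in> Ws ! i" if "i < ?k" for i
        using PiE_mem[OF conjunct1[OF w2], of i] that by (simp add: Ws_def)
      have cc: "w2 i \<in> carrier_vec d" if "i < ?k" for i using w2i[OF that] Wi(3)[OF that] by auto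
      have "vec_fun d v = (\<Sum>i<?k. vec_fun d (w2 i))"
        using vec_fun_finsum[of ?k w2 d] cc w2 by (simp add: Ws_def)
      then have "(\<Sum>i<?k. w i - vec_fun d (w2 i)) = 0" using w(2) by (simp add: sum_subtractf)
      moreover have "w i - vec_fun d (w2 i) \<in> Us ! i" if "i < ?k" for i
        using w(1)[OF that] w2i[OF that] Wi(2)[OF that] sub[of "Us ! i"] that
        by (intro fun_space.subspace_diff) auto
      ultimately have "w i - vec_fun d (w2 i) = 0" if "i < ?k" for i
        using zero[of "\<lambda>i. w i - vec_fun d (w2 i)"] that by blast
      then have "w2 i = vec d (w i)" if "i < ?k" for i
        using that cc[OF that] vec_vec_fun[of "w2 i" d] by simp
      moreover have "w2 i = undefined" if "\<not> i < ?k" for i using w2 that by (auto simp: Ws_def PiE_def extensional_def)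
      ultimately show "w2 = w1" by (auto simp: w1_def Ws_def fun_eq_iff)
    qed
  qed
  then show thesis by (rule that)
qed

text \<open>To be a highest weight vector is a system of linear equations between translates, so an
  isomorphism pulls the generator of the Specht module back to such a vector in \<open>W\<close>.
  Conversely, a nonzero one generates \<open>W\<close>, and \<open>intertwiner\<close> matches it
  with that generator.\<close>

lemma iso_specht_iff:
  fixes W :: "real vec set"
  assumes la: "la \<in> partitions n" and W: "irreducible_subrepresentation n d rho W"
  shows "iso_specht n rho W la \<longleftrightarrow> HW la \<inter> vec_fun d ` W \<noteq> {0}"
proof -
  interpret S: specht n la by (standard) (rule la)
  interpret two_reps n "{..<d}" act "tabloids n la" tabloid_action
    by (intro two_reps.intro ortho_rep_axioms S.ortho_rep_axioms)
  let ?U = "vec_fun d ` W"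
  have Wc: "W \<subseteq> carrier_vec d" using W subrepresentation_carrier by (simp add: irreducible_subrepresentation_def)
  have U: "irrep ?U" using irreducible_iff[OF Wc] W by simp
  then have subU: "subrep ?U" by (simp add: irrep_def)
  then have ssU: "fun_space.subspace ?U" and UV: "?U \<subseteq> V" by (auto simp: subrep_def)
  have mu: "sum_list la = n" using S.sum_la .
  have ssH: "fun_space.subspace (HW la)" using subspace_HW mu by simp
  obtain u where u: "u \<in> S.HW la" "u \<noteq> 0" "S.cyclic u = S.S" using S.specht_generator .
  have injW: "inj_on (vec_fun d) W" using vec_fun_inj Wc by (intro inj_onI) blast
  show ?thesis
  proof
    assume "HW la \<inter> ?U \<noteq> {0}"
    then obtain v where v: "v \<in> HW la" "v \<in> ?U" "v \<noteq> 0"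
      using fun_space.subspace_0[OF ssH] fun_space.subspace_0[OF ssU] by blast
    have cyc: "cyclic v = ?U" using irrep_eq_cyclic[OF U v(2,3)] by simp
    obtain F where F: "bij_betw F ?U S.S"
      "\<And>x y. x \<in> ?U \<Longrightarrow> y \<in> ?U \<Longrightarrow> F (x + y) = F x + F y"
      "\<And>c x. x \<in> ?U \<Longrightarrow> F (fun_scale c x) = fun_scale c (F x)"
      "\<And>g x. g permutes {1..n} \<Longrightarrow> x \<in> ?U \<Longrightarrow> F (act g x) = tabloid_action g (F x)"
      using intertwiner[OF mu v(1,3) u(1,2)] unfolding cyc u(3) by metis
    show "iso_specht n rho W la"
      unfolding iso_specht_def
    proof (intro exI[of _ "F \<circ> vec_fun d"] conjI ballI allI)
      show "bij_betw (F \<circ> vec_fun d) W (specht_module n la)"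
        using bij_betw_trans[OF inj_on_imp_bij_betw[OF injW] F(1)] .
      fix w assume w: "w \<in> W"
      then have wc: "w \<in> carrier_vec d" using Wc by auto
      show "(F \<circ> vec_fun d) (x + w) = (F \<circ> vec_fun d) x + (F \<circ> vec_fun d) w" if "x \<in> W" for x
        using F(2) vec_fun_add[of x d w] w wc that Wc by auto
      show "(F \<circ> vec_fun d) (c \<cdot>\<^sub>v w) = fun_scale c ((F \<circ> vec_fun d) w)" for c
        using F(3) vec_fun_scale[OF wc] w by auto
      show "(F \<circ> vec_fun d) (rho g *\<^sub>v w) = tabloid_action g ((F \<circ> vec_fun d) w)" if "g \<in> carrier (sym_group n)" for g
        using F(4) vec_fun_rho[of g w] w wc that by (auto simp: sym_group_def)
    qed
  next
    assume "iso_specht n rho W la"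
    then obtain f where f: "bij_betw f W S.S" "\<And>v w. v \<in> W \<Longrightarrow> w \<in> W \<Longrightarrow> f (v + w) = f v + f w"
      "\<And>c w. w \<in> W \<Longrightarrow> f (c \<cdot>\<^sub>v w) = fun_scale c (f w)"
      "\<And>g w. g permutes {1..n} \<Longrightarrow> w \<in> W \<Longrightarrow> f (rho g *\<^sub>v w) = tabloid_action g (f w)"
      by (auto simp: iso_specht_def sym_group_def)
    define G where "G y = f (vec d y)" for y
    have vW: "vec d y \<in> W" if "y \<in> ?U" for y using that Wc vec_vec_fun by auto
    have Ginj: "x = y" if "x \<in> ?U" "y \<in> ?U" "G x = G y" for x y
    proof -
      have "vec d x = vec d y"
        using f(1) vW that by (auto simp: G_def bij_betw_def inj_on_def)
      then show ?thesis using that UV vec_fun_vec by (metis subsetD)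
    qed
    have Gadd: "G (x + y) = G x + G y" if "x \<in> ?U" "y \<in> ?U" for x y
      using f(2) vW that by (simp add: G_def vec_add)
    have Gact: "G (act g y) = tabloid_action g (G y)" if "g permutes {1..n}" "y \<in> ?U" for g y
      using f(4) vW that UV vec_act[of y g] by (auto simp: G_def)
    have G0: "G 0 = 0"
      using Gadd[of 0 0] fun_space.subspace_0[OF ssU] by simp
    have Gsum: "G (\<Sum>i\<in>A. x i) = (\<Sum>i\<in>A. G (x i))" if "\<And>i. i \<in> A \<Longrightarrow> x i \<in> ?U" for x and A :: "nat set"
      using that
    proof (induction A rule: infinite_finite_induct)
      case (insert a A)
      then show ?case using Gadd[of "x a" "\<Sum>i\<in>A. x i"] fun_space.subspace_sum[OF ssU, of A x] by simp
    qed (simp_all add: G0)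
    have "u \<in> S.S" using u(3) S.self_in_cyclic[of u] u(1) by (auto simp: S.HW_def S.row_invariant_def)
    then obtain w0 where w0: "w0 \<in> W" "f w0 = u" using bij_betw_imp_surj_on[OF f(1)] by (metis imageE)
    define h where "h = vec_fun d w0"
    have hU: "h \<in> ?U" using w0 by (simp add: h_def)
    have Gh: "G h = u" using w0 Wc vec_vec_fun[of w0 d] by (auto simp: G_def h_def)
    have "h \<noteq> 0" using Gh G0 u(2) by auto
    have actU: "act g x \<in> ?U" if "g permutes {1..n}" "x \<in> ?U" for g x
      using subU that unfolding subrep_def by blast
    \<comment> \<open>Each defining equation is tested after applying the injective map
      \<open>G\<close>, where it becomes the same equation for \<open>u\<close>.\<close>
    have "h \<in> HW la"
      unfolding HW_def row_invariant_def invariant_on_def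
    proof (clarify, intro conjI allI impI ballI)
      show "h \<in> V" using hU UV by auto
      fix r x y assume r: "r < length la" and xy: "x \<in> rows la r" "y \<in> rows la r"
      then have "x \<in> {1..n}" "y \<in> {1..n}" using rows_subset[of la n r] mu by auto
      then have t: "transpose x y permutes {1..n}" by (rule transpose_permutes)
      have "G (act (transpose x y) h) = G h"
        using Gact[OF t hU] Gh u(1) r xy by (simp add: S.HW_def S.row_invariant_def S.invariant_on_def)
      then show "act (transpose x y) h = h" using Ginj actU[OF t hU] hU by blast
    next
      fix s r x assume s: "s < length la" "r < s" and x: "x \<in> rows la s"
      have x1: "x \<in> {1..n}" using x rows_subset[of la n s] mu by auto
      have t: "transpose i x permutes {1..n}" if "i \<in> rows la r" for i
        using transpose_permutes[OF _ x1] that rows_subset[of la n r] mu by auto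
      let ?s = "\<Sum>i\<in>rows la r. act (transpose i x) h"
      have sU: "?s \<in> ?U" using actU[OF t hU] by (intro fun_space.subspace_sum[OF ssU]) auto
      have "G (raise (rows la r) x h) = G h + G ?s"
        unfolding raise_def using Gadd[OF hU sU] .
      also have "G ?s = (\<Sum>i\<in>rows la r. G (act (transpose i x) h))"
        by (rule Gsum) (rule actU[OF t hU])
      also have "G h + \<dots> = S.raise (rows la r) x u"
        using Gact[OF t hU] Gh by (simp add: S.raise_def)
      also have "\<dots> = G 0" using u(1) s x G0 by (simp add: S.HW_def)
      finally have "G (raise (rows la r) x h) = G 0" .
      moreover have "raise (rows la r) x h \<in> ?U"
        unfolding raise_def using hU sU by (intro fun_space.subspace_add[OF ssU])
      ultimately show "raise (rows la r) x h = 0" using Ginj fun_space.subspace_0[OF ssU] by blast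
    qed
    then show "HW la \<inter> ?U \<noteq> {0}" using hU \<open>h \<noteq> 0\<close> by blast
  qed
qed

text \<open>The count equals the dimension of a space defined without reference to a decomposition;
  so all decompositions give the same number, and existence of one yields the converse.\<close>

theorem has_multiplicity_iff:
  assumes la: "la \<in> partitions n"
  shows "has_multiplicity n d rho la a \<longleftrightarrow> a = fun_space.dim (W la)"
proof -
  have mu: "sum_list la = n" using la by (simp add: partitions_def)
  have "card {i. i < length Ws \<and> iso_specht n rho (Ws ! i) la} = fun_space.dim (W la)"
    if Ws: "irreducible_decomposition n d rho Ws" for Ws
  proof -
    have "iso_specht n rho (Ws ! i) la \<longleftrightarrow> HW la \<inter> map ((`) (vec_fun d)) Ws ! i \<noteq> {0}" if "i < length Ws" for i
      using iso_specht_iff[OF la, of "Ws ! i"] Ws that by (simp add: irreducible_decomposition_def)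
    then have "{i. i < length Ws \<and> iso_specht n rho (Ws ! i) la} =
        {i. i < length (map ((`) (vec_fun d)) Ws) \<and> HW la \<inter> map ((`) (vec_fun d)) Ws ! i \<noteq> {0}}"
      by (intro Collect_cong) (simp cong: conj_cong)
    then show ?thesis
      using dim_HW_decomposition[OF mu decomposition_of_irreducible[OF Ws]] W_eq_HW[of la] mu by simp
  qed
  then show ?thesis
    using irreducible_decomposition_exists unfolding has_multiplicity_def by metis
qed

end

section \<open>Kernels by column elimination\<close>

text \<open>A spanning list as long as the dimension is a basis; in this form independence and
  distinctness require no bookkeeping of their own.\<close>

definition spans :: "('a \<Rightarrow> real) list \<Rightarrow> ('a \<Rightarrow> real) set \<Rightarrow> bool" where
  "spans bs U \<longleftrightarrow> fun_space.span (set bs) = U \<and> length bs = fun_space.dim U"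

text \<open>The vector \<open>q\<close> is the pivot, and \<open>0\<close> as long as no pivot has been found; in this case the factor
  is \<open>0 / 0 = 0\<close>.\<close>

primrec sweep :: "(('a \<Rightarrow> real) \<Rightarrow> real) \<Rightarrow> ('a \<Rightarrow> real) \<Rightarrow> ('a \<Rightarrow> real) list \<Rightarrow> ('a \<Rightarrow> real) list" where
  "sweep phi q [] = []"
| "sweep phi q (b # bs) = (if phi q = 0 \<and> phi b \<noteq> 0 then sweep phi b bs
     else (b - fun_scale (phi b / phi q) q) # sweep phi q bs)"

locale functional =
  fixes phi :: "('a \<Rightarrow> real) \<Rightarrow> real"
  assumes phi_add: "phi (f + g) = phi f + phi g"
    and phi_scale: "phi (fun_scale c f) = c * phi f"
begin

lemma phi_zero [simp]: "phi 0 = 0"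
  using phi_scale[of 0 0] by simp

lemma phi_diff: "phi (f - g) = phi f - phi g"
  using phi_add[of "f - g" g] by simp

lemma sweep_kernel: "(q = 0 \<or> phi q \<noteq> 0) \<Longrightarrow> b \<in> set (sweep phi q bs) \<Longrightarrow> phi b = 0"
  by (induction bs arbitrary: q) (auto simp: phi_diff phi_scale split: if_splits)

text \<open>\<open>p\<close> is the final pivot. Every vector is either reduced by a multiple of the
  pivot or becomes the pivot, so the span with the pivot is preserved, and so is the length if a
  nonzero pivot is counted.\<close>

lemma sweep_span:
  assumes "q = 0 \<or> phi q \<noteq> 0"
  shows "\<exists>p. fun_space.span (insert p (set (sweep phi q bs))) = fun_space.span (insert q (set bs)) \<and>
    (p = 0 \<or> phi p \<noteq> 0) \<and> length (sweep phi q bs) + of_bool (p \<noteq> 0) = length bs + of_bool (q \<noteq> 0)"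
  using assms
proof (induction bs arbitrary: q)
  case (Cons b bs)
  show ?case
  proof (cases "phi q = 0 \<and> phi b \<noteq> 0")
    case True
    then have q: "q = 0" and b: "b \<noteq> 0" using Cons.prems by auto
    obtain p where p: "fun_space.span (insert p (set (sweep phi b bs))) = fun_space.span (insert b (set bs))"
      "p = 0 \<or> phi p \<noteq> 0" "length (sweep phi b bs) + of_bool (p \<noteq> 0) = length bs + of_bool (b \<noteq> 0)"
      using Cons.IH[of b] True by blast
    have "fun_space.span (insert q (set (b # bs))) = fun_space.span (insert b (set bs))"
      using q fun_space.span_insert_0 by simp
    then show ?thesis using p True q b by (intro exI[of _ p]) simp
  next
    case False
    obtain p where p: "fun_space.span (insert p (set (sweep phi q bs))) = fun_space.span (insert q (set bs))"
      "p = 0 \<or> phi p \<noteq> 0" "length (sweep phi q bs) + of_bool (p \<noteq> 0) = length bs + of_bool (q \<noteq> 0)"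
      using Cons.IH[of q] Cons.prems by blast
    let ?b = "b - fun_scale (phi b / phi q) q"
    have cong: "fun_space.span (insert x A) = fun_space.span (insert x B)"
      if "fun_space.span A = fun_space.span B" for x and A B :: "('a \<Rightarrow> real) set"
      using that by (simp add: fun_space.span_insert)
    have "fun_space.span (insert p (insert ?b (set (sweep phi q bs)))) =
        fun_space.span (insert ?b (insert q (set bs)))"
      using cong[OF p(1), of ?b] by (simp add: insert_commute)
    also have "\<dots> = fun_space.span (insert q (insert b (set bs)))"
    proof (intro equalityI fun_space.span_minimal fun_space.subspace_span subsetI)
      fix x assume x: "x \<in> insert ?b (insert q (set bs))"
      have "?b \<in> fun_space.span (insert q (insert b (set bs)))"
        by (intro fun_space.span_diff fun_space.span_scale fun_space.span_base) auto
      then show "x \<in> fun_space.span (insert q (insert b (set bs)))"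
        using x by (auto intro: fun_space.span_base)
    next
      fix x assume x: "x \<in> insert q (insert b (set bs))"
      have "?b + fun_scale (phi b / phi q) q \<in> fun_space.span (insert ?b (insert q (set bs)))"
        by (intro fun_space.span_add fun_space.span_scale fun_space.span_base) auto
      then show "x \<in> fun_space.span (insert ?b (insert q (set bs)))"
        using x by (auto intro: fun_space.span_base)
    qed
    finally show ?thesis using p False by (intro exI[of _ p]) auto
  qed
qed auto

text \<open>If no pivot was found, \<open>phi\<close> vanishes on \<open>U\<close> and nothing was
  removed. Otherwise one vector was removed, and the kernel of a functional loses at most one
  dimension.\<close>

lemma spans_sweep:
  assumes I: "finite I" "U \<subseteq> supp_space I" and bs: "spans bs U"
  shows "spans (sweep phi 0 bs) {f \<in> U. phi f = 0}"
proof -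
  let ?o = "sweep phi 0 bs" and ?K = "{f \<in> U. phi f = 0}"
  obtain p where p: "fun_space.span (insert p (set ?o)) = fun_space.span (insert 0 (set bs))"
    "p = 0 \<or> phi p \<noteq> 0" "length ?o + of_bool (p \<noteq> 0) = length bs + of_bool ((0 :: 'a \<Rightarrow> real) \<noteq> 0)"
    using sweep_span[of 0 bs] by auto
  have U: "U = fun_space.span (insert p (set ?o))" using p(1) bs by (simp add: spans_def fun_space.span_insert_0)
  have sub: "fun_space.subspace U" unfolding U by (rule fun_space.subspace_span)
  have subK: "fun_space.subspace ?K"
    using sub by (auto simp: fun_space.subspace_def phi_add phi_scale)
  have "set ?o \<subseteq> ?K" using sweep_kernel[of 0] U by (auto intro: fun_space.span_base)
  then have 1: "fun_space.span (set ?o) \<subseteq> ?K" using subK by (intro fun_space.span_minimal)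
  have 2: "?K \<subseteq> fun_space.span (set ?o)"
  proof
    fix f assume f: "f \<in> ?K"
    \<comment> \<open>Modulo the output \<open>f\<close> is a multiple of the pivot;
      \<open>phi\<close> kills \<open>f\<close> and the output but no nonzero pivot, so this
      multiple is zero.\<close>
    then obtain a where a: "f - fun_scale a p \<in> fun_space.span (set ?o)"
      using U by (auto simp: fun_space.span_insert)
    then have "phi (f - fun_scale a p) = 0" using 1 by auto
    then have "a = 0 \<or> p = 0" using f p(2) by (auto simp: phi_diff phi_scale)
    then show "f \<in> fun_space.span (set ?o)" using a by auto
  qed
  have span: "fun_space.span (set ?o) = ?K" using 1 2 by auto
  have KU: "?K \<subseteq> supp_space I" using I by auto
  have le: "fun_space.dim ?K \<le> length ?o"
    using fun_space.dim_le_card[of ?K "set ?o"] 2 card_length[of ?o] by simp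
  have "length ?o \<le> fun_space.dim ?K"
  proof (cases "p = 0")
    case True
    then have "U = ?K" using U span by (simp add: fun_space.span_insert_0)
    then show ?thesis using p(3) True bs by (simp add: spans_def)
  next
    case False
    obtain B where B: "finite B" "B \<subseteq> ?K" "fun_space.independent B" "?K \<subseteq> fun_space.span B"
      "card B = fun_space.dim ?K"
      by (rule finite_basis[OF I(1) KU])
    have "U \<subseteq> fun_space.span (insert p B)"
    proof -
      have "set ?o \<subseteq> fun_space.span (set ?o)" by (rule fun_space.span_superset)
      also have "\<dots> \<subseteq> fun_space.span B" using span B(4) by simp
      finally have "set ?o \<subseteq> fun_space.span B" .
      then show ?thesis unfolding U
        using fun_space.span_mono[of B "insert p B"]
        by (intro fun_space.span_minimal fun_space.subspace_span) (auto intro: fun_space.span_base)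
    qed
    then have "fun_space.dim U \<le> card (insert p B)" using B by (intro fun_space.dim_le_card) auto
    also have "\<dots> \<le> Suc (fun_space.dim ?K)" using B(1,5) by (simp add: card_insert_if)
    finally show ?thesis using p(3) bs False by (simp add: spans_def)
  qed
  then show ?thesis using span le by (simp add: spans_def)
qed

lemma length_sweep: "length (sweep phi q bs) \<le> length bs"
  by (induction bs arbitrary: q) (auto simp: le_SucI)

end

text \<open>The kernel of \<open>A\<close> as the common kernel of its \<open>d\<close> coordinate
  functionals. One sweep treats every remaining vector once, so the work is proportional to the
  number of vectors.\<close>

definition eliminate :: "((nat \<Rightarrow> real) \<Rightarrow> nat \<Rightarrow> real) \<Rightarrow> nat \<Rightarrow> (nat \<Rightarrow> real) list \<Rightarrow> (nat \<Rightarrow> real) list" where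
  "eliminate A d bs = fold (\<lambda>j. sweep (\<lambda>f. A f j) 0) [0..<d] bs"

lemma eliminate_0 [simp]: "eliminate A 0 bs = bs"
  by (simp add: eliminate_def)

lemma eliminate_Suc: "eliminate A (Suc j) bs = sweep (\<lambda>f. A f j) 0 (eliminate A j bs)"
  by (simp add: eliminate_def)

lemma spans_eliminate:
  assumes I: "finite I" "U \<subseteq> supp_space I" and bs: "spans bs U"
    and A: "\<And>f g. A (f + g) = A f + A g" "\<And>c f. A (fun_scale c f) = fun_scale c (A f)"
  shows "spans (eliminate A k bs) {f \<in> U. \<forall>j<k. A f j = 0}"
proof (induction k)
  case (Suc k)
  interpret functional "\<lambda>f. A f k" by unfold_locales (simp_all add: A fun_apply)
  have "spans (eliminate A (Suc k) bs) {f \<in> {f \<in> U. \<forall>j<k. A f j = 0}. A f k = 0}"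
    unfolding eliminate_Suc using I by (intro spans_sweep[OF I(1) _ Suc]) auto
  moreover have "{f \<in> {f \<in> U. \<forall>j<k. A f j = 0}. A f k = 0} = {f \<in> U. \<forall>j<Suc k. A f j = 0}"
    by (auto simp: less_Suc_eq)
  ultimately show ?case by simp
qed (use bs in simp)

section \<open>The search tree\<close>

definition extend :: "nat list \<Rightarrow> nat list" where
  "extend mu = butlast mu @ [Suc (last mu)]"

lemma extend_not_Nil: "extend mu \<noteq> []"
  by (simp add: extend_def)

lemma extend_pos: "\<forall>x\<in>set mu. 0 < x \<Longrightarrow> \<forall>x\<in>set (extend mu). 0 < x"
  by (auto simp: extend_def dest: in_set_butlastD)

lemma sum_list_extend: "mu \<noteq> [] \<Longrightarrow> sum_list (extend mu) = Suc (sum_list mu)"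
  by (cases mu rule: rev_cases) (auto simp: extend_def)

lemma length_extend: "mu \<noteq> [] \<Longrightarrow> length (extend mu) = length mu"
  by (simp add: extend_def)

text \<open>The row reading tableau of \<open>mu\<close> is an initial part of that of
  \<open>la\<close>: the earlier rows are final, while the last row of \<open>mu\<close> may still
  grow.\<close>

definition refines :: "nat list \<Rightarrow> nat list \<Rightarrow> bool" where
  "refines mu la \<longleftrightarrow> (\<exists>j rest. la = butlast mu @ (last mu + j) # rest)"

context ortho_rep
begin

text \<open>The branch with a new row comes first, which is the order in which the program pops its
  stack.\<close>

primrec leaves :: "nat \<Rightarrow> nat list \<Rightarrow> (nat list \<times> nat) list" where
  "leaves 0 mu = (if fun_space.dim (W mu) = 0 then [] else [(mu, fun_space.dim (W mu))])"
| "leaves (Suc k) mu = (if fun_space.dim (W mu) = 0 then [] else leaves k (mu @ [1]) @ leaves k (extend mu))"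

lemma W_extend:
  assumes "mu \<noteq> []"
  shows "W (extend mu) = {f \<in> W mu. JM (Suc (sum_list mu)) f = fun_scale (real (Suc (last mu)) - real (length mu)) f}"
proof -
  obtain nu l where mu: "mu = nu @ [l]" using assms by (metis append_butlast_last_id)
  have "W (extend mu) = W (nu @ [Suc l])" by (simp add: mu extend_def)
  also have "\<dots> = {f \<in> W (nu @ [l]). JM (Suc (sum_list nu + l)) f = fun_scale (real l - real (length nu)) f}"
    by (rule W_extend_row)
  also have "\<dots> = {f \<in> W mu. JM (Suc (sum_list mu)) f = fun_scale (real (Suc (last mu)) - real (length mu)) f}"
    by (simp add: mu)
  finally show ?thesis .
qed

lemma W_disjoint:
  assumes "mu \<noteq> []"
  shows "W (mu @ [1]) \<inter> W (extend mu) \<subseteq> {0}"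
  using W_children_disjoint[of "butlast mu" "last mu"] assms by (simp add: extend_def)

text \<open>Under row reading the eigenvalue conditions of \<open>mu\<close> are among those of
  \<open>la\<close>. This is what justifies pruning.\<close>

lemma refines_W:
  assumes "mu \<noteq> []" "refines mu la"
  shows "W la \<subseteq> W mu"
proof
  fix f assume f: "f \<in> W la"
  obtain nu l where mu: "mu = nu @ [l]" using assms(1) by (metis append_butlast_last_id)
  obtain j rest where la: "la = nu @ (l + j) # rest" using assms(2) by (auto simp: refines_def mu)
  have st: "rstart la r = rstart mu r" if "r < length mu" for r
    using that rstart_append[of r nu] by (simp add: la mu)
  have "rows mu r \<subseteq> rows la r" if "r < length mu" for r
    using st[OF that] that rstart_Suc[of r mu] rstart_Suc[of r la]
    by (auto simp: rows_def la mu nth_append less_Suc_eq)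
  moreover have "length mu \<le> length la" by (simp add: la mu)
  moreover have "JM k f = fun_scale (real k - 1 - real (rstart la r) - real r) f"
    if "r < length la" "k \<in> rows la r" for r k
    using f that by (simp add: W_def)
  ultimately have "JM k f = fun_scale (real k - 1 - real (rstart mu r) - real r) f"
    if "r < length mu" "k \<in> rows mu r" for r k
    using that st[OF that(1)] by (metis less_le_trans subsetD)
  then show "f \<in> W mu" using f by (simp add: W_def)
qed

end

lemma refines_step:
  assumes "mu \<noteq> []" "\<forall>x\<in>set la. 0 < x" "sum_list mu < sum_list la"
  shows "refines mu la \<longleftrightarrow> refines (mu @ [1]) la \<or> refines (extend mu) la"
proof -
  obtain nu l where mu: "mu = nu @ [l]" using assms(1) by (metis append_butlast_last_id)
  show ?thesis
  proof
    assume "refines mu la"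
    then obtain j rest where la: "la = nu @ (l + j) # rest" by (auto simp: refines_def mu)
    show "refines (mu @ [1]) la \<or> refines (extend mu) la"
    \<comment> \<open>With \<open>j = 0\<close> the last row of \<open>mu\<close> is complete, and a
      further row exists because the sums differ; otherwise the next entry lengthens the last
      row.\<close>
    proof (cases j)
      case 0
      then obtain x xs where r: "rest = x # xs" using assms(3) la by (cases rest) (auto simp: mu)
      then have "x = 1 + (x - 1)" using assms(2) la by auto
      then have "refines (mu @ [1]) la"
        unfolding refines_def using 0 r la by (intro exI[of _ "x - 1"] exI[of _ xs]) (simp add: mu butlast_append)
      then show ?thesis ..
    next
      case (Suc i)
      then have "refines (extend mu) la"
        unfolding refines_def extend_def using la by (intro exI[of _ i] exI[of _ rest]) (simp add: mu butlast_append)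
      then show ?thesis ..
    qed
  next
    assume "refines (mu @ [1]) la \<or> refines (extend mu) la"
    then show "refines mu la"
    proof
      assume "refines (mu @ [1]) la"
      then obtain j rest where "la = mu @ (1 + j) # rest" by (auto simp: refines_def)
      then show ?thesis unfolding refines_def by (intro exI[of _ 0] exI[of _ "(1 + j) # rest"]) (simp add: mu butlast_append)
    next
      assume "refines (extend mu) la"
      then obtain j rest where "la = nu @ (Suc l + j) # rest" by (auto simp: refines_def extend_def mu)
      then show ?thesis unfolding refines_def by (intro exI[of _ "Suc j"] exI[of _ rest]) (simp add: mu butlast_append)
    qed
  qed
qed

lemma refines_disjoint:
  assumes "mu \<noteq> []"
  shows "\<not> (refines (mu @ [1]) la \<and> refines (extend mu) la)"
proof -
  obtain nu l where mu: "mu = nu @ [l]" using assms(1) by (metis append_butlast_last_id)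
  show ?thesis by (auto simp: refines_def extend_def mu butlast_append)
qed

lemma refines_same_sum:
  assumes "mu \<noteq> []" "\<forall>x\<in>set la. 0 < x" "sum_list mu = sum_list la"
  shows "refines mu la \<longleftrightarrow> la = mu"
proof -
  obtain nu l where mu: "mu = nu @ [l]" using assms(1) by (metis append_butlast_last_id)
  show ?thesis
  proof
    assume "refines mu la"
    then obtain j rest where la: "la = nu @ (l + j) # rest" by (auto simp: refines_def mu)
    have "j = 0" "sum_list rest = 0" using assms(3) by (auto simp: la mu)
    moreover have "rest = []" using assms(2) \<open>sum_list rest = 0\<close> by (cases rest) (auto simp: la)
    ultimately show "la = mu" by (simp add: la mu)
  next
    assume "la = mu"
    then show "refines mu la" unfolding refines_def by (intro exI[of _ 0] exI[of _ "[]"]) (simp add: mu)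
  qed
qed

context ortho_rep
begin

text \<open>The two branches partition the refinements of \<open>mu\<close>, and a pruned node loses
  nothing because eigenspaces shrink along refinement.\<close>

lemma set_leaves:
  assumes "mu \<noteq> []" "\<forall>x\<in>set mu. 0 < x"
  shows "set (leaves k mu) = {(la, a). refines mu la \<and> (\<forall>x\<in>set la. 0 < x) \<and> sum_list la = sum_list mu + k \<and>
     a = fun_space.dim (W la) \<and> a \<noteq> 0}"
  using assms
proof (induction k arbitrary: mu)
  case 0
  have "refines mu la \<and> (\<forall>x\<in>set la. 0 < x) \<and> sum_list la = sum_list mu + 0 \<longleftrightarrow> la = mu" for la
    using refines_same_sum[OF 0(1), of la] refines_same_sum[OF 0] 0(2) by auto
  then have "{(la, a). refines mu la \<and> (\<forall>x\<in>set la. 0 < x) \<and> sum_list la = sum_list mu + 0 \<and>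
     a = fun_space.dim (W la) \<and> a \<noteq> 0} = {(la, a). la = mu \<and> a = fun_space.dim (W la) \<and> a \<noteq> 0}" by blast
  then show ?case by auto
next
  case (Suc k)
  have e: "extend mu \<noteq> []" "\<forall>x\<in>set (extend mu). 0 < x" "sum_list (extend mu) = Suc (sum_list mu)"
    using Suc.prems extend_not_Nil extend_pos sum_list_extend by blast+
  have IH1: "set (leaves k (mu @ [1])) = {(la, a). refines (mu @ [1]) la \<and> (\<forall>x\<in>set la. 0 < x) \<and>
      sum_list la = Suc (sum_list mu + k) \<and> a = fun_space.dim (W la) \<and> a \<noteq> 0}"
    using Suc.IH[of "mu @ [1]"] Suc.prems by auto
  have IH2: "set (leaves k (extend mu)) = {(la, a). refines (extend mu) la \<and> (\<forall>x\<in>set la. 0 < x) \<and>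
      sum_list la = Suc (sum_list mu + k) \<and> a = fun_space.dim (W la) \<and> a \<noteq> 0}"
    using Suc.IH[OF e(1,2)] e(3) by simp
  show ?case
  proof (cases "fun_space.dim (W mu) = 0")
    case True
    have "fun_space.dim (W la) = 0" if "refines mu la" for la
      using dim_mono[OF finite_I W_subset_V refines_W[OF Suc.prems(1) that]] True by simp
    then show ?thesis using True by auto
  next
    case False
    have "set (leaves (Suc k) mu) = set (leaves k (mu @ [1])) \<union> set (leaves k (extend mu))" using False by simp
    also have "\<dots> = {(la, a). refines mu la \<and> (\<forall>x\<in>set la. 0 < x) \<and> sum_list la = sum_list mu + Suc k \<and>
     a = fun_space.dim (W la) \<and> a \<noteq> 0}"
      unfolding IH1 IH2 using refines_step[OF Suc.prems(1)] by auto
    finally show ?thesis .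
  qed
qed

lemma distinct_leaves:
  assumes "mu \<noteq> []" "\<forall>x\<in>set mu. 0 < x"
  shows "distinct (map fst (leaves k mu))"
  using assms
proof (induction k arbitrary: mu)
  case (Suc k)
  have e: "extend mu \<noteq> []" "\<forall>x\<in>set (extend mu). 0 < x"
    using Suc.prems extend_not_Nil extend_pos by blast+
  have "set (map fst (leaves k (mu @ [1]))) \<inter> set (map fst (leaves k (extend mu))) = {}"
    using set_leaves[OF e(1), of k] e(2) set_leaves[of "mu @ [1]" k] Suc.prems refines_disjoint[OF Suc.prems(1)] by fastforce
  then show ?case using Suc.IH[OF e] Suc.IH[of "mu @ [1]"] Suc.prems by simp
qed simp

end

context orthogonal_rep
begin

theorem leaves_multiplicities:
  assumes n: "1 \<le> n"
  shows "set (leaves (n - 1) [1]) = {(la, a). la \<in> partitions n \<and> 1 \<le> a \<and> has_multiplicity n d rho la a}"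
proof -
  have "(refines [1] la \<and> (\<forall>x\<in>set la. 0 < x) \<and> sum_list la = n \<and> a = fun_space.dim (W la) \<and> a \<noteq> 0) \<longleftrightarrow>
    (la \<in> partitions n \<and> 1 \<le> a \<and> has_multiplicity n d rho la a)" for la a
  proof
    assume l: "refines [1] la \<and> (\<forall>x\<in>set la. 0 < x) \<and> sum_list la = n \<and> a = fun_space.dim (W la) \<and> a \<noteq> 0"
    \<comment> \<open>The search yields compositions; a nonzero eigenspace forces decreasing parts,
      which turns them into partitions.\<close>
    then have "W la \<noteq> {0}" using dim_eq_0_iff[OF finite_I W_subset_V subspace_W, of la] by auto
    moreover have "0 \<in> W la" using fun_space.subspace_0[OF subspace_W] .
    ultimately obtain f where "f \<in> W la" "f \<noteq> 0" by blast
    then have "sorted_wrt (\<ge>) la" using HW_decreasing[of la f] W_eq_HW[of la] l by simp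
    then have "la \<in> partitions n" using l by (simp add: partitions_def)
    then show "la \<in> partitions n \<and> 1 \<le> a \<and> has_multiplicity n d rho la a"
      using l has_multiplicity_iff[of la a] by simp
  next
    assume r: "la \<in> partitions n \<and> 1 \<le> a \<and> has_multiplicity n d rho la a"
    then have la: "\<forall>x\<in>set la. 0 < x" "sum_list la = n" by (auto simp: partitions_def)
    then obtain x xs where "la = x # xs" "0 < x" using n by (cases la) auto
    then have "refines [1] la" unfolding refines_def by (intro exI[of _ "x - 1"] exI[of _ xs]) simp
    then show "refines [1] la \<and> (\<forall>x\<in>set la. 0 < x) \<and> sum_list la = n \<and> a = fun_space.dim (W la) \<and> a \<noteq> 0"
      using r la has_multiplicity_iff[of la a] by auto
  qed
  moreover have "sum_list [1] + (n - 1) = n" using n by simp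
  ultimately show ?thesis using set_leaves[of "[1]" "n - 1"] by (simp only: list.set) simp
qed

end

section \<open>Reasoning about programs\<close>

text \<open>Total correctness, with the exact number of operations passed to the postcondition. By
  determinism the rules are equivalences and can be used for rewriting.\<close>

definition wp :: "com \<Rightarrow> (nat \<Rightarrow> state \<Rightarrow> bool) \<Rightarrow> state \<Rightarrow> bool" where
  "wp c Q s \<longleftrightarrow> (\<exists>t s'. exec c s t s' \<and> Q t s')"

lemma wp_mono: "wp c Q s \<Longrightarrow> (\<And>t s'. Q t s' \<Longrightarrow> R t s') \<Longrightarrow> wp c R s"
  by (auto simp: wp_def)

lemma wp_exec: "exec c s t s' \<Longrightarrow> wp c Q s \<longleftrightarrow> Q t s'"
  unfolding wp_def using exec_deterministic by blast

lemma wp_Skip: "wp Skip Q s \<longleftrightarrow> Q 1 s"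
  and wp_IAssign: "wp (IAssign x e f) Q s \<longleftrightarrow> Q (1 + icost e + icost f) (set_int x (ival e s) (ival f s) s)"
  and wp_RAssign: "wp (RAssign x e g) Q s \<longleftrightarrow> Q (1 + icost e + rcost g) (set_real x (ival e s) (rval g s) s)"
  and wp_Emit: "wp (Emit e) Q s \<longleftrightarrow> Q (1 + icost e) (s\<lparr>outp := outp s @ [ival e s]\<rparr>)"
  by (rule wp_exec, rule exec.intros)+

lemma wp_Seq: "wp (Seq c1 c2) Q s \<longleftrightarrow> wp c1 (\<lambda>t1. wp c2 (\<lambda>t2. Q (1 + t1 + t2))) s"
proof
  assume "wp (Seq c1 c2) Q s"
  then obtain t s' where "exec (Seq c1 c2) s t s'" "Q t s'" by (auto simp: wp_def)
  then show "wp c1 (\<lambda>t1. wp c2 (\<lambda>t2. Q (1 + t1 + t2))) s"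
    by cases (auto simp: wp_def)
next
  assume "wp c1 (\<lambda>t1. wp c2 (\<lambda>t2. Q (1 + t1 + t2))) s"
  then show "wp (Seq c1 c2) Q s" unfolding wp_def by (blast intro: exec.Seq)
qed

lemma wp_If: "wp (If b c1 c2) Q s \<longleftrightarrow>
  (if bval b s then wp c1 (\<lambda>t. Q (1 + bcost b + t)) s else wp c2 (\<lambda>t. Q (1 + bcost b + t)) s)"
proof
  assume "wp (If b c1 c2) Q s"
  then obtain t s' where "exec (If b c1 c2) s t s'" "Q t s'" by (auto simp: wp_def)
  then show "if bval b s then wp c1 (\<lambda>t. Q (1 + bcost b + t)) s else wp c2 (\<lambda>t. Q (1 + bcost b + t)) s"
    by cases (auto simp: wp_def)
next
  assume "if bval b s then wp c1 (\<lambda>t. Q (1 + bcost b + t)) s else wp c2 (\<lambda>t. Q (1 + bcost b + t)) s"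
  then show "wp (If b c1 c2) Q s" unfolding wp_def
    by (cases "bval b s") (simp_all only: if_True if_False, (blast intro: exec.IfTrue exec.IfFalse)+)
qed

lemmas wp_simps = wp_Skip wp_IAssign wp_RAssign wp_Emit wp_Seq wp_If

text \<open>\<open>x\<close> is ghost data describing the state, such as the contents of the stack,
  and the potential \<open>Phi\<close> pays for each iteration and its test. As an iteration costs
  at least one, the potential also gives termination.\<close>

lemma wp_While:
  assumes step: "\<And>x s. Inv x s \<Longrightarrow> bval b s \<Longrightarrow>
      wp c (\<lambda>t s'. \<exists>y. Inv y s' \<and> 1 + bcost b + t + Phi y \<le> (Phi x :: nat)) s"
    and init: "Inv x s"
  shows "wp (While b c) (\<lambda>t s'. \<exists>y. Inv y s' \<and> \<not> bval b s' \<and> t + Phi y \<le> Phi x + (1 + bcost b)) s"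
  using init
proof (induction "Phi x" arbitrary: x s rule: less_induct)
  case less
  show ?case
  proof (cases "bval b s")
    case True
    obtain t1 s1 y where 1: "exec c s t1 s1" "Inv y s1" "1 + bcost b + t1 + Phi y \<le> Phi x"
      using step[OF less.prems True] by (auto simp: wp_def)
    then obtain t2 s2 z where 2: "exec (While b c) s1 t2 s2" "Inv z s2" "\<not> bval b s2" "t2 + Phi z \<le> Phi y + (1 + bcost b)"
      using less.hyps[of y s1] by (auto simp: wp_def)
    have "exec (While b c) s (1 + bcost b + t1 + t2) s2" using exec.WhileTrue[OF True 1(1) 2(1)] .
    then show ?thesis unfolding wp_def using 1 2 by (intro exI conjI) auto
  next
    case False
    then show ?thesis unfolding wp_def using exec.WhileFalse[OF False, of c] less.prems by (intro exI conjI) auto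
  qed
qed

section \<open>Frame conditions and counting loops\<close>

primrec int_writes :: "com \<Rightarrow> string set" where
  "int_writes Skip = {}"
| "int_writes (IAssign x e f) = {x}"
| "int_writes (RAssign x e f) = {}"
| "int_writes (Emit e) = {}"
| "int_writes (Seq c1 c2) = int_writes c1 \<union> int_writes c2"
| "int_writes (If b c1 c2) = int_writes c1 \<union> int_writes c2"
| "int_writes (While b c) = int_writes c"

primrec real_writes :: "com \<Rightarrow> string set" where
  "real_writes Skip = {}"
| "real_writes (IAssign x e f) = {}"
| "real_writes (RAssign x e f) = {x}"
| "real_writes (Emit e) = {}"
| "real_writes (Seq c1 c2) = real_writes c1 \<union> real_writes c2"
| "real_writes (If b c1 c2) = real_writes c1 \<union> real_writes c2"
| "real_writes (While b c) = real_writes c"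

primrec emits :: "com \<Rightarrow> bool" where
  "emits Skip \<longleftrightarrow> False"
| "emits (IAssign x e f) \<longleftrightarrow> False"
| "emits (RAssign x e f) \<longleftrightarrow> False"
| "emits (Emit e) \<longleftrightarrow> True"
| "emits (Seq c1 c2) \<longleftrightarrow> emits c1 \<or> emits c2"
| "emits (If b c1 c2) \<longleftrightarrow> emits c1 \<or> emits c2"
| "emits (While b c) \<longleftrightarrow> emits c"

text \<open>What stays unchanged is read off the syntax, array by array, so that invariants need to
  mention only the arrays that are written.\<close>

definition frame :: "com \<Rightarrow> state \<Rightarrow> state \<Rightarrow> bool" where
  "frame c s s' \<longleftrightarrow> (\<forall>y. y \<notin> int_writes c \<longrightarrow> ints s' y = ints s y) \<and>
     (\<forall>y. y \<notin> real_writes c \<longrightarrow> reals s' y = reals s y) \<and> (\<not> emits c \<longrightarrow> outp s' = outp s)"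

lemma state_simps [simp]:
  "ints (set_int x i v s) = (ints s)(x := (ints s x)(i := v))"
  "ints (set_real x i r s) = ints s"
  "reals (set_int x i v s) = reals s"
  "reals (set_real x i r s) = (reals s)(x := (reals s x)(i := r))"
  "outp (set_int x i v s) = outp s"
  "outp (set_real x i r s) = outp s"
  by (simp_all add: set_int_def set_real_def)

lemma exec_frame: "exec c s t s' \<Longrightarrow> frame c s s'"
  by (induction rule: exec.induct) (auto simp: frame_def)

lemma wp_framed: "wp c Q s \<Longrightarrow> (\<And>t s'. Q t s' \<Longrightarrow> frame c s s' \<Longrightarrow> R t s') \<Longrightarrow> wp c R s"
  unfolding wp_def using exec_frame by blast

abbreviation sv :: "string \<Rightarrow> iexp" where
  "sv x \<equiv> IGet x (IConst 0)"

definition For :: "string \<Rightarrow> iexp \<Rightarrow> com \<Rightarrow> com" where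
  "For x e c = Seq (IAssign x (IConst 0) (IConst 0))
     (While (ILess (sv x) e) (Seq c (IAssign x (IConst 0) (IAdd (sv x) (IConst 1)))))"

lemma writes_For [simp]:
  "int_writes (For x e c) = insert x (int_writes c)"
  "real_writes (For x e c) = real_writes c"
  "emits (For x e c) = emits c"
  by (auto simp: For_def)

text \<open>The bound is evaluated anew in every round, hence the assumption that it is constant on
  all framed states. \<open>B\<close> bounds the number of rounds and is at least one, so that it
  absorbs the overhead of an empty loop.\<close>

lemma wp_For:
  assumes x: "x \<notin> int_writes c"
    and bound: "\<And>s'. frame (For x e c) s s' \<Longrightarrow> ival e s' = N" and B: "N \<le> B" "1 \<le> B"
    and indep: "\<And>i j s'. Inv i s' \<Longrightarrow> Inv i (set_int x 0 j s')"
    and init: "Inv 0 s"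
    and step: "\<And>i s'. i < N \<Longrightarrow> Inv i s' \<Longrightarrow> ints s' x 0 = i \<Longrightarrow> frame (For x e c) s s' \<Longrightarrow>
      wp c (\<lambda>t s''. t \<le> T \<and> Inv (Suc i) s'') s'"
  shows "wp (For x e c) (\<lambda>t s'. t \<le> B * (2 * (T + icost e + 12)) \<and> Inv N s' \<and> frame (For x e c) s s') s"
proof -
  let ?b = "ILess (sv x) e" and ?inc = "IAssign x (IConst 0) (IAdd (sv x) (IConst 1))"
  \<comment> \<open>A round costs \<open>4 + icost e\<close> for the test, at most \<open>T\<close>
    for the body and \<open>7\<close> for the counter; the last, failing test costs
    \<open>4 + icost e\<close>.\<close>
  have loop: "wp (While ?b (Seq c ?inc))
      (\<lambda>t s''. t \<le> (N - i) * (T + icost e + 11) + (4 + icost e) \<and> Inv N s'') s'"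
    if "i \<le> N" "Inv i s'" "ints s' x 0 = i" "frame (For x e c) s s'" for i s'
    using that
  proof (induction "N - i" arbitrary: i s')
    case 0
    then have "\<not> bval ?b s'" using bound by simp
    from exec.WhileFalse[OF this, of "Seq c ?inc"] show ?case unfolding wp_def
      using 0 by (intro exI conjI) auto
  next
    case (Suc m)
    then have i: "i < N" by simp
    then have b: "bval ?b s'" using bound[OF Suc.prems(4)] Suc.prems(3) by simp
    obtain t1 s1 where 1: "exec c s' t1 s1" "t1 \<le> T" "Inv (Suc i) s1"
      using step[OF i Suc.prems(2-4)] by (auto simp: wp_def)
    have fr: "frame c s' s1" using exec_frame[OF 1(1)] .
    have xi: "ints s1 x 0 = i" using fr x Suc.prems(3) by (simp add: frame_def)
    let ?s2 = "set_int x 0 (Suc i) s1"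
    have e2: "exec (Seq c ?inc) s' (1 + t1 + 6) ?s2"
      using exec.Seq[OF 1(1) exec.IAssign[of x "IConst 0" "IAdd (sv x) (IConst 1)" s1]] xi
      by (simp add: eval_nat_numeral)
    have fr2: "frame (For x e c) s ?s2"
      using fr Suc.prems(4) by (auto simp: frame_def)
    have "m = N - Suc i" using Suc.hyps(2) by simp
    then obtain t3 s3 where 3: "exec (While ?b (Seq c ?inc)) ?s2 t3 s3"
      "t3 \<le> (N - Suc i) * (T + icost e + 11) + (4 + icost e)" "Inv N s3"
      using Suc.hyps(1)[of "Suc i" ?s2] Suc.hyps(2) i indep[OF 1(3)] fr2 by (auto simp: wp_def)
    have N: "N - i = Suc (N - Suc i)" using i by simp
    then have "1 + bcost ?b + (1 + t1 + 6) + t3 \<le> (N - i) * (T + icost e + 11) + (4 + icost e)"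
      using 1(2) 3(2) N by simp
    then show ?case unfolding wp_def using exec.WhileTrue[OF b e2 3(1)] 3(3) by blast
  qed
  have fr0: "frame (For x e c) s (set_int x 0 0 s)" by (auto simp: frame_def)
  have w: "wp (While ?b (Seq c ?inc)) (\<lambda>t s''. t \<le> N * (T + icost e + 11) + (4 + icost e) \<and> Inv N s'') (set_int x 0 0 s)"
    using loop[of 0 "set_int x 0 0 s"] indep[OF init] fr0 by simp
  have le: "t + 4 \<le> B * (2 * (T + icost e + 12))" if "t \<le> N * (T + icost e + 11) + (4 + icost e)" for t
  proof -
    have "N * (T + icost e + 11) \<le> B * (T + icost e + 11)" using B by simp
    moreover have "8 + icost e \<le> B * (8 + icost e)" using B by simp
    ultimately have "t + 4 \<le> B * (T + icost e + 11) + B * (8 + icost e)" using that by linarith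
    also have "\<dots> = B * (T + icost e + 11 + (8 + icost e))" by (simp only: distrib_left)
    also have "\<dots> \<le> B * (2 * (T + icost e + 12))" by (intro mult_le_mono2) simp
    finally show ?thesis .
  qed
  have "wp (For x e c) (\<lambda>t s'. t \<le> B * (2 * (T + icost e + 12)) \<and> Inv N s') s"
    unfolding For_def wp_Seq wp_IAssign ival.simps
  proof (rule wp_mono, rule w, elim conjE, intro conjI)
    fix t assume "t \<le> N * (T + icost e + 11) + (4 + icost e)"
    from le[OF this] show "1 + (1 + icost (IConst 0) + icost (IConst 0)) + t \<le> B * (2 * (T + icost e + 12))" by simp
  qed
  then show ?thesis by (rule wp_framed) simp
qed

section \<open>Matrix products\<close>

definition mat_index :: "iexp \<Rightarrow> iexp \<Rightarrow> iexp \<Rightarrow> iexp" where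
  "mat_index m i j = IAdd (IMul (IAdd (IMul m (sv ''d'')) i) (sv ''d'')) j"

lemma ival_mat_index: "ints s ''d'' 0 = d \<Longrightarrow> ival (mat_index m i j) s = (ival m s * d + ival i s) * d + ival j s"
  by (simp add: mat_index_def)

lemma icost_mat_index: "icost (mat_index m i j) = 8 + icost m + icost i + icost j"
  by (simp add: mat_index_def)

text \<open>\<open>j\<close> and \<open>i\<close> are the last two digits of the address in base
  \<open>d\<close>.\<close>

lemma mat_index_inj:
  assumes "(m * d + i) * d + j = (m' * d + i') * d + (j' :: nat)" "i < d" "j < d" "i' < d" "j' < d"
  shows "m = m' \<and> i = i' \<and> j = j'"
proof -
  have dm: "(a * d + b) div d = a" "(a * d + b) mod d = b" if "b < d" for a b
    using that by simp_all
  have 1: "m * d + i = m' * d + i'" "j = j'"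
    using dm[OF assms(3), of "m * d + i"] dm[OF assms(5), of "m' * d + i'"] unfolding assms(1) by simp_all
  show ?thesis
    using dm[OF assms(2), of m] dm[OF assms(4), of m'] 1(2) unfolding 1(1) by simp
qed

text \<open>The accumulator is not cleared: the caller stores the initial term there, so adding a
  term to a product takes no further loop.\<close>

definition dot :: "string \<Rightarrow> iexp \<Rightarrow> string \<Rightarrow> iexp \<Rightarrow> com" where
  "dot a ai b bi = For ''l'' (sv ''d'') (RAssign ''acc'' (IConst 0)
     (RAdd (RGet ''acc'' (IConst 0)) (RMul (RGet a ai) (RGet b bi))))"

lemma writes_dot [simp]:
  "int_writes (dot a ai b bi) = {''l''}" "real_writes (dot a ai b bi) = {''acc''}" "\<not> emits (dot a ai b bi)"
  by (simp_all add: dot_def)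

lemma wp_dot:
  assumes d: "ints s ''d'' 0 = d" "1 \<le> d" and ab: "a \<noteq> ''acc''" "b \<noteq> ''acc''"
    and ai: "\<And>l s'. frame (dot a ai b bi) s s' \<Longrightarrow> ints s' ''l'' 0 = l \<Longrightarrow> ival ai s' = F l" "icost ai \<le> 30"
    and bi: "\<And>l s'. frame (dot a ai b bi) s s' \<Longrightarrow> ints s' ''l'' 0 = l \<Longrightarrow> ival bi s' = G l" "icost bi \<le> 30"
  shows "wp (dot a ai b bi) (\<lambda>t s'. t \<le> 200 * d \<and>
    reals s' ''acc'' 0 = reals s ''acc'' 0 + (\<Sum>l<d. reals s a (F l) * reals s b (G l)) \<and> frame (dot a ai b bi) s s') s"
proof -
  let ?c = "RAssign ''acc'' (IConst 0) (RAdd (RGet ''acc'' (IConst 0)) (RMul (RGet a ai) (RGet b bi)))"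
  have fr: "frame (dot a ai b bi) s s' \<longleftrightarrow> frame (For ''l'' (sv ''d'') ?c) s s'" for s'
    by (simp add: dot_def)
  have "wp (For ''l'' (sv ''d'') ?c) (\<lambda>t s'. t \<le> d * (2 * (70 + icost (sv ''d'') + 12)) \<and>
     reals s' ''acc'' 0 = reals s ''acc'' 0 + (\<Sum>l<d. reals s a (F l) * reals s b (G l)) \<and>
     frame (For ''l'' (sv ''d'') ?c) s s') s"
  proof (rule wp_For[where Inv = "\<lambda>i s'. reals s' ''acc'' 0 = reals s ''acc'' 0 + (\<Sum>l<i. reals s a (F l) * reals s b (G l))"])
    show "ival (sv ''d'') s' = d" if "frame (For ''l'' (sv ''d'') ?c) s s'" for s'
      using that d by (simp add: frame_def)
    fix i s' assume i: "i < d" and inv: "reals s' ''acc'' 0 = reals s ''acc'' 0 + (\<Sum>l<i. reals s a (F l) * reals s b (G l))"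
      and l: "ints s' ''l'' 0 = i" and f: "frame (For ''l'' (sv ''d'') ?c) s s'"
    have "ival ai s' = F i" "ival bi s' = G i" using ai(1) bi(1) l f fr by auto
    moreover have "reals s' a = reals s a" "reals s' b = reals s b" using f ab by (auto simp: frame_def)
    ultimately show "wp ?c (\<lambda>t s''. t \<le> 70 \<and>
       reals s'' ''acc'' 0 = reals s ''acc'' 0 + (\<Sum>l<Suc i. reals s a (F l) * reals s b (G l))) s'"
      using inv ai(2) bi(2) by (simp add: wp_simps)
  qed (use d in auto)
  then show ?thesis unfolding dot_def by (rule wp_mono) auto
qed

text \<open>\<open>ini\<close> is evaluated inside both loops, so it may be the entry of another
  matrix at the current position.\<close>

definition mat_mult :: "string \<Rightarrow> iexp \<Rightarrow> rexp \<Rightarrow> string \<Rightarrow> iexp \<Rightarrow> string \<Rightarrow> iexp \<Rightarrow> com" where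
  "mat_mult dst md ini a ma b mb = For ''i'' (sv ''d'') (For ''j'' (sv ''d'')
     (Seq (RAssign ''acc'' (IConst 0) ini)
     (Seq (dot a (mat_index ma (sv ''i'') (sv ''l'')) b (mat_index mb (sv ''l'') (sv ''j'')))
          (RAssign dst (mat_index md (sv ''i'') (sv ''j'')) (RGet ''acc'' (IConst 0))))))"

lemma writes_mat_mult [simp]:
  "int_writes (mat_mult dst md ini a ma b mb) = {''i'', ''j'', ''l''}"
  "real_writes (mat_mult dst md ini a ma b mb) = {''acc'', dst}"
  "\<not> emits (mat_mult dst md ini a ma b mb)"
  by (auto simp: mat_mult_def)

lemma wp_mat_mult:
  assumes d: "ints s ''d'' 0 = d" "1 \<le> d" and ab: "a \<noteq> ''acc''" "b \<noteq> ''acc''" "dst \<noteq> ''acc''" "a \<noteq> dst" "b \<noteq> dst"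
    and m: "\<And>s'. frame (mat_mult dst md ini a ma b mb) s s' \<Longrightarrow> ival md s' = Md \<and> ival ma s' = Ma \<and> ival mb s' = Mb"
      "icost md \<le> 10" "icost ma \<le> 10" "icost mb \<le> 10"
    and ini: "\<And>i j s'. frame (mat_mult dst md ini a ma b mb) s s' \<Longrightarrow> ints s' ''i'' 0 = i \<Longrightarrow> ints s' ''j'' 0 = j \<Longrightarrow>
      rval ini s' = J i j" "rcost ini \<le> 30"
  shows "wp (mat_mult dst md ini a ma b mb) (\<lambda>t s'. t \<le> 2000 * d ^ 3 \<and>
    (\<forall>i<d. \<forall>j<d. reals s' dst ((Md * d + i) * d + j) =
      J i j + (\<Sum>l<d. reals s a ((Ma * d + i) * d + l) * reals s b ((Mb * d + l) * d + j))) \<and>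
    (\<forall>p. (\<forall>i<d. \<forall>j<d. p \<noteq> (Md * d + i) * d + j) \<longrightarrow> reals s' dst p = reals s dst p)) s"
proof -
  define val where "val i j = J i j + (\<Sum>l<d. reals s a ((Ma * d + i) * d + l) * reals s b ((Mb * d + l) * d + j))" for i j
  define ix where "ix i j = (Md * d + i) * d + j" for i j
  let ?dot = "dot a (mat_index ma (sv ''i'') (sv ''l'')) b (mat_index mb (sv ''l'') (sv ''j''))"
  let ?body = "Seq (RAssign ''acc'' (IConst 0) ini)
     (Seq ?dot (RAssign dst (mat_index md (sv ''i'') (sv ''j'')) (RGet ''acc'' (IConst 0))))"
  let ?inner = "For ''j'' (sv ''d'') ?body"
  let ?outer = "For ''i'' (sv ''d'') ?inner"
  \<comment> \<open>\<open>P\<close> selects the cells computed so far; everything outside the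
    target matrix is kept, so the other matrices in \<open>dst\<close> survive.\<close>
  define Done where "Done P s' \<longleftrightarrow> (\<forall>i<d. \<forall>j<d. P i j \<longrightarrow> reals s' dst (ix i j) = val i j) \<and>
    (\<forall>p. (\<forall>i<d. \<forall>j<d. p \<noteq> ix i j) \<longrightarrow> reals s' dst p = reals s dst p)" for P and s' :: state
  have fr: "frame (mat_mult dst md ini a ma b mb) s s' \<longleftrightarrow> frame ?outer s s'" for s'
    by (simp add: mat_mult_def)
  have ixinj: "i = i' \<and> j = j'" if "ix i j = ix i' j'" "i < d" "j < d" "i' < d" "j' < d" for i j i' j'
    using mat_index_inj[of Md d i j Md i' j'] that by (simp add: ix_def)
  have body: "wp ?body (\<lambda>t s''. t \<le> 300 * d \<and> Done (\<lambda>i' j'. i' < i \<or> i' = i \<and> j' < Suc j) s'') s'"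
    if ij: "i < d" "j < d" and D: "Done (\<lambda>i' j'. i' < i \<or> i' = i \<and> j' < j) s'"
      and v: "ints s' ''i'' 0 = i" "ints s' ''j'' 0 = j" and f: "frame ?outer s s'" for i j s'
  proof -
    have dd: "ints s'' ''d'' 0 = d" if "frame ?outer s s''" for s'' using that d by (simp add: frame_def)
    let ?s1 = "set_real ''acc'' 0 (J i j) s'"
    have f1: "frame ?outer s ?s1" using f by (auto simp: frame_def)
    have ini1: "rval ini s' = J i j" using ini(1)[of s'] f fr v by simp
    have "wp ?dot (\<lambda>t s''. t \<le> 200 * d \<and>
        reals s'' ''acc'' 0 = reals ?s1 ''acc'' 0 + (\<Sum>l<d. reals ?s1 a ((Ma * d + i) * d + l) * reals ?s1 b ((Mb * d + l) * d + j)) \<and>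
        frame ?dot ?s1 s'') ?s1"
    proof (rule wp_dot)
      show "ints ?s1 ''d'' 0 = d" using dd[OF f1] .
      fix l s2 assume f2: "frame ?dot ?s1 s2" and l: "ints s2 ''l'' 0 = l"
      have f3: "frame ?outer s s2" using f1 f2 by (auto simp: frame_def)
      have "ints s2 ''i'' 0 = i" "ints s2 ''j'' 0 = j" using f2 v by (auto simp: frame_def)
      then show "ival (mat_index ma (sv ''i'') (sv ''l'')) s2 = (Ma * d + i) * d + l"
        "ival (mat_index mb (sv ''l'') (sv ''j'')) s2 = (Mb * d + l) * d + j"
        using m(1)[of s2] f3 fr l by (simp_all add: ival_mat_index[OF dd[OF f3]])
    qed (use d ab m in \<open>simp_all add: icost_mat_index\<close>)
    then have "wp ?dot (\<lambda>t s''. t \<le> 200 * d \<and> reals s'' ''acc'' 0 = val i j \<and> frame ?dot ?s1 s'') ?s1"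
    proof (rule wp_mono, elim conjE, intro conjI)
      fix t s'' assume r: "reals s'' ''acc'' 0 = reals ?s1 ''acc'' 0 + (\<Sum>l<d. reals ?s1 a ((Ma * d + i) * d + l) * reals ?s1 b ((Mb * d + l) * d + j))"
      have "reals ?s1 a = reals s a" "reals ?s1 b = reals s b" using f1 ab by (auto simp: frame_def)
      then show "reals s'' ''acc'' 0 = val i j" using r by (simp add: val_def)
    qed
    then show ?thesis
      unfolding wp_Seq wp_RAssign ival.simps ini1
    proof (rule wp_mono, elim conjE, intro conjI)
      fix t s2 assume t: "t \<le> 200 * d" and acc: "reals s2 ''acc'' 0 = val i j" and f2: "frame ?dot ?s1 s2"
      show "1 + (1 + icost (IConst 0) + rcost ini) + (1 + t + (1 + icost (mat_index md (sv ''i'') (sv ''j'')) +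
          rcost (RGet ''acc'' (IConst 0)))) \<le> 300 * d"
        using t d m ini by (simp add: icost_mat_index)
      have f3: "frame ?outer s s2" using f1 f2 by (auto simp: frame_def)
      have "ints s2 ''i'' 0 = i" "ints s2 ''j'' 0 = j" using f2 v by (auto simp: frame_def)
      then have ix: "ival (mat_index md (sv ''i'') (sv ''j'')) s2 = ix i j"
        using m(1)[of s2] f3 fr by (simp add: ival_mat_index[OF dd[OF f3]] ix_def)
      have dst: "reals s2 dst = reals s' dst" using f2 ab by (auto simp: frame_def)
      show "Done (\<lambda>i' j'. i' < i \<or> i' = i \<and> j' < Suc j) (set_real dst (ival (mat_index md (sv ''i'') (sv ''j'')) s2) (rval (RGet ''acc'' (IConst 0)) s2) s2)"
        unfolding ix rval.simps ival.simps acc Done_def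
      proof (intro conjI allI impI)
        fix i' j' assume l: "i' < d" "j' < d" "i' < i \<or> i' = i \<and> j' < Suc j"
        show "reals (set_real dst (ix i j) (val i j) s2) dst (ix i' j') = val i' j'"
        proof (cases "i' = i \<and> j' = j")
          case False
          then have "ix i' j' \<noteq> ix i j" using ixinj[OF _ l(1,2) ij] by blast
          have "i' < i \<or> i' = i \<and> j' < j" using False l(3) by auto
          then have "reals s' dst (ix i' j') = val i' j'" using D l(1,2) unfolding Done_def by blast
          then show ?thesis using \<open>ix i' j' \<noteq> ix i j\<close> dst by simp
        qed simp
      next
        fix p assume "\<forall>i<d. \<forall>j<d. p \<noteq> ix i j"
        then show "reals (set_real dst (ix i j) (val i j) s2) dst p = reals s dst p"
          using D dst ij unfolding Done_def by simp
      qed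
    qed
  qed
  have fr_inner: "frame ?outer s s''" if "frame ?outer s s'" "frame ?inner s' s''" for s' s''
    using that by (auto simp: frame_def)
  have d_inv: "ints s'' ''d'' 0 = d" if "frame ?outer s s''" for s''
    using that d by (simp add: frame_def)
  have inner: "wp ?inner (\<lambda>t s''. t \<le> 628 * d ^ 2 \<and> Done (\<lambda>i' j'. i' < Suc i) s'') s'"
    if i: "i < d" and D: "Done (\<lambda>i' j'. i' < i) s'" and v: "ints s' ''i'' 0 = i" and f: "frame ?outer s s'" for i s'
  proof -
    have "wp ?inner (\<lambda>t s''. t \<le> d * (2 * (300 * d + icost (sv ''d'') + 12)) \<and>
        Done (\<lambda>i' j'. i' < i \<or> i' = i \<and> j' < d) s'' \<and> frame ?inner s' s'') s'"
    proof (rule wp_For[where Inv = "\<lambda>j s''. Done (\<lambda>i' j'. i' < i \<or> i' = i \<and> j' < j) s''"])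
      show "ival (sv ''d'') s'' = d" if "frame ?inner s' s''" for s''
        using d_inv[OF fr_inner[OF f that]] by simp
      fix j s'' assume *: "j < d" "Done (\<lambda>i' j'. i' < i \<or> i' = i \<and> j' < j) s''" "ints s'' ''j'' 0 = j" "frame ?inner s' s''"
      have "ints s'' ''i'' 0 = i" using *(4) v by (simp add: frame_def)
      then show "wp ?body (\<lambda>t s''. t \<le> 300 * d \<and> Done (\<lambda>i' j'. i' < i \<or> i' = i \<and> j' < Suc j) s'') s''"
        using body[OF i *(1,2) _ *(3) fr_inner[OF f *(4)]] by blast
    qed (use d D in \<open>auto simp: Done_def\<close>)
    then show ?thesis
    proof (rule wp_mono, elim conjE, intro conjI)
      fix t s'' assume t: "t \<le> d * (2 * (300 * d + icost (sv ''d'') + 12))"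
        and D: "Done (\<lambda>i' j'. i' < i \<or> i' = i \<and> j' < d) s''"
      have "d \<le> d ^ 2" using d by (simp add: power2_eq_square)
      moreover have "t \<le> 600 * d ^ 2 + 28 * d" using t by (simp add: power2_eq_square algebra_simps)
      ultimately show "t \<le> 628 * d ^ 2" by linarith
      show "Done (\<lambda>i' j'. i' < Suc i) s''" using D unfolding Done_def by (simp add: less_Suc_eq)
    qed
  qed
  have "wp ?outer (\<lambda>t s'. t \<le> d * (2 * (628 * d ^ 2 + icost (sv ''d'') + 12)) \<and> Done (\<lambda>i' j'. i' < d) s' \<and> frame ?outer s s') s"
  proof (rule wp_For[where Inv = "\<lambda>i. Done (\<lambda>i' j'. i' < i)"])
    show "ival (sv ''d'') s' = d" if "frame ?outer s s'" for s' using d_inv[OF that] by simp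
    show "wp ?inner (\<lambda>t s''. t \<le> 628 * d ^ 2 \<and> Done (\<lambda>i' j'. i' < Suc i) s'') s'"
      if "i < d" "Done (\<lambda>i' j'. i' < i) s'" "ints s' ''i'' 0 = i" "frame ?outer s s'" for i s'
      using inner that by blast
  qed (use d in \<open>auto simp: Done_def\<close>)
  then show ?thesis
    unfolding mat_mult_def
  proof (rule wp_mono, elim conjE, intro conjI)
    fix t s' assume t: "t \<le> d * (2 * (628 * d ^ 2 + icost (sv ''d'') + 12))" and D: "Done (\<lambda>i' j'. i' < d) s'"
    have "d \<le> d ^ 3" using d by (simp add: power3_eq_cube)
    moreover have "t \<le> 1256 * d ^ 3 + 28 * d" using t by (simp add: power2_eq_square power3_eq_cube algebra_simps)
    ultimately show "t \<le> 2000 * d ^ 3" by linarith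
    show "\<forall>i<d. \<forall>j<d. reals s' dst ((Md * d + i) * d + j) =
      J i j + (\<Sum>l<d. reals s a ((Ma * d + i) * d + l) * reals s b ((Mb * d + l) * d + j))"
      and "\<forall>p. (\<forall>i<d. \<forall>j<d. p \<noteq> (Md * d + i) * d + j) \<longrightarrow> reals s' dst p = reals s dst p"
      using D unfolding Done_def ix_def val_def by blast+
  qed
qed

section \<open>The kernel computation\<close>

text \<open>Slot \<open>p\<close> of the array \<open>B\<close> holds up to \<open>d\<close> rows of length \<open>2 * d\<close>: a vector followed by its
  image under the matrix whose kernel is computed.\<close>

definition addr :: "iexp \<Rightarrow> iexp \<Rightarrow> iexp \<Rightarrow> iexp" where
  "addr p v i = IAdd (IMul (IAdd (IMul p (sv ''d'')) v) (IMul (IConst 2) (sv ''d''))) i"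

lemma ival_addr: "ints s ''d'' 0 = d \<Longrightarrow> ival (addr p v i) s = (ival p s * d + ival v s) * (2 * d) + ival i s"
  by (simp add: addr_def)

lemma icost_addr: "icost (addr p v i) = 10 + icost p + icost v + icost i"
  by (simp add: addr_def)

lemma addr_inj:
  assumes "(p * d + v) * (2 * d) + i = (p' * d + v') * (2 * d) + (i' :: nat)" "v < d" "v' < d" "i < 2 * d" "i' < 2 * d"
  shows "p = p' \<and> v = v' \<and> i = i'"
proof -
  have dm: "(a * k + b) div k = a" "(a * k + b) mod k = b" if "b < k" for a b k :: nat
    using that by simp_all
  have 1: "p * d + v = p' * d + v'" "i = i'"
    using dm[OF assms(4), of "p * d + v"] dm[OF assms(5), of "p' * d + v'"] unfolding assms(1) by simp_all
  show ?thesis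
    using dm[OF assms(2), of p] dm[OF assms(3), of p'] 1(2) unfolding 1(1) by simp
qed

text \<open>The value is zero out of range, so that an array write becomes an equation between
  functions on all indices.\<close>

definition row_cells :: "nat \<Rightarrow> state \<Rightarrow> nat \<Rightarrow> nat \<Rightarrow> nat \<Rightarrow> real" where
  "row_cells d s p v i = (if v < d \<and> i < 2 * d then reals s ''B'' ((p * d + v) * (2 * d) + i) else 0)"

definition cell_upd :: "(nat \<Rightarrow> nat \<Rightarrow> nat \<Rightarrow> real) \<Rightarrow> nat \<Rightarrow> nat \<Rightarrow> nat \<Rightarrow> real \<Rightarrow> nat \<Rightarrow> nat \<Rightarrow> nat \<Rightarrow> real" where
  "cell_upd C p v i r = (\<lambda>p' v' i'. if p' = p \<and> v' = v \<and> i' = i then r else C p' v' i')"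

definition row_upd :: "(nat \<Rightarrow> nat \<Rightarrow> nat \<Rightarrow> real) \<Rightarrow> nat \<Rightarrow> nat \<Rightarrow> nat \<Rightarrow> nat \<Rightarrow> (nat \<Rightarrow> real) \<Rightarrow> nat \<Rightarrow> nat \<Rightarrow> nat \<Rightarrow> real" where
  "row_upd C p v a m r = (\<lambda>p' v' i'. if p' = p \<and> v' = v \<and> a \<le> i' \<and> i' < a + m then r (i' - a) else C p' v' i')"

lemma row_cells_get: "v < d \<Longrightarrow> i < 2 * d \<Longrightarrow> reals s ''B'' ((p * d + v) * (2 * d) + i) = row_cells d s p v i"
  by (simp add: row_cells_def)

lemma row_cells_set:
  assumes "v < d" "i < 2 * d"
  shows "row_cells d (set_real ''B'' ((p * d + v) * (2 * d) + i) r s) = cell_upd (row_cells d s) p v i r"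
  using addr_inj[OF _ _ assms(1) _ assms(2), of _ _ _ p] assms
  by (intro ext) (auto simp: row_cells_def cell_upd_def)

lemma row_cells_cong: "reals s ''B'' = reals s' ''B'' \<Longrightarrow> row_cells d s = row_cells d s'"
  by (intro ext) (simp add: row_cells_def)

lemma row_upd_0: "row_upd C p v a 0 r = C"
  by (intro ext) (simp add: row_upd_def)

lemma row_upd_Suc: "row_upd C p v a (Suc m) r = cell_upd (row_upd C p v a m r) p v (a + m) (r m)"
  by (intro ext) (auto simp: row_upd_def cell_upd_def)

text \<open>The loops that fill a stretch of one row differ only in the values written; progress is
  expressed relative to the state before the loop.\<close>

lemma wp_For_row:
  assumes x: "x \<notin> int_writes c"
    and bound: "\<And>s'. frame (For x e c) s s' \<Longrightarrow> ival e s' = N" and B: "N \<le> M" "1 \<le> M"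
    and step: "\<And>i s'. i < N \<Longrightarrow> row_cells d s' = row_upd (row_cells d s) p v a i r \<Longrightarrow> ints s' x 0 = i \<Longrightarrow>
      frame (For x e c) s s' \<Longrightarrow>
      wp c (\<lambda>t s''. t \<le> T \<and> row_cells d s'' = cell_upd (row_cells d s') p v (a + i) (r i)) s'"
  shows "wp (For x e c) (\<lambda>t s'. t \<le> M * (2 * (T + icost e + 12)) \<and>
     row_cells d s' = row_upd (row_cells d s) p v a N r \<and> frame (For x e c) s s') s"
proof (rule wp_For[OF x bound B, where Inv = "\<lambda>i s'. row_cells d s' = row_upd (row_cells d s) p v a i r"])
  show "row_cells d (set_int x 0 j s') = row_upd (row_cells d s) p v a i r"
    if "row_cells d s' = row_upd (row_cells d s) p v a i r" for i j s'
    using that row_cells_cong[of "set_int x 0 j s'" s' d] by simp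
  show "wp c (\<lambda>t s''. t \<le> T \<and> row_cells d s'' = row_upd (row_cells d s) p v a (Suc i) r) s'"
    if "i < N" "row_cells d s' = row_upd (row_cells d s) p v a i r" "ints s' x 0 = i" "frame (For x e c) s s'" for i s'
    using step[OF that] that(2) by (simp add: row_upd_Suc)
qed (simp_all add: row_upd_0)

text \<open>Row operations are linear and act on a vector and its image alike. Storing both avoids
  recomputing images, and the functional of each sweep becomes a stored coordinate.\<close>

definition joined :: "nat \<Rightarrow> ((nat \<Rightarrow> real) \<Rightarrow> nat \<Rightarrow> real) \<Rightarrow> (nat \<Rightarrow> real) \<Rightarrow> nat \<Rightarrow> real" where
  "joined d A f i = (if i < d then f i else A f (i - d))"

text \<open>The slots \<open>p\<close> and \<open>q\<close> may coincide: row \<open>v\<close> is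
  read only in its own round, and then its first half is rewritten with the same values.\<close>

definition load :: com where
  "load = For ''v'' (IGet ''D'' (sv ''p'')) (Seq
     (For ''j'' (sv ''d'') (RAssign ''B'' (addr (sv ''q'') (sv ''v'') (sv ''j''))
        (RGet ''B'' (addr (sv ''p'') (sv ''v'') (sv ''j'')))))
     (For ''j'' (sv ''d'') (Seq
        (RAssign ''acc'' (IConst 0) (RSub (RNat (IConst 0)) (RMul (RGet ''c'' (IConst 0))
           (RGet ''B'' (addr (sv ''q'') (sv ''v'') (sv ''j''))))))
        (Seq (dot ''X'' (mat_index (sv ''k'') (sv ''j'') (sv ''l'')) ''B'' (addr (sv ''q'') (sv ''v'') (sv ''l'')))
           (RAssign ''B'' (addr (sv ''q'') (sv ''v'') (IAdd (sv ''d'') (sv ''j''))) (RGet ''acc'' (IConst 0)))))))"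

lemma writes_load [simp]:
  "int_writes load = {''v'', ''j'', ''l''}" "real_writes load = {''B'', ''acc''}" "\<not> emits load"
  by (auto simp: load_def)

definition shifted :: "nat \<Rightarrow> (nat \<Rightarrow> nat \<Rightarrow> real) \<Rightarrow> real \<Rightarrow> (nat \<Rightarrow> real) \<Rightarrow> nat \<Rightarrow> real" where
  "shifted d X c f i = (\<Sum>l<d. X i l * f l) - c * f i"

lemma wp_load:
  assumes d: "ints s ''d'' 0 = d" "1 \<le> d" and len: "ints s ''D'' (ints s ''p'' 0) = length bs" "1 \<le> length bs" "length bs \<le> d"
    and bs: "\<And>v i. v < length bs \<Longrightarrow> i < d \<Longrightarrow> row_cells d s (ints s ''p'' 0) v i = (bs ! v) i"
    and X: "\<And>i l. i < d \<Longrightarrow> l < d \<Longrightarrow> reals s ''X'' ((ints s ''k'' 0 * d + i) * d + l) = X i l"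
  defines "A \<equiv> shifted d X (reals s ''c'' 0)"
  shows "wp load (\<lambda>t s'. t \<le> 3000 * length bs * d ^ 2 \<and>
    row_cells d s' = (\<lambda>p' v i. if p' = ints s ''q'' 0 \<and> v < length bs \<and> i < 2 * d then joined d A (bs ! v) i else row_cells d s p' v i)) s"
proof -
  define p where "p = ints s ''p'' 0"
  define q where "q = ints s ''q'' 0"
  let ?copy = "RAssign ''B'' (addr (sv ''q'') (sv ''v'') (sv ''j''))
        (RGet ''B'' (addr (sv ''p'') (sv ''v'') (sv ''j'')))"
  let ?dot = "dot ''X'' (mat_index (sv ''k'') (sv ''j'') (sv ''l'')) ''B'' (addr (sv ''q'') (sv ''v'') (sv ''l''))"
  let ?app = "Seq (RAssign ''acc'' (IConst 0) (RSub (RNat (IConst 0)) (RMul (RGet ''c'' (IConst 0))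
           (RGet ''B'' (addr (sv ''q'') (sv ''v'') (sv ''j''))))))
        (Seq ?dot
           (RAssign ''B'' (addr (sv ''q'') (sv ''v'') (IAdd (sv ''d'') (sv ''j''))) (RGet ''acc'' (IConst 0))))"
  let ?c1 = "For ''j'' (sv ''d'') ?copy" and ?c2 = "For ''j'' (sv ''d'') ?app"
  define Done where "Done w = (\<lambda>p' v i. if p' = q \<and> v < w \<and> i < 2 * d then joined d A (bs ! v) i else row_cells d s p' v i)" for w
  have fixed: "ints s' ''d'' 0 = d" "ints s' ''p'' 0 = p" "ints s' ''q'' 0 = q" "ints s' ''k'' 0 = ints s ''k'' 0"
    "ints s' ''D'' = ints s ''D''" "reals s' ''X'' = reals s ''X''" "reals s' ''c'' = reals s ''c''"
    if "frame load s s'" for s'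
    using that d by (auto simp: frame_def p_def q_def)
  have body: "wp (Seq ?c1 ?c2) (\<lambda>t s''. t \<le> 1400 * d ^ 2 \<and> row_cells d s'' = Done (Suc v)) s'"
    if v: "v < length bs" and D: "row_cells d s' = Done v" and iv: "ints s' ''v'' 0 = v" and f: "frame load s s'" for v s'
  proof -
    have vd: "v < d" using v len by simp
    define b where "b = bs ! v"
    \<comment> \<open>If the slots coincide, only rows before \<open>v\<close> have been changed so
      far.\<close>
    have old: "row_cells d s' p v i = b i" if "i < d" for i
      using bs[OF v that] D by (simp add: Done_def b_def p_def)
    have f': "frame load s s''" if "frame ?c1 s' s''" for s'' using f that by (auto simp: frame_def)
    have 1: "wp ?c1 (\<lambda>t s''. t \<le> d * (2 * (40 + icost (sv ''d'') + 12)) \<and>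
       row_cells d s'' = row_upd (row_cells d s') q v 0 d b \<and> frame ?c1 s' s'') s'"
    proof (rule wp_For_row)
      show "ival (sv ''d'') s'' = d" if "frame ?c1 s' s''" for s'' using fixed[OF f'[OF that]] by simp
      fix j s'' assume *: "j < d" "row_cells d s'' = row_upd (row_cells d s') q v 0 j b" "ints s'' ''j'' 0 = j" "frame ?c1 s' s''"
      have iv'': "ints s'' ''v'' 0 = v" using *(4) iv by (simp add: frame_def)
      note fx = fixed[OF f'[OF *(4)]]
      have j2: "j < 2 * d" using *(1) by simp
      have "row_cells d s'' p v j = b j" using *(1,2) old by (auto simp: row_upd_def)
      then show "wp ?copy (\<lambda>t s3. t \<le> 40 \<and> row_cells d s3 = cell_upd (row_cells d s'') q v (0 + j) (b j)) s''"
        by (simp add: wp_simps icost_addr ival_addr[OF fx(1)] fx iv'' *(3) row_cells_get[OF vd j2] row_cells_set[OF vd j2] del: state_simps(4))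
    qed (use d in auto)
    have 2: "wp ?c2 (\<lambda>t s3. t \<le> d * (2 * (300 * d + icost (sv ''d'') + 12)) \<and>
       row_cells d s3 = row_upd (row_cells d s2) q v d d (A b) \<and> frame ?c2 s2 s3) s2"
      if c2: "row_cells d s2 = row_upd (row_cells d s') q v 0 d b" and f2: "frame ?c1 s' s2" for s2
    proof (rule wp_For_row)
      have f3: "frame load s s3" if "frame ?c2 s2 s3" for s3 using f'[OF f2] that by (auto simp: frame_def)
      show "ival (sv ''d'') s3 = d" if "frame ?c2 s2 s3" for s3 using fixed[OF f3[OF that]] by simp
      fix j s3 assume *: "j < d" "row_cells d s3 = row_upd (row_cells d s2) q v d j (A b)" "ints s3 ''j'' 0 = j" "frame ?c2 s2 s3"
      have iv3: "ints s3 ''v'' 0 = v" using *(4) f2 iv by (simp add: frame_def)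
      note fx = fixed[OF f3[OF *(4)]]
      have j2: "j < 2 * d" "d + j < 2 * d" using *(1) by simp_all
      have row: "row_cells d s3 q v i = b i" if "i < d" for i
        using that *(2) c2 by (simp add: row_upd_def)
      \<comment> \<open>The diagonal term of the shifted matrix is preloaded as the initial value of
        the scalar product.\<close>
      let ?s4 = "set_real ''acc'' 0 (- (reals s ''c'' 0 * b j)) s3"
      have cB: "row_cells d s5 = row_cells d s3" if "frame ?dot ?s4 s5" for s5
        using that by (intro row_cells_cong) (simp add: frame_def)
      have fd: "frame load s s5" if "frame ?dot ?s4 s5" for s5
        using f3[OF *(4)] that by (auto simp: frame_def)
      have w: "wp ?dot (\<lambda>t s5. t \<le> 200 * d \<and>
        reals s5 ''acc'' 0 = reals ?s4 ''acc'' 0 + (\<Sum>l<d. reals ?s4 ''X'' ((ints s ''k'' 0 * d + j) * d + l) *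
          reals ?s4 ''B'' ((q * d + v) * (2 * d) + l)) \<and> frame ?dot ?s4 s5) ?s4"
      proof (rule wp_dot)
        show "ints ?s4 ''d'' 0 = d" using fx by simp
        fix l s5 assume f5: "frame ?dot ?s4 s5" and l: "ints s5 ''l'' 0 = l"
        have "ints s5 ''j'' 0 = j" "ints s5 ''v'' 0 = v" using f5 *(3) iv3 by (auto simp: frame_def)
        then show "ival (mat_index (sv ''k'') (sv ''j'') (sv ''l'')) s5 = (ints s ''k'' 0 * d + j) * d + l"
          "ival (addr (sv ''q'') (sv ''v'') (sv ''l'')) s5 = (q * d + v) * (2 * d) + l"
          using fixed[OF fd[OF f5]] l by (simp_all add: ival_mat_index[of _ d] ival_addr[of _ d])
      qed (use d in \<open>simp_all add: icost_mat_index icost_addr\<close>)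
      have val: "reals ?s4 ''acc'' 0 + (\<Sum>l<d. reals ?s4 ''X'' ((ints s ''k'' 0 * d + j) * d + l) *
          reals ?s4 ''B'' ((q * d + v) * (2 * d) + l)) = A b j"
      proof -
        have "reals ?s4 ''B'' ((q * d + v) * (2 * d) + l) = b l" if "l < d" for l
          using row_cells_get[OF vd, of l s3 q] row[OF that] that by simp
        then show ?thesis using X[OF *(1)] fx(6) by (simp add: A_def shifted_def)
      qed
      have rv: "rval (RSub (RNat (IConst 0)) (RMul (RGet ''c'' (IConst 0)) (RGet ''B'' (addr (sv ''q'') (sv ''v'') (sv ''j''))))) s3
          = - (reals s ''c'' 0 * b j)"
        using fx iv3 *(3) by (simp add: ival_addr[of _ d] row_cells_get[OF vd j2(1)] row[OF *(1)])
      show "wp ?app (\<lambda>t s4. t \<le> 300 * d \<and> row_cells d s4 = cell_upd (row_cells d s3) q v (d + j) (A b j)) s3"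
        unfolding wp_Seq wp_RAssign ival.simps rv
      proof (rule wp_mono, rule w, elim conjE, intro conjI)
        fix t s5 assume t: "t \<le> 200 * d" and acc: "reals s5 ''acc'' 0 = reals ?s4 ''acc'' 0 +
          (\<Sum>l<d. reals ?s4 ''X'' ((ints s ''k'' 0 * d + j) * d + l) * reals ?s4 ''B'' ((q * d + v) * (2 * d) + l))"
          and f5: "frame ?dot ?s4 s5"
        show "1 + (1 + icost (IConst 0) + rcost (RSub (RNat (IConst 0)) (RMul (RGet ''c'' (IConst 0))
            (RGet ''B'' (addr (sv ''q'') (sv ''v'') (sv ''j'')))))) +
          (1 + t + (1 + icost (addr (sv ''q'') (sv ''v'') (IAdd (sv ''d'') (sv ''j''))) + rcost (RGet ''acc'' (IConst 0)))) \<le> 300 * d"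
          using t d by (simp add: icost_addr)
        have "ints s5 ''j'' 0 = j" "ints s5 ''v'' 0 = v" using f5 *(3) iv3 by (auto simp: frame_def)
        then have ix: "ival (addr (sv ''q'') (sv ''v'') (IAdd (sv ''d'') (sv ''j''))) s5 = (q * d + v) * (2 * d) + (d + j)"
          using fixed[OF fd[OF f5]] by (simp add: ival_addr[of _ d])
        show "row_cells d (set_real ''B'' (ival (addr (sv ''q'') (sv ''v'') (IAdd (sv ''d'') (sv ''j''))) s5)
            (rval (RGet ''acc'' (IConst 0)) s5) s5) = cell_upd (row_cells d s3) q v (d + j) (A b j)"
          unfolding ix row_cells_set[OF vd j2(2)] cB[OF f5] by (simp only: rval.simps ival.simps acc val)
      qed
    qed (use d in auto)
    show ?thesis unfolding wp_Seq
    proof (rule wp_mono[OF 1], elim conjE)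
      fix t1 s2 assume t1: "t1 \<le> d * (2 * (40 + icost (sv ''d'') + 12))"
        and c2: "row_cells d s2 = row_upd (row_cells d s') q v 0 d b" and f2: "frame ?c1 s' s2"
      show "wp ?c2 (\<lambda>t2 s''. 1 + t1 + t2 \<le> 1400 * d ^ 2 \<and> row_cells d s'' = Done (Suc v)) s2"
      proof (rule wp_mono[OF 2[OF c2 f2]], elim conjE, intro conjI)
        fix t2 s3 assume t2: "t2 \<le> d * (2 * (300 * d + icost (sv ''d'') + 12))"
          and c3: "row_cells d s3 = row_upd (row_cells d s2) q v d d (A b)"
        have "t1 + t2 \<le> 600 * d ^ 2 + 136 * d" using t1 t2 by (simp add: power2_eq_square algebra_simps)
        moreover have "d \<le> d ^ 2" using d by (simp add: power2_eq_square)
        ultimately show "1 + t1 + t2 \<le> 1400 * d ^ 2" using d by linarith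
        show "row_cells d s3 = Done (Suc v)"
          unfolding c3 c2 D by (intro HOL.ext) (auto simp: row_upd_def Done_def joined_def b_def less_Suc_eq)
      qed
    qed
  qed
  have "wp load (\<lambda>t s'. t \<le> length bs * (2 * (1400 * d ^ 2 + icost (IGet ''D'' (sv ''p'')) + 12)) \<and> row_cells d s' = Done (length bs) \<and>
     frame (For ''v'' (IGet ''D'' (sv ''p'')) (Seq ?c1 ?c2)) s s') s"
    unfolding load_def
  proof (rule wp_For[where Inv = "\<lambda>v s'. row_cells d s' = Done v"])
    show "row_cells d (set_int ''v'' 0 j s') = Done i" if "row_cells d s' = Done i" for i j s'
      using that row_cells_cong[of "set_int ''v'' 0 j s'" s' d] by simp
    show "ival (IGet ''D'' (sv ''p'')) s' = length bs" if "frame (For ''v'' (IGet ''D'' (sv ''p'')) (Seq ?c1 ?c2)) s s'" for s'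
      using fixed[of s'] that len by (simp add: load_def p_def)
    show "wp (Seq ?c1 ?c2) (\<lambda>t s''. t \<le> 1400 * d ^ 2 \<and> row_cells d s'' = Done (Suc v)) s'"
      if "v < length bs" "row_cells d s' = Done v" "ints s' ''v'' 0 = v" "frame (For ''v'' (IGet ''D'' (sv ''p'')) (Seq ?c1 ?c2)) s s'" for v s'
      using body[OF that(1-3)] that(4) by (simp add: load_def)
    show "row_cells d s = Done 0" by (intro HOL.ext) (simp add: Done_def)
  qed (use len in auto)
  then show ?thesis
  proof (rule wp_mono, elim conjE, intro conjI)
    fix t s' assume t: "t \<le> length bs * (2 * (1400 * d ^ 2 + icost (IGet ''D'' (sv ''p'')) + 12))"
    have "2 * (1400 * e + icost (IGet ''D'' (sv ''p'')) + 12) \<le> 3000 * e" if "1 \<le> e" for e using that by simp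
    from this[of "d ^ 2"] have "2 * (1400 * d ^ 2 + icost (IGet ''D'' (sv ''p'')) + 12) \<le> 3000 * d ^ 2"
      using d by simp
    then have "length bs * (2 * (1400 * d ^ 2 + icost (IGet ''D'' (sv ''p'')) + 12)) \<le> length bs * (3000 * d ^ 2)"
      by (rule mult_le_mono2)
    from le_trans[OF t this] show "t \<le> 3000 * length bs * d ^ 2" by (simp only: ac_simps)
  qed (simp_all add: Done_def q_def)
qed

section \<open>One sweep in place\<close>

definition two_d :: iexp where
  "two_d = IMul (IConst 2) (sv ''d'')"

definition pivot_index :: iexp where
  "pivot_index = IAdd (sv ''d'') (sv ''j'')"

text \<open>A new pivot moves to \<open>Q\<close> and leaves no row behind; any other row is reduced
  and written at position \<open>w\<close>. Since \<open>w\<close> never exceeds \<open>v\<close>,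
  reduction and compaction take place in the same slot.\<close>

definition sweep_step :: com where
  "sweep_step = If (BAnd (REq (RGet ''Q'' pivot_index) (RNat (IConst 0)))
       (BNot (REq (RGet ''B'' (addr (sv ''q'') (sv ''v'') pivot_index)) (RNat (IConst 0)))))
     (For ''i'' two_d (RAssign ''Q'' (sv ''i'') (RGet ''B'' (addr (sv ''q'') (sv ''v'') (sv ''i'')))))
     (Seq (RAssign ''f'' (IConst 0) (RDiv (RGet ''B'' (addr (sv ''q'') (sv ''v'') pivot_index)) (RGet ''Q'' pivot_index)))
     (Seq (For ''i'' two_d (RAssign ''B'' (addr (sv ''q'') (sv ''w'') (sv ''i''))
        (RSub (RGet ''B'' (addr (sv ''q'') (sv ''v'') (sv ''i''))) (RMul (RGet ''f'' (IConst 0)) (RGet ''Q'' (sv ''i''))))))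
       (IAssign ''w'' (IConst 0) (IAdd (sv ''w'') (IConst 1)))))"

definition column :: com where
  "column = Seq (For ''i'' two_d (RAssign ''Q'' (sv ''i'') (RNat (IConst 0))))
     (Seq (IAssign ''w'' (IConst 0) (IConst 0))
     (Seq (For ''v'' (IGet ''D'' (sv ''q'')) sweep_step)
       (IAssign ''D'' (sv ''q'') (sv ''w''))))"

lemma writes_sweep_step [simp]:
  "int_writes sweep_step = {''i'', ''w''}" "real_writes sweep_step = {''Q'', ''B'', ''f''}" "\<not> emits sweep_step"
  by (auto simp: sweep_step_def)

lemma writes_column [simp]:
  "int_writes column = {''i'', ''w'', ''v'', ''D''}" "real_writes column = {''Q'', ''B'', ''f''}" "\<not> emits column"
  by (auto simp: column_def)

text \<open>The invariant of the loop: the rows written so far, followed by the sweep of the unread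
  rows, are the complete result \<open>R\<close>. Rows after \<open>v\<close> are untouched, so the
  unread input survives the compaction.\<close>

lemma wp_sweep_step:
  assumes d: "ints s ''d'' 0 = d" "1 \<le> d" and j: "j < d" "ints s ''j'' 0 = j"
    and A: "\<And>f g c i. A (f - fun_scale c g) i = A f i - c * A g i"
    and v: "v < length bs" "length bs \<le> d" "ints s ''v'' 0 = v"
    and w: "ints s ''w'' 0 = length out" "length out \<le> v" and q: "ints s ''q'' 0 = q"
    and Q: "\<And>i. i < 2 * d \<Longrightarrow> reals s ''Q'' i = joined d A piv i"
    and row: "\<And>i. i < 2 * d \<Longrightarrow> row_cells d s q v i = joined d A (bs ! v) i"
    and out: "\<And>u i. u < length out \<Longrightarrow> i < 2 * d \<Longrightarrow> row_cells d s q u i = joined d A (out ! u) i"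
    and sw: "out @ sweep (\<lambda>f. A f j) piv (drop v bs) = R"
  shows "wp sweep_step (\<lambda>t s'. t \<le> 500 * d \<and> (\<exists>out' piv'.
    out' @ sweep (\<lambda>f. A f j) piv' (drop (Suc v) bs) = R \<and> ints s' ''w'' 0 = length out' \<and> length out' \<le> Suc v \<and>
    (\<forall>i<2 * d. reals s' ''Q'' i = joined d A piv' i) \<and>
    (\<forall>u<length out'. \<forall>i<2 * d. row_cells d s' q u i = joined d A (out' ! u) i)) \<and>
    (\<forall>p u. (p \<noteq> q \<or> v < u) \<longrightarrow> row_cells d s' p u = row_cells d s p u)) s"
proof -
  define b where "b = bs ! v"
  have vd: "v < d" and wd: "length out < d" using v w by simp_all
  have drop: "drop v bs = b # drop (Suc v) bs" using v by (simp add: b_def Cons_nth_drop_Suc)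
  have dj: "d + j < 2 * d" using j by simp
  have pi: "ival pivot_index s = d + j" using d j by (simp add: pivot_index_def)
  have ai: "ival (addr (sv ''q'') (sv ''v'') pivot_index) s = (q * d + v) * (2 * d) + (d + j)"
    using v q d pi by (simp add: ival_addr[of _ d])
  have Qj: "reals s ''Q'' (d + j) = A piv j" using Q[OF dj] by (simp add: joined_def)
  have Bj: "reals s ''B'' ((q * d + v) * (2 * d) + (d + j)) = A b j"
    using row[OF dj] row_cells_get[OF vd dj] by (simp add: joined_def b_def)
  let ?test = "BAnd (REq (RGet ''Q'' pivot_index) (RNat (IConst 0)))
       (BNot (REq (RGet ''B'' (addr (sv ''q'') (sv ''v'') pivot_index)) (RNat (IConst 0))))"
  have bv: "bval ?test s \<longleftrightarrow> A piv j = 0 \<and> A b j \<noteq> 0" using pi ai Qj Bj by simp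
  have bc: "bcost ?test = 34" by (simp add: icost_addr pivot_index_def)
  have it: "icost two_d = 4" by (simp add: two_d_def)
  show ?thesis
  proof (cases "A piv j = 0 \<and> A b j \<noteq> 0")
    case True
    let ?c = "RAssign ''Q'' (sv ''i'') (RGet ''B'' (addr (sv ''q'') (sv ''v'') (sv ''i'')))"
    have "wp (For ''i'' two_d ?c) (\<lambda>t s'. t \<le> (2 * d) * (2 * (30 + icost two_d + 12)) \<and>
      (\<forall>i<2 * d. reals s' ''Q'' i = joined d A b i) \<and> frame (For ''i'' two_d ?c) s s') s"
    proof (rule wp_For[where Inv = "\<lambda>i s'. \<forall>i'<i. reals s' ''Q'' i' = joined d A b i'"])
      show "ival two_d s' = 2 * d" if "frame (For ''i'' two_d ?c) s s'" for s'
        using that d by (simp add: frame_def two_d_def)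
      fix i s' assume i: "i < 2 * d" and inv: "\<forall>i'<i. reals s' ''Q'' i' = joined d A b i'"
        and ii: "ints s' ''i'' 0 = i" and f: "frame (For ''i'' two_d ?c) s s'"
      have fx: "ints s' ''d'' 0 = d" "ints s' ''q'' 0 = q" "ints s' ''v'' 0 = v" "reals s' ''B'' = reals s ''B''"
        using f d q v by (auto simp: frame_def)
      have "reals s' ''B'' ((q * d + v) * (2 * d) + i) = joined d A b i"
        using row[OF i] row_cells_get[OF vd i] fx(4) by (simp add: b_def)
      then show "wp ?c (\<lambda>t s''. t \<le> 30 \<and> (\<forall>i'<Suc i. reals s'' ''Q'' i' = joined d A b i')) s'"
        using fx ii inv by (simp add: wp_simps icost_addr ival_addr[of _ d] less_Suc_eq)
    qed (use d in auto)
    then have 1: "wp (For ''i'' two_d ?c) (\<lambda>t s'. t \<le> 200 * d \<and>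
      (\<forall>i<2 * d. reals s' ''Q'' i = joined d A b i) \<and> frame (For ''i'' two_d ?c) s s') s"
      by (rule wp_mono) (auto simp: it)
    show ?thesis
      unfolding sweep_step_def wp_If bv bc
      using True
    proof (simp only: if_True simp_thms, intro wp_mono[OF 1], elim conjE, intro conjI)
      fix t s' assume t: "t \<le> 200 * d" and Q': "\<forall>i<2 * d. reals s' ''Q'' i = joined d A b i"
        and f: "frame (For ''i'' two_d ?c) s s'"
      show "1 + 34 + t \<le> 500 * d" using t d by linarith
      have C: "row_cells d s' = row_cells d s" using f by (intro row_cells_cong) (simp add: frame_def)
      then show "\<forall>p u. p \<noteq> q \<or> v < u \<longrightarrow> row_cells d s' p u = row_cells d s p u" by simp
      show "\<exists>out' piv'. out' @ sweep (\<lambda>f. A f j) piv' (drop (Suc v) bs) = R \<and>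
        ints s' ''w'' 0 = length out' \<and> length out' \<le> Suc v \<and> (\<forall>i<2 * d. reals s' ''Q'' i = joined d A piv' i) \<and>
        (\<forall>u<length out'. \<forall>i<2 * d. row_cells d s' q u i = joined d A (out' ! u) i)"
        using sw True w f out Q' C by (intro exI[of _ out] exI[of _ b]) (simp add: drop frame_def)
    qed
  next
    case False
    define c where "c = A b j / A piv j"
    define b' where "b' = b - fun_scale c piv"
    let ?s1 = "set_real ''f'' 0 c s"
    let ?c = "RAssign ''B'' (addr (sv ''q'') (sv ''w'') (sv ''i''))
        (RSub (RGet ''B'' (addr (sv ''q'') (sv ''v'') (sv ''i''))) (RMul (RGet ''f'' (IConst 0)) (RGet ''Q'' (sv ''i''))))"
    have C1: "row_cells d ?s1 = row_cells d s" by (rule row_cells_cong) simp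
    \<comment> \<open>By linearity of \<open>A\<close>, one row operation reduces the vector and its
      image at the same time.\<close>
    have eb': "joined d A b' i = joined d A b i - c * joined d A piv i" for i
      by (simp add: joined_def b'_def A fun_apply)
    have "wp (For ''i'' two_d ?c) (\<lambda>t s'. t \<le> (2 * d) * (2 * (60 + icost two_d + 12)) \<and>
      row_cells d s' = row_upd (row_cells d ?s1) q (length out) 0 (2 * d) (joined d A b') \<and> frame (For ''i'' two_d ?c) ?s1 s') ?s1"
    proof (rule wp_For_row)
      show "ival two_d s' = 2 * d" if "frame (For ''i'' two_d ?c) ?s1 s'" for s'
        using that d by (simp add: frame_def two_d_def)
      fix i s' assume i: "i < 2 * d" and inv: "row_cells d s' = row_upd (row_cells d ?s1) q (length out) 0 i (joined d A b')"
        and ii: "ints s' ''i'' 0 = i" and f: "frame (For ''i'' two_d ?c) ?s1 s'"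
      have fx: "ints s' ''d'' 0 = d" "ints s' ''q'' 0 = q" "ints s' ''v'' 0 = v" "ints s' ''w'' 0 = length out"
        "reals s' ''f'' 0 = c" "reals s' ''Q'' = reals s ''Q''"
        using f d q v w by (auto simp: frame_def)
      \<comment> \<open>The row that is read and the row that is written may be the same, but only
        positions below \<open>i\<close> have been overwritten.\<close>
      have "row_cells d s' q v i = joined d A b i" using inv C1 row[OF i] by (simp add: row_upd_def b_def)
      then have val: "reals s' ''B'' ((q * d + v) * (2 * d) + i) = joined d A b i" using row_cells_get[OF vd i] by simp
      show "wp ?c (\<lambda>t s''. t \<le> 60 \<and> row_cells d s'' = cell_upd (row_cells d s') q (length out) (0 + i) (joined d A b' i)) s'"
        using fx ii i Q[OF i] by (simp add: wp_simps icost_addr ival_addr[of _ d] val eb' row_cells_set[OF wd i] del: state_simps(4))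
    qed (use d in auto)
    then have 1: "wp (For ''i'' two_d ?c) (\<lambda>t s'. t \<le> 400 * d \<and>
      row_cells d s' = row_upd (row_cells d s) q (length out) 0 (2 * d) (joined d A b') \<and> frame (For ''i'' two_d ?c) ?s1 s') ?s1"
      by (rule wp_mono) (auto simp: it C1)
    have rv: "rval (RDiv (RGet ''B'' (addr (sv ''q'') (sv ''v'') pivot_index)) (RGet ''Q'' pivot_index)) s = c"
      using pi ai Qj Bj by (simp add: c_def)
    show ?thesis
      unfolding sweep_step_def wp_If bv bc wp_Seq wp_RAssign ival.simps rv
    proof (simp only: False if_False, intro wp_mono[OF 1], elim conjE)
      fix t s2 assume t: "t \<le> 400 * d" and C: "row_cells d s2 = row_upd (row_cells d s) q (length out) 0 (2 * d) (joined d A b')"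
        and f: "frame (For ''i'' two_d ?c) ?s1 s2"
      have fx: "ints s2 ''w'' 0 = length out" "reals s2 ''Q'' = reals s ''Q''" using f w by (auto simp: frame_def)
      let ?s3 = "set_int ''w'' 0 (Suc (length out)) s2"
      have C3: "row_cells d ?s3 = row_upd (row_cells d s) q (length out) 0 (2 * d) (joined d A b')"
        using C row_cells_cong[of ?s3 s2 d] by simp
      have big: "row_cells d s p u i = 0" if "\<not> i < 2 * d" for p u i using that by (simp add: row_cells_def)
      show "wp (IAssign ''w'' (IConst 0) (IAdd (sv ''w'') (IConst 1)))
        (\<lambda>t2 s'. 1 + 34 + (1 + (1 + icost (IConst 0) + rcost (RDiv (RGet ''B'' (addr (sv ''q'') (sv ''v'') pivot_index)) (RGet ''Q'' pivot_index))) +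
           (1 + t + t2)) \<le> 500 * d \<and>
          (\<exists>out' piv'. out' @ sweep (\<lambda>f. A f j) piv' (drop (Suc v) bs) = R \<and>
            ints s' ''w'' 0 = length out' \<and> length out' \<le> Suc v \<and> (\<forall>i<2 * d. reals s' ''Q'' i = joined d A piv' i) \<and>
            (\<forall>u<length out'. \<forall>i<2 * d. row_cells d s' q u i = joined d A (out' ! u) i)) \<and>
          (\<forall>p u. p \<noteq> q \<or> v < u \<longrightarrow> row_cells d s' p u = row_cells d s p u)) s2"
        unfolding wp_IAssign
      proof (intro conjI)
        show "1 + 34 + (1 + (1 + icost (IConst 0) + rcost (RDiv (RGet ''B'' (addr (sv ''q'') (sv ''v'') pivot_index)) (RGet ''Q'' pivot_index))) +
           (1 + t + (1 + icost (IConst 0) + icost (IAdd (sv ''w'') (IConst 1))))) \<le> 500 * d"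
          using t d by (simp add: icost_addr pivot_index_def)
        have s3: "set_int ''w'' (ival (IConst 0) s2) (ival (IAdd (sv ''w'') (IConst 1)) s2) s2 = ?s3"
          using fx by simp
        show "\<exists>out' piv'. out' @ sweep (\<lambda>f. A f j) piv' (drop (Suc v) bs) = R \<and>
            ints (set_int ''w'' (ival (IConst 0) s2) (ival (IAdd (sv ''w'') (IConst 1)) s2) s2) ''w'' 0 = length out' \<and>
            length out' \<le> Suc v \<and>
            (\<forall>i<2 * d. reals (set_int ''w'' (ival (IConst 0) s2) (ival (IAdd (sv ''w'') (IConst 1)) s2) s2) ''Q'' i = joined d A piv' i) \<and>
            (\<forall>u<length out'. \<forall>i<2 * d.
               row_cells d (set_int ''w'' (ival (IConst 0) s2) (ival (IAdd (sv ''w'') (IConst 1)) s2) s2) q u i = joined d A (out' ! u) i)"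
          unfolding s3 C3
        proof (intro exI[of _ "out @ [b']"] exI[of _ piv] conjI allI impI)
          show "(out @ [b']) @ sweep (\<lambda>f. A f j) piv (drop (Suc v) bs) = R"
            using sw False by (auto simp: drop b'_def c_def)
          fix u i assume u: "u < length (out @ [b'])" "i < 2 * d"
          show "row_upd (row_cells d s) q (length out) 0 (2 * d) (joined d A b') q u i = joined d A ((out @ [b']) ! u) i"
            using u out by (auto simp: row_upd_def nth_append less_Suc_eq)
        qed (use fx w Q in simp_all)
        show "\<forall>p u. p \<noteq> q \<or> v < u \<longrightarrow>
            row_cells d (set_int ''w'' (ival (IConst 0) s2) (ival (IAdd (sv ''w'') (IConst 1)) s2) s2) p u = row_cells d s p u"
          unfolding s3 C3 using w by (auto simp: row_upd_def fun_eq_iff)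
      qed
    qed
  qed
qed

text \<open>\<open>m\<close> can stay fixed while the list shrinks from column to column. It is at
  least one even if no row is left, which pays for clearing the pivot.\<close>

lemma wp_column:
  assumes d: "ints s ''d'' 0 = d" "1 \<le> d" and j: "j < d" "ints s ''j'' 0 = j"
    and A: "\<And>f g c i. A (f - fun_scale c g) i = A f i - c * A g i" "\<And>i. A 0 i = 0"
    and q: "ints s ''q'' 0 = q" and len: "ints s ''D'' q = length bs" "length bs \<le> d" "length bs \<le> m" "1 \<le> m"
    and row: "\<And>v i. v < length bs \<Longrightarrow> i < 2 * d \<Longrightarrow> row_cells d s q v i = joined d A (bs ! v) i"
  shows "wp column (\<lambda>t s'. t \<le> 1500 * m * d \<and>
    ints s' ''D'' = (ints s ''D'')(q := length (sweep (\<lambda>f. A f j) 0 bs)) \<and>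
    (\<forall>v<length (sweep (\<lambda>f. A f j) 0 bs). \<forall>i<2 * d. row_cells d s' q v i = joined d A (sweep (\<lambda>f. A f j) 0 bs ! v) i) \<and>
    (\<forall>p. p \<noteq> q \<longrightarrow> row_cells d s' p = row_cells d s p)) s"
proof -
  let ?R = "sweep (\<lambda>f. A f j) 0 bs"
  let ?clear = "RAssign ''Q'' (sv ''i'') (RNat (IConst 0))"
  let ?bound = "IGet ''D'' (sv ''q'')"
  have it: "icost two_d = 4" by (simp add: two_d_def)
  have "wp (For ''i'' two_d ?clear) (\<lambda>t s'. t \<le> (2 * d) * (2 * (5 + icost two_d + 12)) \<and>
    (\<forall>i<2 * d. reals s' ''Q'' i = 0) \<and> frame (For ''i'' two_d ?clear) s s') s"
  proof (rule wp_For[where Inv = "\<lambda>i s'. \<forall>i'<i. reals s' ''Q'' i' = 0"])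
    show "ival two_d s' = 2 * d" if "frame (For ''i'' two_d ?clear) s s'" for s'
      using that d by (simp add: frame_def two_d_def)
  qed (use d in \<open>auto simp: wp_simps less_Suc_eq\<close>)
  then have 1: "wp (For ''i'' two_d ?clear) (\<lambda>t s'. t \<le> 100 * d \<and>
    (\<forall>i<2 * d. reals s' ''Q'' i = 0) \<and> frame (For ''i'' two_d ?clear) s s') s"
    by (rule wp_mono) (auto simp: it)
  define Inv where "Inv v s' \<longleftrightarrow> (\<exists>out piv. out @ sweep (\<lambda>f. A f j) piv (drop v bs) = ?R \<and>
      ints s' ''w'' 0 = length out \<and> length out \<le> v \<and> (\<forall>i<2 * d. reals s' ''Q'' i = joined d A piv i) \<and>
      (\<forall>u<length out. \<forall>i<2 * d. row_cells d s' q u i = joined d A (out ! u) i)) \<and>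
      (\<forall>p u. p \<noteq> q \<or> v \<le> u \<longrightarrow> row_cells d s' p u = row_cells d s p u)" for v s'
  have 2: "wp (For ''v'' ?bound sweep_step) (\<lambda>t s3. t \<le> m * (2 * (500 * d + icost ?bound + 12)) \<and>
      Inv (length bs) s3 \<and> frame (For ''v'' ?bound sweep_step) s2 s3) s2"
    if Q0: "\<forall>i<2 * d. reals s2 ''Q'' i = 0" and w0: "ints s2 ''w'' 0 = 0"
      and fx2: "ints s2 ''d'' 0 = d" "ints s2 ''j'' 0 = j" "ints s2 ''q'' 0 = q" "ints s2 ''D'' = ints s ''D''"
      and C2: "row_cells d s2 = row_cells d s" for s2
  proof (rule wp_For[where Inv = Inv])
    show "ival ?bound s3 = length bs" if "frame (For ''v'' ?bound sweep_step) s2 s3" for s3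
      using that fx2 len by (simp add: frame_def)
    show "Inv i (set_int ''v'' 0 k s3)" if "Inv i s3" for i k s3
      using that row_cells_cong[of "set_int ''v'' 0 k s3" s3 d] by (simp add: Inv_def)
    have "joined d A 0 i = 0" for i by (simp add: joined_def A fun_apply)
    then show "Inv 0 s2" unfolding Inv_def using Q0 w0 C2 by (intro conjI exI[of _ "[]"] exI[of _ 0]) auto
    fix v s3 assume v: "v < length bs" and inv: "Inv v s3" and vv: "ints s3 ''v'' 0 = v"
      and f: "frame (For ''v'' ?bound sweep_step) s2 s3"
    obtain out piv where o: "out @ sweep (\<lambda>f. A f j) piv (drop v bs) = ?R"
      "ints s3 ''w'' 0 = length out" "length out \<le> v" "\<forall>i<2 * d. reals s3 ''Q'' i = joined d A piv i"
      "\<forall>u<length out. \<forall>i<2 * d. row_cells d s3 q u i = joined d A (out ! u) i"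
      and rest: "\<forall>p u. p \<noteq> q \<or> v \<le> u \<longrightarrow> row_cells d s3 p u = row_cells d s p u"
      using inv unfolding Inv_def by blast
    have fx3: "ints s3 ''d'' 0 = d" "ints s3 ''j'' 0 = j" "ints s3 ''q'' 0 = q"
      using f fx2 by (auto simp: frame_def)
    have "row_cells d s3 q v = row_cells d s q v" using rest by simp
    then have rv: "row_cells d s3 q v i = joined d A (bs ! v) i" if "i < 2 * d" for i using row[OF v that] by simp
    have step: "wp sweep_step (\<lambda>t s'. t \<le> 500 * d \<and> (\<exists>out' piv'.
      out' @ sweep (\<lambda>f. A f j) piv' (drop (Suc v) bs) = ?R \<and> ints s' ''w'' 0 = length out' \<and> length out' \<le> Suc v \<and>
      (\<forall>i<2 * d. reals s' ''Q'' i = joined d A piv' i) \<and>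
      (\<forall>u<length out'. \<forall>i<2 * d. row_cells d s' q u i = joined d A (out' ! u) i)) \<and>
      (\<forall>p u. (p \<noteq> q \<or> v < u) \<longrightarrow> row_cells d s' p u = row_cells d s3 p u)) s3"
      by (rule wp_sweep_step[OF fx3(1) d(2) j(1) fx3(2) A(1) v len(2) vv o(2,3) fx3(3) _ rv _ o(1)]) (use o in auto)
    show "wp sweep_step (\<lambda>t s''. t \<le> 500 * d \<and> Inv (Suc v) s'') s3"
    proof (rule wp_mono[OF step], elim conjE, intro conjI)
      fix t s' assume a: "\<exists>out' piv'.
        out' @ sweep (\<lambda>f. A f j) piv' (drop (Suc v) bs) = ?R \<and> ints s' ''w'' 0 = length out' \<and> length out' \<le> Suc v \<and>
        (\<forall>i<2 * d. reals s' ''Q'' i = joined d A piv' i) \<and>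
        (\<forall>u<length out'. \<forall>i<2 * d. row_cells d s' q u i = joined d A (out' ! u) i)"
        and b: "\<forall>p u. (p \<noteq> q \<or> v < u) \<longrightarrow> row_cells d s' p u = row_cells d s3 p u"
      have "\<forall>p u. p \<noteq> q \<or> Suc v \<le> u \<longrightarrow> row_cells d s' p u = row_cells d s p u"
      proof (intro allI impI)
        fix p u assume "p \<noteq> q \<or> Suc v \<le> u"
        then have "p \<noteq> q \<or> v < u" "p \<noteq> q \<or> v \<le> u" by auto
        then show "row_cells d s' p u = row_cells d s p u" using b rest by metis
      qed
      with a show "Inv (Suc v) s'" unfolding Inv_def by (rule conjI)
    qed
  qed (use len in auto)
  show ?thesis
    unfolding column_def wp_Seq wp_IAssign
  proof (rule wp_mono[OF 1], elim conjE)
    fix t1 s1 assume t1: "t1 \<le> 100 * d" and Q0: "\<forall>i<2 * d. reals s1 ''Q'' i = 0"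
      and f1: "frame (For ''i'' two_d ?clear) s s1"
    let ?s2 = "set_int ''w'' (ival (IConst 0) s1) (ival (IConst 0) s1) s1"
    have C2: "row_cells d ?s2 = row_cells d s" using f1 by (intro row_cells_cong) (simp add: frame_def)
    have fx2: "ints ?s2 ''d'' 0 = d" "ints ?s2 ''j'' 0 = j" "ints ?s2 ''q'' 0 = q" "ints ?s2 ''D'' = ints s ''D''"
      using f1 d j q by (auto simp: frame_def)
    show "wp (For ''v'' ?bound sweep_step) (\<lambda>t. \<lambda>s'.
        1 + t1 + (1 + (1 + icost (IConst 0) + icost (IConst 0)) + (1 + t + (1 + icost (sv ''q'') + icost (sv ''w'')))) \<le> 1500 * m * d \<and>
        ints (set_int ''D'' (ival (sv ''q'') s') (ival (sv ''w'') s') s') ''D'' = (ints s ''D'')(q := length ?R) \<and>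
        (\<forall>v<length ?R. \<forall>i<2 * d. row_cells d (set_int ''D'' (ival (sv ''q'') s') (ival (sv ''w'') s') s') q v i =
           joined d A (?R ! v) i) \<and>
        (\<forall>p. p \<noteq> q \<longrightarrow> row_cells d (set_int ''D'' (ival (sv ''q'') s') (ival (sv ''w'') s') s') p = row_cells d s p)) ?s2"
    proof (rule wp_mono[OF 2[OF _ _ fx2 C2]], simp add: Q0, simp, elim conjE, intro conjI)
      fix t s3 assume t: "t \<le> m * (2 * (500 * d + icost ?bound + 12))" and inv: "Inv (length bs) s3"
        and f3: "frame (For ''v'' ?bound sweep_step) ?s2 s3"
      have "d \<le> m * d" "m \<le> m * d" "1 \<le> m * d" using d len by simp_all
      moreover have "t \<le> 1000 * (m * d) + 30 * m" using t by (simp add: algebra_simps)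
      ultimately have "t1 + t + 13 \<le> 1500 * (m * d)" using t1 by linarith
      then show "1 + t1 + (1 + (1 + icost (IConst 0) + icost (IConst 0)) + (1 + t + (1 + icost (sv ''q'') + icost (sv ''w'')))) \<le> 1500 * m * d"
        by (simp add: ac_simps)
      have fx3: "ints s3 ''q'' 0 = q" "ints s3 ''D'' = ints s ''D''" using f3 fx2 by (auto simp: frame_def)
      have C4: "row_cells d (set_int ''D'' a b s3) = row_cells d s3" for a b by (rule row_cells_cong) simp
      have o: "ints s3 ''w'' 0 = length ?R" "\<forall>u<length ?R. \<forall>i<2 * d. row_cells d s3 q u i = joined d A (?R ! u) i"
        and rest: "\<forall>p u. p \<noteq> q \<or> length bs \<le> u \<longrightarrow> row_cells d s3 p u = row_cells d s p u"
        using inv unfolding Inv_def by auto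
      show "ints (set_int ''D'' (ival (sv ''q'') s3) (ival (sv ''w'') s3) s3) ''D'' = (ints s ''D'')(q := length ?R)"
        using fx3 o(1) by simp
      show "\<forall>v<length ?R. \<forall>i<2 * d. row_cells d (set_int ''D'' (ival (sv ''q'') s3) (ival (sv ''w'') s3) s3) q v i =
           joined d A (?R ! v) i"
        unfolding C4 using o(2) .
      show "\<forall>p. p \<noteq> q \<longrightarrow> row_cells d (set_int ''D'' (ival (sv ''q'') s3) (ival (sv ''w'') s3) s3) p = row_cells d s p"
        unfolding C4 using rest by (auto simp: fun_eq_iff)
    qed
  qed
qed

definition kern :: com where
  "kern = Seq load (Seq (IAssign ''D'' (sv ''q'') (IGet ''D'' (sv ''p''))) (For ''j'' (sv ''d'') column))"

lemma writes_kern [simp]: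
  "int_writes kern = {''v'', ''j'', ''l'', ''D'', ''i'', ''w''}" "real_writes kern = {''B'', ''acc'', ''Q'', ''f''}" "\<not> emits kern"
  by (auto simp: kern_def)

lemma shifted_linear:
  "shifted d X c (f + g) = shifted d X c f + shifted d X c g"
  "shifted d X c (fun_scale a f) = fun_scale a (shifted d X c f)"
  "shifted d X c (f - fun_scale a g) i = shifted d X c f i - a * shifted d X c g i"
  "shifted d X c 0 i = 0"
  by (simp_all add: shifted_def fun_eq_iff fun_apply sum.distrib sum_subtractf sum_distrib_left algebra_simps)

lemma length_eliminate:
  assumes A: "\<And>f g. A (f + g) = A f + A g" "\<And>c f. A (fun_scale c f) = fun_scale c (A f)"
  shows "length (eliminate A k bs) \<le> length bs"
proof (induction k)
  case (Suc k)
  interpret functional "\<lambda>f. A f k" by unfold_locales (simp_all add: A fun_apply)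
  show ?case unfolding eliminate_Suc using length_sweep[of 0 "eliminate A k bs"] Suc by simp
qed simp

text \<open>The cost is proportional to the number of basis vectors, so the kernels of one level
  together cost a multiple of \<open>d ^ 3\<close>. Slots other than \<open>q\<close> keep their
  rows, which protects the rest of the stack.\<close>

lemma wp_kern:
  assumes d: "ints s ''d'' 0 = d" "1 \<le> d" and len: "ints s ''D'' (ints s ''p'' 0) = length bs" "1 \<le> length bs" "length bs \<le> d"
    and bs: "\<And>v i. v < length bs \<Longrightarrow> i < d \<Longrightarrow> row_cells d s (ints s ''p'' 0) v i = (bs ! v) i"
    and X: "\<And>i l. i < d \<Longrightarrow> l < d \<Longrightarrow> reals s ''X'' ((ints s ''k'' 0 * d + i) * d + l) = X i l"
    and q: "ints s ''q'' 0 = q"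
  defines "A \<equiv> shifted d X (reals s ''c'' 0)"
  shows "wp kern (\<lambda>t s'. t \<le> 7000 * length bs * d ^ 2 \<and>
    ints s' ''D'' = (ints s ''D'')(q := length (eliminate A d bs)) \<and>
    (\<forall>v<length (eliminate A d bs). \<forall>i<d. row_cells d s' q v i = (eliminate A d bs ! v) i) \<and>
    (\<forall>p. p \<noteq> q \<longrightarrow> row_cells d s' p = row_cells d s p)) s"
proof -
  define m where "m = length bs"
  have A: "A (f - fun_scale c g) i = A f i - c * A g i" "A 0 i = 0" "A (f + g) = A f + A g"
    "A (fun_scale c f) = fun_scale c (A f)" for f g c i
    by (simp_all add: A_def shifted_linear)
  define Inv where "Inv j s' \<longleftrightarrow> ints s' ''D'' = (ints s ''D'')(q := length (eliminate A j bs)) \<and>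
    (\<forall>v<length (eliminate A j bs). \<forall>i<2 * d. row_cells d s' q v i = joined d A (eliminate A j bs ! v) i) \<and>
    (\<forall>p. p \<noteq> q \<longrightarrow> row_cells d s' p = row_cells d s p)" for j s'
  have loop: "wp (For ''j'' (sv ''d'') column) (\<lambda>t s'. t \<le> d * (2 * (1500 * m * d + icost (sv ''d'') + 12)) \<and> Inv d s' \<and>
      frame (For ''j'' (sv ''d'') column) s2 s') s2"
    if "Inv 0 s2" "ints s2 ''d'' 0 = d" "ints s2 ''q'' 0 = q" for s2
  proof (rule wp_For[where Inv = Inv])
    show "ival (sv ''d'') s' = d" if "frame (For ''j'' (sv ''d'') column) s2 s'" for s'
      using that \<open>ints s2 ''d'' 0 = d\<close> by (simp add: frame_def)
    show "Inv i (set_int ''j'' 0 k s')" if "Inv i s'" for i k s'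
      using that row_cells_cong[of "set_int ''j'' 0 k s'" s' d] by (simp add: Inv_def)
    fix j s' assume j: "j < d" and inv: "Inv j s'" and jj: "ints s' ''j'' 0 = j" and f: "frame (For ''j'' (sv ''d'') column) s2 s'"
    let ?e = "eliminate A j bs"
    have fx: "ints s' ''d'' 0 = d" "ints s' ''q'' 0 = q" using f that by (auto simp: frame_def)
    have le: "length ?e \<le> length bs" using A by (intro length_eliminate)
    have "wp column (\<lambda>t s''. t \<le> 1500 * m * d \<and>
      ints s'' ''D'' = (ints s' ''D'')(q := length (sweep (\<lambda>f. A f j) 0 ?e)) \<and>
      (\<forall>v<length (sweep (\<lambda>f. A f j) 0 ?e). \<forall>i<2 * d. row_cells d s'' q v i = joined d A (sweep (\<lambda>f. A f j) 0 ?e ! v) i) \<and>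
      (\<forall>p. p \<noteq> q \<longrightarrow> row_cells d s'' p = row_cells d s' p)) s'"
    proof (rule wp_column[OF fx(1) d(2) j jj A(1,2) fx(2)])
      show "ints s' ''D'' q = length ?e" using inv by (simp add: Inv_def)
      show "row_cells d s' q v i = joined d A (?e ! v) i" if "v < length ?e" "i < 2 * d" for v i
        using inv that by (simp add: Inv_def)
    qed (use le len in \<open>simp_all add: m_def\<close>)
    then show "wp column (\<lambda>t s''. t \<le> 1500 * m * d \<and> Inv (Suc j) s'') s'"
      by (rule wp_mono) (use inv in \<open>simp add: Inv_def eliminate_Suc\<close>)
  qed (use that d in auto)
  show ?thesis
    unfolding kern_def wp_Seq wp_IAssign
  proof (rule wp_framed[OF wp_load[OF d len bs X]], assumption+, elim conjE)
    fix t1 s1 assume t1: "t1 \<le> 3000 * length bs * d\<^sup>2"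
      and C1: "row_cells d s1 = (\<lambda>p' v i. if p' = ints s ''q'' 0 \<and> v < length bs \<and> i < 2 * d
        then joined d (shifted d X (reals s ''c'' 0)) (bs ! v) i else row_cells d s p' v i)"
      and f1: "frame load s s1"
    let ?s2 = "set_int ''D'' (ival (sv ''q'') s1) (ival (IGet ''D'' (sv ''p'')) s1) s1"
    have fx: "ints s1 ''d'' 0 = d" "ints s1 ''q'' 0 = q" "ints s1 ''p'' 0 = ints s ''p'' 0" "ints s1 ''D'' = ints s ''D''"
      using f1 d q by (auto simp: frame_def)
    have C2: "row_cells d ?s2 = row_cells d s1" by (rule row_cells_cong) simp
    have "Inv 0 ?s2"
      unfolding Inv_def C2 unfolding C1 using fx len q by (simp add: A_def)
    then have w: "wp (For ''j'' (sv ''d'') column) (\<lambda>t s'. t \<le> d * (2 * (1500 * m * d + icost (sv ''d'') + 12)) \<and> Inv d s' \<and>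
      frame (For ''j'' (sv ''d'') column) ?s2 s') ?s2"
      using fx by (intro loop) simp_all
    show "wp (For ''j'' (sv ''d'') column) (\<lambda>t s'.
      1 + t1 + (1 + (1 + icost (sv ''q'') + icost (IGet ''D'' (sv ''p''))) + t) \<le> 7000 * length bs * d ^ 2 \<and>
      ints s' ''D'' = (ints s ''D'')(q := length (eliminate A d bs)) \<and>
      (\<forall>v<length (eliminate A d bs). \<forall>i<d. row_cells d s' q v i = (eliminate A d bs ! v) i) \<and>
      (\<forall>p. p \<noteq> q \<longrightarrow> row_cells d s' p = row_cells d s p)) ?s2"
    proof (rule wp_mono[OF w], elim conjE, intro conjI)
      fix t s' assume t: "t \<le> d * (2 * (1500 * m * d + icost (sv ''d'') + 12))" and inv: "Inv d s'"
      have "1 \<le> m" using len by (simp add: m_def)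
      then have "d \<le> m * d ^ 2" "1 \<le> m * d ^ 2" using d by (simp_all add: power2_eq_square)
      moreover have "t \<le> 3000 * (m * d ^ 2) + 28 * d" using t by (simp add: power2_eq_square algebra_simps)
      moreover have "t1 \<le> 3000 * (m * d ^ 2)" using t1 by (simp add: m_def ac_simps)
      ultimately have "t1 + t + 8 \<le> 7000 * (m * d ^ 2)" by linarith
      then show "1 + t1 + (1 + (1 + icost (sv ''q'') + icost (IGet ''D'' (sv ''p''))) + t) \<le> 7000 * length bs * d ^ 2"
        by (simp add: m_def ac_simps)
      show "ints s' ''D'' = (ints s ''D'')(q := length (eliminate A d bs))"
        "\<forall>p. p \<noteq> q \<longrightarrow> row_cells d s' p = row_cells d s p"
        "\<forall>v<length (eliminate A d bs). \<forall>i<d. row_cells d s' q v i = (eliminate A d bs ! v) i"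
        using inv by (auto simp: Inv_def joined_def)
    qed
  qed
qed

section \<open>The algorithm\<close>

text \<open>The recurrence \<open>X (k + 1) = s + s X k s\<close> for the simple transposition
  \<open>s\<close>, at the price of two matrix products per step; \<open>T\<close> holds the product
  \<open>s X k\<close>.\<close>

definition jm_program :: com where
  "jm_program = For ''m'' (ISub (sv ''n'') (IConst 1)) (Seq
     (mat_mult ''T'' (IConst 0) (RNat (IConst 0)) ''M'' (sv ''m'') ''X'' (sv ''m''))
     (mat_mult ''X'' (IAdd (sv ''m'') (IConst 1)) (RGet ''M'' (mat_index (sv ''m'') (sv ''i'') (sv ''j'')))
        ''T'' (IConst 0) ''M'' (sv ''m'')))"

lemma index_mult_square:
  fixes A B :: "real mat"
  assumes "A \<in> carrier_mat d d" "B \<in> carrier_mat d d" "i < d" "j < d"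
  shows "(A * B) $$ (i, j) = (\<Sum>l<d. A $$ (i, l) * B $$ (l, j))"
  using assms by (simp add: scalar_prod_def lessThan_atLeast0)

context orthogonal_rep
begin

definition jm :: "nat \<Rightarrow> nat \<Rightarrow> nat \<Rightarrow> real" where
  "jm k i j = (\<Sum>l\<in>{0<..<k}. rho (transpose l k) $$ (i, j))"

lemma JM_jm: "JM k f = (\<lambda>i. if i < d then \<Sum>j<d. jm k i j * f j else 0)"
proof
  fix i
  show "JM k f i = (if i < d then \<Sum>j<d. jm k i j * f j else 0)"
    by (simp add: JM_def sum_fun_apply mat_act_def jm_def sum_distrib_right sum.swap[of _ "{..<d}"])
qed

lemma shifted_jm:
  assumes "f \<in> V"
  shows "(\<forall>j<d. shifted d (jm k) c f j = 0) \<longleftrightarrow> JM k f = fun_scale c f"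
  using assms unfolding JM_jm by (auto simp: shifted_def fun_eq_iff fun_apply supp_space_def)

text \<open>Memory is initially zero, so the first matrix is correct without being written.\<close>

lemma jm_1: "jm (Suc 0) i j = 0"
proof -
  have "{0<..<Suc 0} = {}" by auto
  then show ?thesis unfolding jm_def by simp
qed

text \<open>Conjugation by the simple transposition carries \<open>(l k)\<close> to
  \<open>(l k+1)\<close> for every \<open>l\<close> below \<open>k\<close>; the remaining summand is
  the simple transposition itself.\<close>

lemma jm_Suc:
  assumes k: "k \<in> {1..n}" "Suc k \<in> {1..n}" and ij: "i < d" "j < d"
  defines "A \<equiv> rho (transpose k (Suc k))"
  shows "jm (Suc k) i j = A $$ (i, j) + (\<Sum>l<d. (\<Sum>m<d. A $$ (i, m) * jm k m l) * A $$ (l, j))"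
proof -
  let ?t = "transpose k (Suc k)"
  have t: "?t permutes {1..n}" using transpose_permutes k by blast
  have A: "A \<in> carrier_mat d d" unfolding A_def by (rule rho_carrier[OF t])
  have *: "rho (transpose l (Suc k)) $$ (i, j) =
      (\<Sum>q<d. (\<Sum>m<d. A $$ (i, m) * rho (transpose l k) $$ (m, q)) * A $$ (q, j))" if l: "l \<in> {0<..<k}" for l
  proof -
    have l1: "transpose l k permutes {1..n}" using transpose_permutes[of l k] l k by auto
    have B: "rho (transpose l k) \<in> carrier_mat d d" by (rule rho_carrier[OF l1])
    have tl: "?t l = l" using l by (intro transpose_apply_other) auto
    have "?t \<circ> transpose l k = transpose l (Suc k) \<circ> ?t"
      using comp_transpose[of ?t l k] tl by simp
    then have "transpose l (Suc k) = (?t \<circ> transpose l k) \<circ> ?t" by (simp add: comp_assoc)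
    then have "rho (transpose l (Suc k)) = (A * rho (transpose l k)) * A"
      using rho_mult[OF permutes_compose[OF l1 t] t] rho_mult[OF t l1] by (simp add: A_def)
    then show ?thesis
      using index_mult_square[OF mult_carrier_mat[OF A B] A ij] index_mult_square[OF A B ij(1)] by simp
  qed
  have "{0<..<Suc k} = insert k {0<..<k}" using k by auto
  then have "jm (Suc k) i j = A $$ (i, j) + (\<Sum>l\<in>{0<..<k}. rho (transpose l (Suc k)) $$ (i, j))"
    by (simp add: jm_def A_def)
  also have "(\<Sum>l\<in>{0<..<k}. rho (transpose l (Suc k)) $$ (i, j)) =
      (\<Sum>q<d. (\<Sum>m<d. A $$ (i, m) * jm k m q) * A $$ (q, j))"
    by (simp add: * jm_def sum_distrib_left sum_distrib_right sum.swap[of _ _ "{0<..<k}"])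
  finally show ?thesis .
qed

text \<open>Slot \<open>k\<close> belongs to the entry \<open>k + 1\<close>, so the sum of a
  composition is the index of the matrix that places its next entry.\<close>

definition jm_correct :: "state \<Rightarrow> bool" where
  "jm_correct s \<longleftrightarrow> (\<forall>k<n. \<forall>i<d. \<forall>j<d. reals s ''X'' ((k * d + i) * d + j) = jm (Suc k) i j)"

abbreviation start :: state where
  "start \<equiv> init_state n d (\<lambda>l. rho (transpose l (Suc l)))"

lemma start_M:
  assumes "m < n - 1" "i < d" "j < d"
  shows "reals start ''M'' ((m * d + i) * d + j) = rho (transpose (Suc m) (Suc (Suc m))) $$ (i, j)"
proof -
  have dm: "(a * k + b) div k = a" "(a * k + b) mod k = b" if "b < k" for a b k :: nat
    using that by simp_all
  have ij: "i * d + j < d * d"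
  proof -
    have "i * d + j < Suc i * d" using assms by simp
    also have "\<dots> \<le> d * d" using assms by (intro mult_le_mono1) simp
    finally show ?thesis .
  qed
  have e: "(m * d + i) * d + j = m * (d * d) + (i * d + j)" by (simp add: algebra_simps)
  have "m * (d * d) + (i * d + j) < Suc m * (d * d)" using ij by simp
  also have "\<dots> \<le> (n - 1) * (d * d)" using assms(1) by (intro mult_le_mono1) simp
  finally have "(m * d + i) * d + j < (n - 1) * d * d" by (simp add: e mult.assoc)
  moreover have "((m * d + i) * d + j) div (d * d) = m" "((m * d + i) * d + j) mod (d * d) = i * d + j"
    unfolding e using dm[OF ij] by simp_all
  moreover have "((m * d + i) * d + j) mod d = j" "(i * d + j) div d = i" using dm[OF assms(3)] by simp_all
  ultimately show ?thesis by (simp add: init_state_def)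
qed

lemma wp_jm_program:
  assumes nd: "1 \<le> n" "1 \<le> d"
  shows "wp jm_program (\<lambda>t s. t \<le> 10000 * n * d ^ 3 \<and> jm_correct s \<and> frame jm_program start s) start"
proof -
  let ?m1 = "mat_mult ''T'' (IConst 0) (RNat (IConst 0)) ''M'' (sv ''m'') ''X'' (sv ''m'')"
  let ?m2 = "mat_mult ''X'' (IAdd (sv ''m'') (IConst 1)) (RGet ''M'' (mat_index (sv ''m'') (sv ''i'') (sv ''j'')))
        ''T'' (IConst 0) ''M'' (sv ''m'')"
  let ?e = "ISub (sv ''n'') (IConst 1)"
  let ?p = "For ''m'' ?e (Seq ?m1 ?m2)"
  define Inv where "Inv m s \<longleftrightarrow> (\<forall>k\<le>m. \<forall>i<d. \<forall>j<d. reals s ''X'' ((k * d + i) * d + j) = jm (Suc k) i j)" for m and s :: state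
  have start_nd: "ints start ''n'' 0 = n" "ints start ''d'' 0 = d" by (simp_all add: init_state_def)
  have fixed: "ints s ''n'' 0 = n" "ints s ''d'' 0 = d" "reals s ''M'' = reals start ''M''" if "frame ?p start s" for s
    using that start_nd by (auto simp: frame_def)
  have "wp ?p (\<lambda>t s. t \<le> n * (2 * (4001 * d ^ 3 + icost ?e + 12)) \<and> Inv (n - 1) s \<and> frame ?p start s) start"
  proof (rule wp_For[where Inv = Inv])
    show "ival ?e s = n - 1" if "frame ?p start s" for s using fixed[OF that] by simp
    show "Inv 0 start" by (simp add: Inv_def jm_1 init_state_def)
    fix m s assume m: "m < n - 1" and inv: "Inv m s" and im: "ints s ''m'' 0 = m" and f: "frame ?p start s"
    note fx = fixed[OF f]
    have M: "reals s ''M'' ((m * d + i) * d + j) = rho (transpose (Suc m) (Suc (Suc m))) $$ (i, j)" if "i < d" "j < d" for i j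
      using start_M[OF m that] fx(3) by simp
    have 1: "wp ?m1 (\<lambda>t s'. t \<le> 2000 * d ^ 3 \<and>
      (\<forall>i<d. \<forall>j<d. reals s' ''T'' ((0 * d + i) * d + j) =
        0 + (\<Sum>l<d. reals s ''M'' ((m * d + i) * d + l) * reals s ''X'' ((m * d + l) * d + j))) \<and>
      (\<forall>p. (\<forall>i<d. \<forall>j<d. p \<noteq> (0 * d + i) * d + j) \<longrightarrow> reals s' ''T'' p = reals s ''T'' p)) s"
      by (rule wp_mat_mult[OF fx(2) nd(2)]) (auto simp: frame_def im)
    have 2: "wp ?m2 (\<lambda>t s'. t \<le> 2000 * d ^ 3 \<and>
      (\<forall>i<d. \<forall>j<d. reals s' ''X'' ((Suc m * d + i) * d + j) =
        reals s1 ''M'' ((m * d + i) * d + j) +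
        (\<Sum>l<d. reals s1 ''T'' ((0 * d + i) * d + l) * reals s1 ''M'' ((m * d + l) * d + j))) \<and>
      (\<forall>p. (\<forall>i<d. \<forall>j<d. p \<noteq> (Suc m * d + i) * d + j) \<longrightarrow> reals s' ''X'' p = reals s1 ''X'' p)) s1"
      if f1: "frame ?m1 s s1" for s1
    proof -
      have d1: "ints s1 ''d'' 0 = d" and m1: "ints s1 ''m'' 0 = m" using f1 fx im by (auto simp: frame_def)
      show ?thesis
        by (rule wp_mat_mult[OF d1 nd(2)]) (auto simp: frame_def m1 d1 ival_mat_index[of _ d] icost_mat_index)
    qed
    show "wp (Seq ?m1 ?m2) (\<lambda>t s'. t \<le> 4001 * d ^ 3 \<and> Inv (Suc m) s') s"
      unfolding wp_Seq
    proof (rule wp_framed[OF 1], elim conjE)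
      fix t1 :: nat and s1 :: state assume t1: "t1 \<le> 2000 * d ^ 3" and f1: "frame ?m1 s s1"
        and T: "\<forall>i<d. \<forall>j<d. reals s1 ''T'' ((0 * d + i) * d + j) =
          0 + (\<Sum>l<d. reals s ''M'' ((m * d + i) * d + l) * reals s ''X'' ((m * d + l) * d + j))"
      have fr: "reals s1 ''M'' = reals s ''M''" "reals s1 ''X'' = reals s ''X''" using f1 by (auto simp: frame_def)
      show "wp ?m2 (\<lambda>t2 s'. 1 + t1 + t2 \<le> 4001 * d ^ 3 \<and> Inv (Suc m) s') s1"
      proof (rule wp_mono[OF 2[OF f1]], elim conjE, intro conjI)
        fix t2 and s2 :: state assume t2: "t2 \<le> 2000 * d ^ 3"
          and X: "\<forall>i<d. \<forall>j<d. reals s2 ''X'' ((Suc m * d + i) * d + j) =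
            reals s1 ''M'' ((m * d + i) * d + j) +
            (\<Sum>l<d. reals s1 ''T'' ((0 * d + i) * d + l) * reals s1 ''M'' ((m * d + l) * d + j))"
          and rest: "\<forall>p. (\<forall>i<d. \<forall>j<d. p \<noteq> (Suc m * d + i) * d + j) \<longrightarrow> reals s2 ''X'' p = reals s1 ''X'' p"
        have "1 \<le> d ^ 3" using nd(2) by (rule one_le_power)
        then show "1 + t1 + t2 \<le> 4001 * d ^ 3" using t1 t2 by linarith
        show "Inv (Suc m) s2" unfolding Inv_def
        proof (intro allI impI)
          fix k i j assume k: "k \<le> Suc m" and ij: "i < d" "j < d"
          show "reals s2 ''X'' ((k * d + i) * d + j) = jm (Suc k) i j"
          proof (cases "k = Suc m")
            case True
            have Xm: "reals s ''X'' ((m * d + l) * d + q) = jm (Suc m) l q" if "l < d" "q < d" for l q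
              using inv that by (simp add: Inv_def)
            have "reals s1 ''T'' ((0 * d + i) * d + q) =
                (\<Sum>l<d. rho (transpose (Suc m) (Suc (Suc m))) $$ (i, l) * jm (Suc m) l q)" if "q < d" for q
              using T ij that M Xm by simp
            then have "reals s2 ''X'' ((Suc m * d + i) * d + j) = rho (transpose (Suc m) (Suc (Suc m))) $$ (i, j) +
              (\<Sum>q<d. (\<Sum>l<d. rho (transpose (Suc m) (Suc (Suc m))) $$ (i, l) * jm (Suc m) l q) *
                rho (transpose (Suc m) (Suc (Suc m))) $$ (q, j))"
              using X ij M fr by simp
            also have "\<dots> = jm (Suc (Suc m)) i j"
              using jm_Suc[of "Suc m" i j] m ij by simp
            finally show ?thesis using True by simp
          next
            case False
            then have "(k * d + i) * d + j \<noteq> (Suc m * d + i') * d + j'" if "i' < d" "j' < d" for i' j'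
              using mat_index_inj[of k d i j "Suc m" i' j'] ij that by blast
            then have "reals s2 ''X'' ((k * d + i) * d + j) = reals s ''X'' ((k * d + i) * d + j)"
              using rest fr by simp
            then show ?thesis using inv False k ij by (simp add: Inv_def)
          qed
        qed
      qed
    qed
  qed (use nd in \<open>auto simp: Inv_def\<close>)
  then show ?thesis
    unfolding jm_program_def
  proof (rule wp_mono, elim conjE, intro conjI)
    fix t s assume t: "t \<le> n * (2 * (4001 * d ^ 3 + icost ?e + 12))" and inv: "Inv (n - 1) s"
    have "2 * (4001 * x + icost ?e + 12) \<le> 10000 * x" if "1 \<le> x" for x using that by simp
    from this[of "d ^ 3"] have "2 * (4001 * d ^ 3 + icost ?e + 12) \<le> 10000 * d ^ 3" using nd(2) by simp
    then have "n * (2 * (4001 * d ^ 3 + icost ?e + 12)) \<le> n * (10000 * d ^ 3)" by (rule mult_le_mono2)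
    from le_trans[OF t this] show "t \<le> 10000 * n * d ^ 3" by (simp only: ac_simps)
    show "jm_correct s" using inv nd(1) by (auto simp: jm_correct_def Inv_def)
  qed assumption
qed

end

text \<open>The stack of the depth first search: slot \<open>p\<close> holds a composition with its sum in \<open>K\<close>, its
  length in \<open>R\<close>, its parts in \<open>P\<close>, and a basis of its joint eigenspace, of length \<open>D\<close>.\<close>

definition part_index :: "iexp \<Rightarrow> iexp \<Rightarrow> iexp" where
  "part_index p r = IAdd (IMul p (sv ''n'')) r"

text \<open>The content of the first cell of a new row is minus the number of rows above it. The sum
  of the parent is saved in \<open>k\<close>, because it selects the matrix for both
  children.\<close>

definition new_row_program :: com where
  "new_row_program =
     Seq (IAssign ''q'' (IConst 0) (IAdd (sv ''p'') (IConst 1)))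
     (Seq (IAssign ''k'' (IConst 0) (IGet ''K'' (sv ''p'')))
     (Seq (For ''r'' (IGet ''R'' (sv ''p''))
        (IAssign ''P'' (part_index (sv ''q'') (sv ''r'')) (IGet ''P'' (part_index (sv ''p'') (sv ''r'')))))
     (Seq (IAssign ''P'' (part_index (sv ''q'') (IGet ''R'' (sv ''p''))) (IConst 1))
     (Seq (IAssign ''R'' (sv ''q'') (IAdd (IGet ''R'' (sv ''p'')) (IConst 1)))
     (Seq (IAssign ''K'' (sv ''q'') (IAdd (sv ''k'') (IConst 1)))
        (RAssign ''c'' (IConst 0) (RSub (RNat (IConst 0)) (RNat (IGet ''R'' (sv ''p''))))))))))"

text \<open>Counted from zero, the appended cell has the old last part as its column and
  \<open>R - 1\<close> as its row; the difference is the new last part minus \<open>R\<close>. Shape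
  and sum are updated in place.\<close>

definition extend_program :: com where
  "extend_program =
     Seq (RAssign ''c'' (IConst 0) (RSub
       (RNat (IAdd (IGet ''P'' (part_index (sv ''p'') (ISub (IGet ''R'' (sv ''p'')) (IConst 1)))) (IConst 1)))
       (RNat (IGet ''R'' (sv ''p'')))))
     (Seq (IAssign ''P'' (part_index (sv ''p'') (ISub (IGet ''R'' (sv ''p'')) (IConst 1)))
       (IAdd (IGet ''P'' (part_index (sv ''p'') (ISub (IGet ''R'' (sv ''p'')) (IConst 1)))) (IConst 1)))
     (Seq (IAssign ''K'' (sv ''p'') (IAdd (sv ''k'') (IConst 1)))
       (IAssign ''q'' (IConst 0) (sv ''p''))))"

definition emit_program :: com where
  "emit_program = Seq (Emit (IGet ''R'' (sv ''p'')))
     (Seq (For ''r'' (IGet ''R'' (sv ''p'')) (Emit (IGet ''P'' (part_index (sv ''p'') (sv ''r'')))))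
       (Emit (IGet ''D'' (sv ''p''))))"

text \<open>The new row goes first: it needs the basis of the parent in slot \<open>p\<close>, which
  the extension then overwrites.\<close>

definition expand_program :: com where
  "expand_program = Seq new_row_program (Seq kern (Seq extend_program (Seq kern
     (IAssign ''N'' (IConst 0) (IAdd (sv ''p'') (IConst 2))))))"

lemma writes_programs [simp]:
  "int_writes new_row_program = {''q'', ''k'', ''r'', ''P'', ''R'', ''K''}" "real_writes new_row_program = {''c''}"
  "\<not> emits new_row_program"
  "int_writes extend_program = {''P'', ''K'', ''q''}" "real_writes extend_program = {''c''}" "\<not> emits extend_program"
  "int_writes emit_program = {''r''}" "real_writes emit_program = {}"
  by (auto simp: new_row_program_def extend_program_def emit_program_def)

section \<open>Effect and cost of the node operations\<close>

lemma wp_new_row_program: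
  assumes s: "ints s ''p'' 0 = p" "ints s ''n'' 0 = n" "1 \<le> n" and len: "ints s ''R'' p < n"
  shows "wp new_row_program (\<lambda>t s'. t \<le> 150 * n \<and> ints s' ''q'' 0 = Suc p \<and> ints s' ''k'' 0 = ints s ''K'' p \<and>
    reals s' ''c'' 0 = - real (ints s ''R'' p) \<and>
    ints s' ''K'' = (ints s ''K'')(Suc p := Suc (ints s ''K'' p)) \<and>
    ints s' ''R'' = (ints s ''R'')(Suc p := Suc (ints s ''R'' p)) \<and>
    (\<forall>r<ints s ''R'' p. ints s' ''P'' (Suc p * n + r) = ints s ''P'' (p * n + r)) \<and>
    ints s' ''P'' (Suc p * n + ints s ''R'' p) = 1 \<and>
    (\<forall>x<Suc p * n. ints s' ''P'' x = ints s ''P'' x)) s"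
proof -
  let ?L = "ints s ''R'' p"
  let ?s1 = "set_int ''q'' 0 (Suc p) s"
  let ?s2 = "set_int ''k'' 0 (ints s ''K'' p) ?s1"
  let ?c = "IAssign ''P'' (part_index (sv ''q'') (sv ''r'')) (IGet ''P'' (part_index (sv ''p'') (sv ''r'')))"
  let ?for = "For ''r'' (IGet ''R'' (sv ''p'')) ?c"
  have loop: "wp ?for (\<lambda>t s'. t \<le> n * (2 * (20 + icost (IGet ''R'' (sv ''p'')) + 12)) \<and>
     ((\<forall>r<?L. ints s' ''P'' (Suc p * n + r) = ints s ''P'' (p * n + r)) \<and> (\<forall>x<Suc p * n. ints s' ''P'' x = ints s ''P'' x)) \<and>
     frame ?for ?s2 s') ?s2"
  proof (rule wp_For[where Inv = "\<lambda>i s'. (\<forall>r<i. ints s' ''P'' (Suc p * n + r) = ints s ''P'' (p * n + r)) \<and>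
      (\<forall>x<Suc p * n. ints s' ''P'' x = ints s ''P'' x)"])
    show "ival (IGet ''R'' (sv ''p'')) s' = ?L" if "frame ?for ?s2 s'" for s'
      using that s by (simp add: frame_def)
    fix i s' assume i: "i < ?L" and inv: "(\<forall>r<i. ints s' ''P'' (Suc p * n + r) = ints s ''P'' (p * n + r)) \<and>
      (\<forall>x<Suc p * n. ints s' ''P'' x = ints s ''P'' x)" and r: "ints s' ''r'' 0 = i" and f: "frame ?for ?s2 s'"
    have fx: "ints s' ''p'' 0 = p" "ints s' ''n'' 0 = n" "ints s' ''q'' 0 = Suc p"
      using f s by (simp_all add: frame_def)
    have "p * n + i < Suc p * n" using i len by simp
    then have "ints s' ''P'' (p * n + i) = ints s ''P'' (p * n + i)" using inv by blast
    then show "wp ?c (\<lambda>t s''. t \<le> 20 \<and> (\<forall>r<Suc i. ints s'' ''P'' (Suc p * n + r) = ints s ''P'' (p * n + r)) \<and>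
      (\<forall>x<Suc p * n. ints s'' ''P'' x = ints s ''P'' x)) s'"
      using inv fx r by (simp add: wp_simps part_index_def less_Suc_eq)
  qed (use s len in auto)
  have s2: "set_int ''k'' (ival (IConst 0) ?s1) (ival (IGet ''K'' (sv ''p'')) ?s1) ?s1 = ?s2" using s by simp
  have s1: "set_int ''q'' (ival (IConst 0) s) (ival (IAdd (sv ''p'') (IConst 1)) s) s = ?s1" using s by simp
  show ?thesis
    unfolding new_row_program_def wp_Seq[of "IAssign _ _ _"] wp_IAssign s1 s2 wp_Seq[of ?for]
  proof (rule wp_mono[OF loop], elim conjE, goal_cases)
    case (1 t s3)
    have fx: "ints s3 ''p'' 0 = p" "ints s3 ''n'' 0 = n" "ints s3 ''q'' 0 = Suc p" "ints s3 ''k'' 0 = ints s ''K'' p"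
      "ints s3 ''K'' = ints s ''K''" "ints s3 ''R'' = ints s ''R''"
      using 1 s by (auto simp: frame_def)
    have "t + 60 \<le> 150 * n" using 1(1) s(3) by simp
    then show ?case
      using fx 1(2-) by (simp add: wp_simps part_index_def)
  qed
qed

lemma wp_extend_program:
  assumes s: "ints s ''p'' 0 = p" "ints s ''n'' 0 = n"
  shows "wp extend_program (\<lambda>t s'. t \<le> 70 \<and> ints s' ''q'' 0 = p \<and>
    reals s' ''c'' 0 = real (Suc (ints s ''P'' (p * n + (ints s ''R'' p - 1)))) - real (ints s ''R'' p) \<and>
    ints s' ''K'' = (ints s ''K'')(p := Suc (ints s ''k'' 0)) \<and>
    ints s' ''P'' = (ints s ''P'')(p * n + (ints s ''R'' p - 1) := Suc (ints s ''P'' (p * n + (ints s ''R'' p - 1))))) s"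
  using s by (simp add: extend_program_def wp_simps part_index_def)

lemma wp_emit_program:
  assumes s: "ints s ''p'' 0 = p" "ints s ''n'' 0 = n" "1 \<le> n" and mu: "ints s ''R'' p = length mu" "length mu \<le> n"
    "\<And>r. r < length mu \<Longrightarrow> ints s ''P'' (p * n + r) = mu ! r"
  shows "wp emit_program (\<lambda>t s'. t \<le> 100 * n \<and> outp s' = outp s @ encode [(mu, ints s ''D'' p)]) s"
proof -
  let ?s1 = "s\<lparr>outp := outp s @ [ival (IGet ''R'' (sv ''p'')) s]\<rparr>"
  let ?c = "Emit (IGet ''P'' (part_index (sv ''p'') (sv ''r'')))"
  let ?for = "For ''r'' (IGet ''R'' (sv ''p'')) ?c"
  have loop: "wp ?for (\<lambda>t s'. t \<le> n * (2 * (15 + icost (IGet ''R'' (sv ''p'')) + 12)) \<and>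
     outp s' = outp s @ [length mu] @ take (length mu) mu \<and> frame ?for ?s1 s') ?s1"
  proof (rule wp_For[where Inv = "\<lambda>i s'. outp s' = outp s @ [length mu] @ take i mu"])
    show "ival (IGet ''R'' (sv ''p'')) s' = length mu" if "frame ?for ?s1 s'" for s'
      using that s mu by (simp add: frame_def)
    fix i s' assume i: "i < length mu" and inv: "outp s' = outp s @ [length mu] @ take i mu"
      and r: "ints s' ''r'' 0 = i" and f: "frame ?for ?s1 s'"
    have fx: "ints s' ''p'' 0 = p" "ints s' ''n'' 0 = n" "ints s' ''P'' = ints s ''P''"
      using f s by (simp_all add: frame_def)
    then show "wp ?c (\<lambda>t s''. t \<le> 15 \<and> outp s'' = outp s @ [length mu] @ take (Suc i) mu) s'"
      using inv r mu(3)[OF i] i by (simp add: wp_simps part_index_def take_Suc_conv_app_nth)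
  qed (use s mu in auto)
  show ?thesis
    unfolding emit_program_def wp_Seq wp_Emit
  proof (rule wp_mono[OF loop], elim conjE)
    fix t s2 assume t: "t \<le> n * (2 * (15 + icost (IGet ''R'' (sv ''p'')) + 12))"
      and o: "outp s2 = outp s @ [length mu] @ take (length mu) mu" and f: "frame ?for ?s1 s2"
    have fx: "ints s2 ''p'' 0 = p" "ints s2 ''D'' = ints s ''D''" using f s by (simp_all add: frame_def)
    have "t + 20 \<le> 100 * n" using t s(3) by simp
    then show "1 + (1 + icost (IGet ''R'' (sv ''p''))) + (1 + t + (1 + icost (IGet ''D'' (sv ''p'')))) \<le> 100 * n \<and>
      outp (s2\<lparr>outp := outp s2 @ [ival (IGet ''D'' (sv ''p'')) s2]\<rparr>) = outp s @ encode [(mu, ints s ''D'' p)]"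
      using o fx by (simp add: encode_def)
  qed
qed

context orthogonal_rep
begin

definition node_ok :: "nat list \<times> (nat \<Rightarrow> real) list \<Rightarrow> bool" where
  "node_ok x \<longleftrightarrow> (case x of (mu, bs) \<Rightarrow>
     mu \<noteq> [] \<and> (\<forall>x\<in>set mu. 0 < x) \<and> sum_list mu \<le> n \<and> spans bs (W mu))"

definition slot_ok :: "state \<Rightarrow> nat \<Rightarrow> nat list \<times> (nat \<Rightarrow> real) list \<Rightarrow> bool" where
  "slot_ok s i x \<longleftrightarrow> (case x of (mu, bs) \<Rightarrow>
     ints s ''K'' i = sum_list mu \<and> ints s ''R'' i = length mu \<and> ints s ''D'' i = length bs \<and>
     (\<forall>r<length mu. ints s ''P'' (i * n + r) = mu ! r) \<and>
     (\<forall>v<length bs. \<forall>x<d. row_cells d s i v x = (bs ! v) x))"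

text \<open>Parts are compared at the \<open>n\<close> positions belonging to the slot, which is
  enough because a composition of a number up to \<open>n\<close> has at most \<open>n\<close>
  parts.\<close>

definition same_slot :: "state \<Rightarrow> state \<Rightarrow> nat \<Rightarrow> bool" where
  "same_slot s s' i \<longleftrightarrow> ints s' ''K'' i = ints s ''K'' i \<and> ints s' ''R'' i = ints s ''R'' i \<and>
     ints s' ''D'' i = ints s ''D'' i \<and> (\<forall>r<n. ints s' ''P'' (i * n + r) = ints s ''P'' (i * n + r)) \<and>
     row_cells d s' i = row_cells d s i"

lemma length_le_sum: "\<forall>x\<in>set mu. 0 < x \<Longrightarrow> length mu \<le> sum_list mu" for mu :: "nat list"
  by (induction mu) (auto simp: Suc_le_eq add_strict_increasing)

lemma node_okD:
  assumes "node_ok (mu, bs)"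
  shows "mu \<noteq> []" "\<forall>x\<in>set mu. 0 < x" "sum_list mu \<le> n" "spans bs (W mu)" "length mu \<le> n" "length bs \<le> d"
proof -
  show 1: "mu \<noteq> []" "\<forall>x\<in>set mu. 0 < x" "sum_list mu \<le> n" "spans bs (W mu)" using assms by (auto simp: node_ok_def)
  show "length mu \<le> n" using length_le_sum[OF 1(2)] 1(3) by simp
  have "fun_space.dim (W mu) \<le> fun_space.dim V" by (rule dim_mono[OF finite_I subset_refl W_subset_V])
  then show "length bs \<le> d" using 1(4) dim_supp_space[OF finite_I] by (simp add: spans_def)
qed

lemma slot_ok_same: "same_slot s s' i \<Longrightarrow> length (fst x) \<le> n \<Longrightarrow> slot_ok s i x \<Longrightarrow> slot_ok s' i x"
  by (cases x) (auto simp: slot_ok_def same_slot_def)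

lemma spans_child:
  assumes bs: "spans bs (W mu)"
  shows "spans (eliminate (shifted d (jm k) c) d bs) {f \<in> W mu. JM k f = fun_scale c f}"
proof -
  have "{f \<in> W mu. JM k f = fun_scale c f} = {f \<in> W mu. \<forall>j<d. shifted d (jm k) c f j = 0}"
    using shifted_jm W_subset_V by blast
  then show ?thesis using spans_eliminate[OF finite_I W_subset_V bs, of "shifted d (jm k) c"] by (simp add: shifted_linear)
qed

text \<open>The cost is that of two kernels and of copying fewer than \<open>n\<close> parts. The
  copying can be charged to the basis vectors, as \<open>length bs * n\<close>, because there is at
  least one of them.\<close>

lemma wp_expand_program:
  assumes s: "ints s ''p'' 0 = p" "ints s ''n'' 0 = n" "ints s ''d'' 0 = d" and nd: "1 \<le> n" "1 \<le> d"
    and jm: "jm_correct s" and node: "node_ok (mu, bs)" and slot: "slot_ok s p (mu, bs)"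
    and lt: "sum_list mu < n" and ne: "1 \<le> length bs"
  shows "wp expand_program (\<lambda>t s'. t \<le> 15000 * (length bs * (d ^ 2 + n)) \<and> ints s' ''N'' 0 = p + 2 \<and>
    (\<exists>bs1 bs2. node_ok (mu @ [1], bs1) \<and> node_ok (extend mu, bs2) \<and> slot_ok s' (Suc p) (mu @ [1], bs1) \<and>
       slot_ok s' p (extend mu, bs2) \<and> length bs1 + length bs2 \<le> length bs) \<and> (\<forall>i<p. same_slot s s' i)) s"
proof -
  note nk = node_okD[OF node]
  define k where "k = sum_list mu"
  define c1 where "c1 = - real (length mu)"
  define c2 where "c2 = real (Suc (last mu)) - real (length mu)"
  define bs1 where "bs1 = eliminate (shifted d (jm (Suc k)) c1) d bs"
  define bs2 where "bs2 = eliminate (shifted d (jm (Suc k)) c2) d bs"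
  have W1: "spans bs1 (W (mu @ [1]))" and W2: "spans bs2 (W (extend mu))"
    using spans_child[OF nk(4)] unfolding bs1_def bs2_def c1_def c2_def k_def W_new_row W_extend[OF nk(1)] by blast+
  have node1: "node_ok (mu @ [1], bs1)" using nk lt W1 by (auto simp: node_ok_def)
  have node2: "node_ok (extend mu, bs2)"
    using nk lt W2 extend_not_Nil extend_pos[OF nk(2)] sum_list_extend[OF nk(1)] by (simp add: node_ok_def)
  have "W (mu @ [1]) \<subseteq> W mu" "W (extend mu) \<subseteq> W mu" unfolding W_new_row W_extend[OF nk(1)] by auto
  then have dims: "length bs1 + length bs2 \<le> length bs"
    using dim_disjoint_sum[OF finite_I W_subset_V _ _ subspace_W subspace_W W_disjoint[OF nk(1)]] W1 W2 nk(4)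
    by (simp add: spans_def)
  have sl: "ints s ''K'' p = k" "ints s ''R'' p = length mu" "ints s ''D'' p = length bs"
    "\<And>r. r < length mu \<Longrightarrow> ints s ''P'' (p * n + r) = mu ! r"
    "\<And>v x. v < length bs \<Longrightarrow> x < d \<Longrightarrow> row_cells d s p v x = (bs ! v) x"
    using slot by (auto simp: slot_ok_def k_def)
  have lm: "length mu < n" using length_le_sum[OF nk(2)] lt by simp
  have jmX: "reals s ''X'' ((k * d + i) * d + l) = jm (Suc k) i l" if "i < d" "l < d" for i l
    using jm lt that by (simp add: jm_correct_def k_def)
  have lastmu: "mu ! (length mu - 1) = last mu" using nk(1) by (simp add: last_conv_nth)
  have len1: "length mu - 1 < length mu" using nk(1) by simp
  define Post where "Post t s' \<longleftrightarrow> t \<le> 15000 * (length bs * (d ^ 2 + n)) \<and> ints s' ''N'' 0 = p + 2 \<and>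
    (\<exists>bs1 bs2. node_ok (mu @ [1], bs1) \<and> node_ok (extend mu, bs2) \<and> slot_ok s' (Suc p) (mu @ [1], bs1) \<and>
       slot_ok s' p (extend mu, bs2) \<and> length bs1 + length bs2 \<le> length bs) \<and> (\<forall>i<p. same_slot s s' i)" for t s'
  let ?last = "IAssign ''N'' (IConst 0) (IAdd (sv ''p'') (IConst 2))"
  have "wp expand_program Post s"
    unfolding expand_program_def wp_Seq
  proof (rule wp_framed[OF wp_new_row_program[OF s(1,2) nd(1)]], simp add: sl lm, elim conjE, unfold sl)
    fix t1 :: nat and s1 :: state assume t1: "t1 \<le> 150 * n" and f1: "frame new_row_program s s1"
      and q1: "ints s1 ''q'' 0 = Suc p" "ints s1 ''k'' 0 = k" "reals s1 ''c'' 0 = - real (length mu)"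
      and K1: "ints s1 ''K'' = (ints s ''K'')(Suc p := Suc k)"
      and R1: "ints s1 ''R'' = (ints s ''R'')(Suc p := Suc (length mu))"
      and P1: "\<forall>r<length mu. ints s1 ''P'' (Suc p * n + r) = ints s ''P'' (p * n + r)"
        "ints s1 ''P'' (Suc p * n + length mu) = 1" "\<forall>x<Suc p * n. ints s1 ''P'' x = ints s ''P'' x"
    have fx1: "ints s1 ''p'' 0 = p" "ints s1 ''n'' 0 = n" "ints s1 ''d'' 0 = d" "ints s1 ''D'' = ints s ''D''"
      "reals s1 ''X'' = reals s ''X''" using f1 s by (auto simp: frame_def)
    have C1: "row_cells d s1 = row_cells d s" using f1 by (intro row_cells_cong) (simp add: frame_def)
    have kern1: "wp kern (\<lambda>t s2. t \<le> 7000 * length bs * d ^ 2 \<and> ints s2 ''D'' = (ints s1 ''D'')(Suc p := length bs1) \<and>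
       (\<forall>v<length bs1. \<forall>i<d. row_cells d s2 (Suc p) v i = (bs1 ! v) i) \<and>
       (\<forall>p'. p' \<noteq> Suc p \<longrightarrow> row_cells d s2 p' = row_cells d s1 p')) s1"
      unfolding bs1_def c1_def q1(3)[symmetric]
      by (rule wp_kern[OF fx1(3) nd(2) _ ne nk(6) _ _ q1(1)]) (use fx1 q1 sl jmX C1 in simp_all)
    show "wp kern (\<lambda>t2. wp extend_program (\<lambda>t3. wp kern (\<lambda>t4. wp ?last (\<lambda>t5. Post (1 + t1 + (1 + t2 + (1 + t3 + (1 + t4 + t5)))))))) s1"
    proof (rule wp_framed[OF kern1], elim conjE)
      fix t2 :: nat and s2 :: state assume t2: "t2 \<le> 7000 * length bs * d ^ 2" and f2: "frame kern s1 s2"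
        and D2: "ints s2 ''D'' = (ints s1 ''D'')(Suc p := length bs1)"
        and B2: "\<forall>v<length bs1. \<forall>i<d. row_cells d s2 (Suc p) v i = (bs1 ! v) i"
          "\<forall>p'. p' \<noteq> Suc p \<longrightarrow> row_cells d s2 p' = row_cells d s1 p'"
      have fx2: "ints s2 ''p'' 0 = p" "ints s2 ''n'' 0 = n" "ints s2 ''d'' 0 = d" "ints s2 ''k'' 0 = k"
        "ints s2 ''K'' = ints s1 ''K''" "ints s2 ''R'' = ints s1 ''R''" "ints s2 ''P'' = ints s1 ''P''"
        "reals s2 ''X'' = reals s ''X''" using f2 fx1 q1 by (auto simp: frame_def)
      have R2: "ints s2 ''R'' p = length mu" using fx2 R1 sl by simp
      have ixp: "p * n + (length mu - 1) < Suc p * n" using lm by simp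
      have P2: "ints s2 ''P'' (p * n + (length mu - 1)) = last mu"
        using fx2(7) P1(3) ixp sl(4)[OF len1] lastmu by simp
      note ext = wp_extend_program[OF fx2(1,2), unfolded R2 P2]
      show "wp extend_program (\<lambda>t3. wp kern (\<lambda>t4. wp ?last (\<lambda>t5. Post (1 + t1 + (1 + t2 + (1 + t3 + (1 + t4 + t5))))))) s2"
      proof (rule wp_framed[OF ext], elim conjE)
        fix t3 :: nat and s3 :: state assume t3: "t3 \<le> 70" and f3: "frame extend_program s2 s3" and q3: "ints s3 ''q'' 0 = p"
          and c3: "reals s3 ''c'' 0 = real (Suc (last mu)) - real (length mu)"
          and K3: "ints s3 ''K'' = (ints s2 ''K'')(p := Suc (ints s2 ''k'' 0))"
          and P3: "ints s3 ''P'' = (ints s2 ''P'')(p * n + (length mu - 1) := Suc (last mu))"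
        have fx3: "ints s3 ''p'' 0 = p" "ints s3 ''n'' 0 = n" "ints s3 ''d'' 0 = d" "ints s3 ''k'' 0 = k"
          "ints s3 ''R'' = ints s2 ''R''" "ints s3 ''D'' = ints s2 ''D''" "reals s3 ''X'' = reals s ''X''"
          using f3 fx2 by (auto simp: frame_def)
        have C3: "row_cells d s3 = row_cells d s2" using f3 by (intro row_cells_cong) (simp add: frame_def)
        \<comment> \<open>Slot \<open>p\<close> still holds the basis of the parent, since the first
          kernel wrote only slot \<open>p + 1\<close>.\<close>
        have kern2: "wp kern (\<lambda>t s4. t \<le> 7000 * length bs * d ^ 2 \<and> ints s4 ''D'' = (ints s3 ''D'')(p := length bs2) \<and>
           (\<forall>v<length bs2. \<forall>i<d. row_cells d s4 p v i = (bs2 ! v) i) \<and>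
           (\<forall>p'. p' \<noteq> p \<longrightarrow> row_cells d s4 p' = row_cells d s3 p')) s3"
          unfolding bs2_def c2_def c3[symmetric]
          by (rule wp_kern[OF fx3(3) nd(2) _ ne nk(6) _ _ q3]) (use fx3 fx1 D2 sl jmX C1 B2 C3 in simp_all)
        show "wp kern (\<lambda>t4. wp ?last (\<lambda>t5. Post (1 + t1 + (1 + t2 + (1 + t3 + (1 + t4 + t5)))))) s3"
        proof (rule wp_framed[OF kern2], elim conjE, unfold wp_IAssign)
          fix t4 :: nat and s4 :: state assume t4: "t4 \<le> 7000 * length bs * d ^ 2" and f4: "frame kern s3 s4"
            and D4: "ints s4 ''D'' = (ints s3 ''D'')(p := length bs2)"
            and B4: "\<forall>v<length bs2. \<forall>i<d. row_cells d s4 p v i = (bs2 ! v) i"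
              "\<forall>p'. p' \<noteq> p \<longrightarrow> row_cells d s4 p' = row_cells d s3 p'"
          let ?s5 = "set_int ''N'' (ival (IConst 0) s4) (ival (IAdd (sv ''p'') (IConst 2)) s4) s4"
          have fx4: "ints s4 ''p'' 0 = p" "ints s4 ''K'' = ints s3 ''K''" "ints s4 ''R'' = ints s3 ''R''"
            "ints s4 ''P'' = ints s3 ''P''" using f4 fx3 by (auto simp: frame_def)
          have C5: "row_cells d ?s5 = row_cells d s4" by (rule row_cells_cong) simp
          have K5: "ints ?s5 ''K'' = (ints s ''K'')(Suc p := Suc k, p := Suc k)" using fx4 K3 fx2 K1 by simp
          have R5: "ints ?s5 ''R'' = (ints s ''R'')(Suc p := Suc (length mu))" using fx4 fx3 fx2 R1 by simp
          have D5: "ints ?s5 ''D'' = (ints s ''D'')(Suc p := length bs1, p := length bs2)" using D4 fx3 D2 fx1 by simp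
          have P5: "ints ?s5 ''P'' = (ints s1 ''P'')(p * n + (length mu - 1) := Suc (last mu))" using fx4 P3 fx2 by simp
          \<comment> \<open>Slots are \<open>n\<close> wide, so enlarging the last part in slot
            \<open>p\<close> does not reach slot \<open>p + 1\<close>.\<close>
          have ixq: "Suc p * n + r \<noteq> p * n + (length mu - 1)" for r using ixp by linarith
          have slot1: "slot_ok ?s5 (Suc p) (mu @ [1], bs1)"
            unfolding slot_ok_def
          proof (simp only: prod.case, intro conjI allI impI)
            show "ints ?s5 ''P'' (Suc p * n + r) = (mu @ [1]) ! r" if "r < length (mu @ [1])" for r
              using that P1(1,2) sl(4) ixq[of r] unfolding P5 by (auto simp: nth_append less_Suc_eq)
            show "row_cells d ?s5 (Suc p) v x = (bs1 ! v) x" if "v < length bs1" "x < d" for v x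
              using that C5 B4(2) C3 B2(1) by simp
            show "ints ?s5 ''K'' (Suc p) = sum_list (mu @ [1])" unfolding K5 by (simp add: k_def)
            show "ints ?s5 ''R'' (Suc p) = length (mu @ [1])" unfolding R5 by simp
            show "ints ?s5 ''D'' (Suc p) = length bs1" unfolding D5 by simp
          qed
          have slot2: "slot_ok ?s5 p (extend mu, bs2)"
            unfolding slot_ok_def
          proof (simp only: prod.case, intro conjI allI impI)
            show "ints ?s5 ''P'' (p * n + r) = extend mu ! r" if r: "r < length (extend mu)" for r
            proof -
              have rm: "r < length mu" using r length_extend[OF nk(1)] by simp
              show ?thesis
              proof (cases "r = length mu - 1")
                case True
                then show ?thesis unfolding P5 by (simp add: extend_def nth_append)
              next
                case False
                have "p * n + r < Suc p * n" using rm lm by simp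
                then have "ints s1 ''P'' (p * n + r) = mu ! r" using P1(3) sl(4)[OF rm] by simp
                moreover have "r < length mu - 1" using False rm by simp
                then have "extend mu ! r = mu ! r" by (simp add: extend_def nth_append nth_butlast)
                moreover have "p * n + r \<noteq> p * n + (length mu - 1)" using False by simp
                ultimately show ?thesis unfolding P5 by simp
              qed
            qed
            show "row_cells d ?s5 p v x = (bs2 ! v) x" if "v < length bs2" "x < d" for v x
              using that C5 B4(1) by simp
            show "ints ?s5 ''K'' p = sum_list (extend mu)" unfolding K5 using sum_list_extend[OF nk(1)] by (simp add: k_def)
            show "ints ?s5 ''R'' p = length (extend mu)" unfolding R5 using length_extend[OF nk(1)] sl by simp
            show "ints ?s5 ''D'' p = length bs2" unfolding D5 by simp
          qed
          have same: "same_slot s ?s5 i" if i: "i < p" for i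
            unfolding same_slot_def
          proof (intro conjI allI impI)
            show "ints ?s5 ''K'' i = ints s ''K'' i" unfolding K5 using i by simp
            show "ints ?s5 ''R'' i = ints s ''R'' i" unfolding R5 using i by simp
            show "ints ?s5 ''D'' i = ints s ''D'' i" unfolding D5 using i by simp
            show "row_cells d ?s5 i = row_cells d s i" using i C5 B4(2) C3 B2(2) C1 by simp
            fix r assume "r < n"
            then have "i * n + r < Suc i * n" by simp
            also have "\<dots> \<le> p * n" using i by (intro mult_le_mono1) simp
            finally have lt: "i * n + r < p * n" .
            then have "i * n + r < Suc p * n" by simp
            then show "ints ?s5 ''P'' (i * n + r) = ints s ''P'' (i * n + r)" unfolding P5 using lt P1(3) by simp
          qed
          have time: "1 + t1 + (1 + t2 + (1 + t3 + (1 + t4 +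
              (1 + icost (IConst 0) + icost (IAdd (sv ''p'') (IConst 2)))))) \<le> 15000 * (length bs * (d ^ 2 + n))"
          proof -
            define a where "a = length bs * d ^ 2"
            define b where "b = length bs * n"
            have "n \<le> b" "1 \<le> b" using ne nd by (simp_all add: b_def)
            moreover have "t2 \<le> 7000 * a" "t4 \<le> 7000 * a" using t2 t4 by (simp_all add: a_def mult.assoc)
            moreover from calculation have "t1 + t3 + 20 \<le> 15000 * b" using t1 t3 by simp
            ultimately have "t1 + t2 + t3 + t4 + 20 \<le> 15000 * (a + b)" by simp
            then show ?thesis by (simp add: a_def b_def distrib_left)
          qed
          show "Post (1 + t1 + (1 + t2 + (1 + t3 + (1 + t4 +
              (1 + icost (IConst 0) + icost (IAdd (sv ''p'') (IConst 2))))))) ?s5"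
            unfolding Post_def
            using time node1 node2 slot1 slot2 dims same fx4(1) by (intro conjI exI[of _ bs1] exI[of _ bs2]) simp_all
        qed
      qed
    qed
  qed
  then show ?thesis by (rule wp_mono) (simp add: Post_def)
qed

end

section \<open>The search loop and its potential\<close>

definition step_program :: com where
  "step_program = Seq (IAssign ''N'' (IConst 0) (ISub (sv ''N'') (IConst 1))) (Seq (IAssign ''p'' (IConst 0) (sv ''N''))
     (If (IEq (IGet ''D'' (sv ''p'')) (IConst 0)) Skip
       (If (IEq (IGet ''K'' (sv ''p'')) (sv ''n'')) emit_program expand_program)))"

definition init_program :: com where
  "init_program = Seq (IAssign ''K'' (IConst 0) (IConst 1)) (Seq (IAssign ''R'' (IConst 0) (IConst 1))
     (Seq (IAssign ''P'' (IConst 0) (IConst 1)) (Seq (IAssign ''D'' (IConst 0) (sv ''d''))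
     (Seq (IAssign ''N'' (IConst 0) (IConst 1))
       (For ''i'' (sv ''d'') (RAssign ''B'' (addr (IConst 0) (sv ''i'') (sv ''i'')) (RNat (IConst 1))))))))"

definition algorithm :: com where
  "algorithm = Seq jm_program (Seq init_program (While (ILess (IConst 0) (sv ''N'')) step_program))"

lemma encode_append: "encode (xs @ ys) = encode xs @ encode ys"
  by (simp add: encode_def)

context orthogonal_rep
begin

definition item_leaves :: "nat list \<times> (nat \<Rightarrow> real) list \<Rightarrow> (nat list \<times> nat) list" where
  "item_leaves x = leaves (n - sum_list (fst x)) (fst x)"

text \<open>Each basis vector pays once for every level from the present one to the leaves
  inclusive, and the constant pays for popping the node. The children have in total no more vectors
  and one level less, so one full share of the parent is set free for its expansion.\<close>

definition weight :: "nat list \<times> (nat \<Rightarrow> real) list \<Rightarrow> nat" where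
  "weight x = (Suc n - sum_list (fst x)) * (length (snd x) * (20000 * (d ^ 2 + n))) + 100"

definition potential :: "(nat list \<times> (nat \<Rightarrow> real) list) list \<Rightarrow> nat" where
  "potential st = sum_list (map weight st)"

text \<open>The output so far, followed by what the nodes on the stack will print, is constant. The
  top of the stack is the end of the list, hence \<open>rev\<close>.\<close>

definition stack_ok :: "(nat list \<times> (nat \<Rightarrow> real) list) list \<Rightarrow> state \<Rightarrow> bool" where
  "stack_ok st s \<longleftrightarrow> ints s ''n'' 0 = n \<and> ints s ''d'' 0 = d \<and> ints s ''N'' 0 = length st \<and> jm_correct s \<and>
     (\<forall>i<length st. node_ok (st ! i) \<and> slot_ok s i (st ! i)) \<and>
     outp s @ encode (concat (map item_leaves (rev st))) = encode (leaves (n - 1) [1])"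

lemma wp_step_program:
  assumes nd: "1 \<le> n" "1 \<le> d" and inv: "stack_ok st s" and b: "bval (ILess (IConst 0) (sv ''N'')) s"
  shows "wp step_program (\<lambda>t s'. \<exists>st'. stack_ok st' s' \<and>
    1 + bcost (ILess (IConst 0) (sv ''N'')) + t + potential st' \<le> potential st) s"
proof -
  have i: "ints s ''n'' 0 = n" "ints s ''d'' 0 = d" "ints s ''N'' 0 = length st" "jm_correct s"
    "\<And>i. i < length st \<Longrightarrow> node_ok (st ! i) \<and> slot_ok s i (st ! i)"
    "outp s @ encode (concat (map item_leaves (rev st))) = encode (leaves (n - 1) [1])"
    using inv by (auto simp: stack_ok_def)
  have "st \<noteq> []" using b i(3) by auto
  then obtain st' x where st0: "st = st' @ [x]" by (metis append_butlast_last_id)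
  obtain mu bs where x: "x = (mu, bs)" by force
  note st = st0[unfolded x]
  define p where "p = length st'"
  define s2 where "s2 = set_int ''p'' 0 p (set_int ''N'' 0 p s)"
  have node: "node_ok (mu, bs)" and slot: "slot_ok s p (mu, bs)" using i(5)[of p] by (auto simp: st p_def)
  note nk = node_okD[OF node]
  have C2: "row_cells d s2 = row_cells d s" unfolding s2_def by (rule row_cells_cong) simp
  have same2: "same_slot s s2 j" for j using C2 by (simp add: same_slot_def s2_def)
  have slot2: "slot_ok s2 p (mu, bs)" using slot_ok_same[OF same2 _ slot] nk by simp
  have st2: "node_ok (st' ! j) \<and> slot_ok s2 j (st' ! j)" if "j < p" for j
  proof -
    have "node_ok (st' ! j)" "slot_ok s j (st' ! j)" using i(5)[of j] that by (auto simp: st p_def nth_append)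
    then show ?thesis
      using slot_ok_same[OF same2, of "st' ! j" j] node_okD(5)[of "fst (st' ! j)" "snd (st' ! j)"] by simp
  qed
  have fx2: "ints s2 ''p'' 0 = p" "ints s2 ''n'' 0 = n" "ints s2 ''d'' 0 = d" "ints s2 ''N'' 0 = p" "outp s2 = outp s"
    "jm_correct s2" using i by (simp_all add: s2_def jm_correct_def)
  have sl2: "ints s2 ''D'' p = length bs" "ints s2 ''K'' p = sum_list mu" "ints s2 ''R'' p = length mu"
    "\<And>r. r < length mu \<Longrightarrow> ints s2 ''P'' (p * n + r) = mu ! r" using slot2 by (auto simp: slot_ok_def)
  have out: "outp s @ encode (item_leaves (mu, bs)) @ encode (concat (map item_leaves (rev st'))) = encode (leaves (n - 1) [1])"
    using i(6) by (simp add: st encode_append)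
  have pot: "potential st = potential st' + weight (mu, bs)" by (simp add: potential_def st)
  have dim: "fun_space.dim (W mu) = length bs" using nk(4) by (simp add: spans_def)
  have start2: "set_int ''p'' (ival (IConst 0) (set_int ''N'' (ival (IConst 0) s) (ival (ISub (sv ''N'') (IConst 1)) s) s))
      (ival (sv ''N'') (set_int ''N'' (ival (IConst 0) s) (ival (ISub (sv ''N'') (IConst 1)) s) s))
      (set_int ''N'' (ival (IConst 0) s) (ival (ISub (sv ''N'') (IConst 1)) s) s) = s2"
    using i(3) by (simp add: s2_def p_def st)
  have bv: "bval (IEq (IGet ''D'' (sv ''p'')) (IConst 0)) s2 \<longleftrightarrow> length bs = 0"
    "bval (IEq (IGet ''K'' (sv ''p'')) (sv ''n'')) s2 \<longleftrightarrow> sum_list mu = n"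
    using fx2 sl2 by simp_all
  let ?m = "length bs * (20000 * (d ^ 2 + n))"
  define Post where "Post t s' \<longleftrightarrow> (\<exists>st'. stack_ok st' s' \<and>
    1 + bcost (ILess (IConst 0) (sv ''N'')) + t + potential st' \<le> potential st)" for t s'
  let ?pre = "\<lambda>t. 1 + (1 + icost (IConst 0) + icost (ISub (sv ''N'') (IConst 1))) +
    (1 + (1 + icost (IConst 0) + icost (sv ''N'')) + (1 + bcost (IEq (IGet ''D'' (sv ''p'')) (IConst 0)) + t))"
  let ?mid = "\<lambda>t. 1 + bcost (IEq (IGet ''K'' (sv ''p'')) (sv ''n'')) + t"
  have "wp step_program Post s"
    unfolding step_program_def wp_Seq wp_IAssign start2 wp_If bv
  proof (split if_split, intro conjI impI)
    assume "length bs = 0"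
    then have "item_leaves (mu, bs) = []" using dim by (cases "n - sum_list mu") (simp_all add: item_leaves_def)
    then have "stack_ok st' s2" using fx2 st2 out by (simp add: stack_ok_def p_def encode_def)
    then show "wp Skip (\<lambda>t. Post (?pre t)) s2"
      unfolding wp_Skip Post_def by (intro exI[of _ st']) (simp add: pot weight_def)
  next
    assume ne: "length bs \<noteq> 0"
    \<comment> \<open>At a leaf the remaining share is large enough to print at most
      \<open>n\<close> parts.\<close>
    then have big: "200 * n + 100 \<le> ?m"
    proof -
      have "1 * (20000 * (d ^ 2 + n)) \<le> ?m" using ne by (intro mult_le_mono1) (cases bs, simp_all)
      moreover have "200 * n + 100 \<le> 1 * (20000 * (d ^ 2 + n))" using nd by simp
      ultimately show ?thesis by (rule le_trans[rotated])
    qed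
    show "if sum_list mu = n
      then wp emit_program (\<lambda>t. Post (?pre (?mid t))) s2
      else wp expand_program (\<lambda>t. Post (?pre (?mid t))) s2"
    proof (split if_split, intro conjI impI)
      assume full: "sum_list mu = n"
      have leaf: "item_leaves (mu, bs) = [(mu, length bs)]" using full ne dim by (simp add: item_leaves_def)
      show "wp emit_program (\<lambda>t. Post (?pre (?mid t))) s2"
      proof (rule wp_framed[OF wp_emit_program[OF fx2(1,2) nd(1) sl2(3) nk(5) sl2(4)]], assumption, elim conjE, unfold sl2)
        fix t and s3 :: state assume t: "t \<le> 100 * n" and o: "outp s3 = outp s2 @ encode [(mu, length bs)]"
          and f: "frame emit_program s2 s3"
        have fx3: "ints s3 ''n'' 0 = n" "ints s3 ''d'' 0 = d" "ints s3 ''N'' 0 = p" "reals s3 ''X'' = reals s2 ''X''"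
          using f fx2 by (auto simp: frame_def)
        have C3: "row_cells d s3 = row_cells d s2" using f by (intro row_cells_cong) (simp add: frame_def)
        have "same_slot s2 s3 j" for j using f C3 by (simp add: same_slot_def frame_def)
        then have "node_ok (st' ! j) \<and> slot_ok s3 j (st' ! j)" if "j < p" for j
          using slot_ok_same[of s2 s3 j "st' ! j"] st2[OF that] node_okD(5)[of "fst (st' ! j)" "snd (st' ! j)"] by simp
        then have "stack_ok st' s3"
          using fx3 fx2 o out leaf by (simp add: stack_ok_def p_def jm_correct_def)
        then show "Post (?pre (?mid t)) s3"
          unfolding Post_def using t full big nd by (intro exI[of _ st']) (simp add: pot weight_def)
      qed
    next
      assume "sum_list mu \<noteq> n"
      then have lt: "sum_list mu < n" using nk(3) by simp
      have ne1: "1 \<le> length bs" using ne by (cases bs) simp_all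
      show "wp expand_program (\<lambda>t. Post (?pre (?mid t))) s2"
      proof (rule wp_framed[OF wp_expand_program[OF fx2(1-3) nd fx2(6) node slot2 lt ne1]], elim conjE exE)
        fix t bs1 bs2 and s3 :: state assume t: "t \<le> 15000 * (length bs * (d ^ 2 + n))" and f: "frame expand_program s2 s3"
          and N: "ints s3 ''N'' 0 = p + 2" and n1: "node_ok (mu @ [1], bs1)" and n2: "node_ok (extend mu, bs2)"
          and s1: "slot_ok s3 (Suc p) (mu @ [1], bs1)" and s2: "slot_ok s3 p (extend mu, bs2)"
          and le: "length bs1 + length bs2 \<le> length bs" and same: "\<forall>i<p. same_slot s2 s3 i"
        \<comment> \<open>The child with the new row lies on top, so its leaves are printed first,
          in the order of \<open>leaves\<close>.\<close>
        let ?st = "st' @ [(extend mu, bs2), (mu @ [1], bs1)]"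
        have fx3: "ints s3 ''n'' 0 = n" "ints s3 ''d'' 0 = d" "reals s3 ''X'' = reals s2 ''X''" "outp s3 = outp s"
          using f fx2 by (auto simp: frame_def expand_program_def)
        have "node_ok (?st ! j) \<and> slot_ok s3 j (?st ! j)" if jp: "j < p + 2" for j
        proof -
          consider "j < p" | "j = p" | "j = Suc p" using jp by linarith
          then show ?thesis
          proof cases
            case 1
            then show ?thesis
              using slot_ok_same[of s2 s3 j "st' ! j"] st2[OF 1] node_okD(5)[of "fst (st' ! j)" "snd (st' ! j)"] same
              by (simp add: nth_append p_def)
          qed (use n1 n2 s1 s2 in \<open>simp_all add: nth_append p_def\<close>)
        qed
        moreover have "item_leaves (mu, bs) = item_leaves (mu @ [1], bs1) @ item_leaves (extend mu, bs2)"
        proof -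
          have "n - sum_list mu = Suc (n - Suc (sum_list mu))" using lt by simp
          then show ?thesis using ne dim sum_list_extend[OF nk(1)] by (simp add: item_leaves_def)
        qed
        ultimately have ok: "stack_ok ?st s3"
          using fx3 fx2 out N by (simp add: stack_ok_def p_def jm_correct_def encode_append)
        have pot': "potential ?st = potential st' + (weight (mu @ [1], bs1) + weight (extend mu, bs2))"
          by (simp add: potential_def)
        define z where "z = n - sum_list mu"
        define y where "y = 20000 * (d ^ 2 + n)"
        have w: "weight (mu @ [1], bs1) + weight (extend mu, bs2) \<le> z * (length bs * y) + 200"
        proof -
          have "weight (mu @ [1], bs1) + weight (extend mu, bs2) = z * ((length bs1 + length bs2) * y) + 200"
            using sum_list_extend[OF nk(1)] by (simp add: weight_def z_def y_def algebra_simps)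
          moreover have "z * ((length bs1 + length bs2) * y) \<le> z * (length bs * y)"
            using le by (intro mult_le_mono2 mult_le_mono1)
          ultimately show ?thesis by simp
        qed
        have w0: "weight (mu, bs) = z * (length bs * y) + length bs * y + 100"
          using lt by (simp add: weight_def z_def y_def Suc_diff_le)
        \<comment> \<open>The factor \<open>20000\<close>, against \<open>15000\<close> for an
          expansion, leaves room for the constant of the additional node and for the tests.\<close>
        have "length bs * y = 20000 * (length bs * (d ^ 2 + n))" by (simp add: y_def)
        moreover have "1 \<le> length bs * (d ^ 2 + n)" using ne1 nd by simp
        ultimately have "t + 200 \<le> length bs * y" using t by linarith
        then show "Post (?pre (?mid t)) s3"
          unfolding Post_def using ok w w0 pot pot' by (intro exI[of _ ?st] conjI) simp_all
      qed
    qed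
  qed
  then show ?thesis by (rule wp_mono) (simp add: Post_def)
qed

text \<open>The search starts with the standard basis, since the first entry imposes no
  condition.\<close>

lemma wp_init_program:
  assumes nd: "1 \<le> n" "1 \<le> d" and s: "ints s ''n'' 0 = n" "ints s ''d'' 0 = d" "jm_correct s"
    "reals s ''B'' = (\<lambda>_. 0)" "outp s = []"
  shows "wp init_program (\<lambda>t s'. t \<le> 200 * d \<and> stack_ok [([1], map unit_fun [0..<d])] s') s"
proof -
  let ?c = "RAssign ''B'' (addr (IConst 0) (sv ''i'') (sv ''i'')) (RNat (IConst 1))"
  let ?for = "For ''i'' (sv ''d'') ?c"
  let ?bs = "map unit_fun [0..<d]"
  define s1 where "s1 = set_int ''N'' 0 1 (set_int ''D'' 0 d (set_int ''P'' 0 1 (set_int ''R'' 0 1 (set_int ''K'' 0 1 s))))"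
  have loop: "wp ?for (\<lambda>t s'. t \<le> d * (2 * (20 + icost (sv ''d'') + 12)) \<and>
      row_cells d s' = (\<lambda>p v x. of_bool (p = 0 \<and> v = x \<and> v < d)) \<and> frame ?for s1 s') s1"
  proof (rule wp_For[where Inv = "\<lambda>i s'. row_cells d s' = (\<lambda>p v x. of_bool (p = 0 \<and> v = x \<and> v < i))"])
    show "ival (sv ''d'') s' = d" if "frame ?for s1 s'" for s' using that s by (simp add: frame_def s1_def)
    show "row_cells d s1 = (\<lambda>p v x. of_bool (p = 0 \<and> v = x \<and> v < 0))"
      using s(4) by (intro HOL.ext) (simp add: row_cells_def s1_def)
    show "row_cells d (set_int ''i'' 0 j s') = (\<lambda>p v x. of_bool (p = 0 \<and> v = x \<and> v < i))"
      if "row_cells d s' = (\<lambda>p v x. of_bool (p = 0 \<and> v = x \<and> v < i))" for i j s'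
      using that row_cells_cong[of "set_int ''i'' 0 j s'" s' d] by simp
    fix i s' assume i: "i < d" and inv: "row_cells d s' = (\<lambda>p v x. of_bool (p = 0 \<and> v = x \<and> v < i))"
      and ii: "ints s' ''i'' 0 = i" and f: "frame ?for s1 s'"
    have "ints s' ''d'' 0 = d" using f s by (simp add: frame_def s1_def)
    then have ix: "ival (addr (IConst 0) (sv ''i'') (sv ''i'')) s' = (0 * d + i) * (2 * d) + i"
      using ii by (simp add: ival_addr[of _ d])
    have i2: "i < 2 * d" using i by simp
    show "wp ?c (\<lambda>t s''. t \<le> 20 \<and> row_cells d s'' = (\<lambda>p v x. of_bool (p = 0 \<and> v = x \<and> v < Suc i))) s'"
      unfolding wp_RAssign ix row_cells_set[OF i i2] inv
      by (auto simp: cell_upd_def icost_addr fun_eq_iff less_Suc_eq)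
  qed (use nd in auto)
  have s1: "set_int ''N'' 0 1 (set_int ''D'' 0 (ints (set_int ''P'' 0 1 (set_int ''R'' 0 1 (set_int ''K'' 0 1 s))) ''d'' 0)
      (set_int ''P'' 0 1 (set_int ''R'' 0 1 (set_int ''K'' 0 1 s)))) = s1"
    using s by (simp add: s1_def)
  have spans: "spans ?bs (W [1])"
    using supp_space_span[OF finite_I] dim_supp_space[OF finite_I]
    unfolding spans_def W_singleton by (simp add: lessThan_atLeast0)
  show ?thesis
    unfolding init_program_def wp_Seq wp_IAssign ival.simps s1
  proof (rule wp_mono[OF loop], elim conjE, goal_cases)
    case (1 t s')
    have "t + 40 \<le> 200 * d" using 1(1) nd by simp
    moreover have "stack_ok [([1], ?bs)] s'"
      unfolding stack_ok_def
    proof (intro conjI allI impI)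
      have fx: "ints s' y = ints s1 y" if "y \<noteq> ''i''" for y using 1 that by (simp add: frame_def)
      show "ints s' ''n'' 0 = n" "ints s' ''d'' 0 = d" "ints s' ''N'' 0 = length [([1], ?bs)]"
        using s fx by (simp_all add: s1_def)
      have "reals s' ''X'' = reals s ''X''" using 1 by (simp add: frame_def s1_def)
      then show "jm_correct s'" using s(3) by (simp add: jm_correct_def)
      have "outp s' = []" using 1 s(5) by (simp add: frame_def s1_def)
      then show "outp s' @ encode (concat (map item_leaves (rev [([1], ?bs)]))) = encode (leaves (n - 1) [1])"
        by (simp add: item_leaves_def)
      fix j assume "j < length [([1 :: nat], ?bs)]"
      then have j: "j = 0" by simp
      show "node_ok ([([1], ?bs)] ! j)" using spans nd by (simp add: j node_ok_def)
      show "slot_ok s' j ([([1], ?bs)] ! j)"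
      proof -
        have "row_cells d s' 0 v x = (?bs ! v) x" if "v < d" for v x
          using 1(2) that by (auto simp: unit_fun_def)
        then show ?thesis using fx by (simp add: j slot_ok_def s1_def)
      qed
    qed
    ultimately show ?case by simp
  qed
qed

end

theorem corollary3:
  shows "\<exists>(C::nat) (prog::com). \<forall>(n::nat) (d::nat) (\<rho> :: (nat \<Rightarrow> nat) \<Rightarrow> real mat).
    1 \<le> n \<longrightarrow> 1 \<le> d \<longrightarrow> \<rho> \<in> hom (sym_group n) (orthogonal_group d) \<longrightarrow>
    (\<exists>t s ps.
       exec prog (init_state n d (\<lambda>l. \<rho> (Transposition.transpose l (Suc l)))) t s \<and>
       t \<le> C * n ^ 2 * d ^ 3 \<and>
       outp s = encode ps \<and>
       distinct (map fst ps) \<and>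
       set ps = {(la, a). la \<in> partitions n \<and> 1 \<le> a \<and> has_multiplicity n d \<rho> la a})"
proof (rule exI[of _ 100000], rule exI[of _ algorithm], intro allI impI)
  fix n d :: nat and rho :: "(nat \<Rightarrow> nat) \<Rightarrow> real mat"
  assume nd: "1 \<le> n" "1 \<le> d" and rho: "rho \<in> hom (sym_group n) (orthogonal_group d)"
  interpret orthogonal_rep n d rho by unfold_locales (rule rho)
  let ?b = "ILess (IConst 0) (sv ''N'')"
  let ?st = "[([1], map unit_fun [0..<d])]"
  have main: "wp (While ?b step_program) (\<lambda>t s'. \<exists>st. stack_ok st s' \<and> \<not> bval ?b s' \<and>
      t + potential st \<le> potential ?st + (1 + bcost ?b)) s" if "stack_ok ?st s" for s
    by (rule wp_While[where Inv = stack_ok and Phi = potential, OF wp_step_program[OF nd] that])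
  have "wp algorithm (\<lambda>t s. t \<le> 100000 * n ^ 2 * d ^ 3 \<and> outp s = encode (leaves (n - 1) [1])) start"
    unfolding algorithm_def wp_Seq
  proof (rule wp_mono[OF wp_jm_program[OF nd]], elim conjE, goal_cases)
    case (1 t1 s1)
    have s1: "ints s1 ''n'' 0 = n" "ints s1 ''d'' 0 = d" "jm_correct s1" "reals s1 ''B'' = (\<lambda>_. 0)" "outp s1 = []"
      using 1 by (auto simp: frame_def jm_program_def init_state_def)
    show ?case
    proof (rule wp_mono[OF wp_init_program[OF nd s1]], elim conjE, goal_cases)
      case (1 t2 s2)
      show ?case
      proof (rule wp_mono[OF main[OF 1(2)]], elim exE conjE, goal_cases)
        case (1 t3 s3 st)
        then have "st = []" by (simp add: stack_ok_def)
        then have out: "outp s3 = encode (leaves (n - 1) [1])" using 1 by (simp add: stack_ok_def encode_def)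
        define N where "N = n ^ 2 * d ^ 3"
        have p1: "n * d ^ 3 \<le> N" unfolding N_def using nd by (simp add: power2_eq_square)
        have p2: "d \<le> N"
        proof -
          have "1 * d ^ 1 \<le> n ^ 2 * d ^ 3" using nd by (intro mult_le_mono power_increasing) simp_all
          then show ?thesis by (simp add: N_def)
        qed
        have p3: "n * (d * n) \<le> N"
        proof -
          have "n ^ 2 * d ^ 1 \<le> n ^ 2 * d ^ 3" using nd by (intro mult_le_mono power_increasing) simp_all
          then show ?thesis by (simp add: N_def power2_eq_square ac_simps)
        qed
        \<comment> \<open>The root pays for \<open>n\<close> levels and \<open>d\<close> basis
          vectors. The second term comes from handling the compositions and is the only one
          quadratic in \<open>n\<close>.\<close>
        have "potential ?st = 20000 * (n * d ^ 3) + 20000 * (n * (d * n)) + 100"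
          by (simp add: potential_def weight_def power2_eq_square power3_eq_cube algebra_simps)
        then have "t3 \<le> 20000 * (n * d ^ 3) + 20000 * (n * (d * n)) + 200" using 1 by simp
        moreover have "t1 \<le> 10000 * (n * d ^ 3)" using \<open>t1 \<le> 10000 * n * d ^ 3\<close> by (simp add: mult.assoc)
        moreover have "t2 \<le> 200 * d" using \<open>t2 \<le> 200 * d\<close> .
        \<comment> \<open>The matrices account for \<open>10000\<close>, each of the two terms of
          the search for \<open>20000\<close>, and the setup for a few hundred; the constant is
          rounded up.\<close>
        ultimately have "1 + t1 + (1 + t2 + t3) \<le> 100000 * N" using p1 p2 p3 nd by linarith
        then show ?case using out by (simp add: N_def mult.assoc)
      qed
    qed
  qed
  then obtain t s where "exec algorithm start t s" "t \<le> 100000 * n ^ 2 * d ^ 3" "outp s = encode (leaves (n - 1) [1])"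
    by (auto simp: wp_def)
  moreover have "distinct (map fst (leaves (n - 1) [1]))" by (rule distinct_leaves) simp_all
  ultimately show "\<exists>t s ps. exec algorithm start t s \<and> t \<le> 100000 * n ^ 2 * d ^ 3 \<and> outp s = encode ps \<and>
      distinct (map fst ps) \<and> set ps = {(la, a). la \<in> partitions n \<and> 1 \<le> a \<and> has_multiplicity n d rho la a}"
    using leaves_multiplicities[OF nd(1)] by blast
qed

end
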